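(* Let $d\ge 1$, $\varepsilon>0$, and let $\mu,\nu$ be probability measures on $\mathbb{R}^d$. Assume (A1), (A2), (A3) from the context, with constants $c_\mu,c_\nu,\alpha_\mu,\alpha_\nu$, $p,C_p$, $t_0,\delta,C_\psi,\gamma$ as there. Put $\tilde\delta:=\min\{\delta,t_0/2\}$ and, for $n\ge 5$, $$r_n^\mu:=\Big[4p\,c_\mu^{-1}(c_\mu^{-1}\vee 1)\Big(\frac{p}{\alpha_\mu}\vee 1\Big)^2\log(n)\Big]^{\frac1{\alpha_\mu}},\qquad r_n^\nu:=\Big[4p\,c_\nu^{-1}(c_\nu^{-1}\vee 1)\Big(\frac{p}{\alpha_\nu}\vee 1\Big)^2\log(n)\Big]^{\frac1{\alpha_\nu}},$$ $$B_n^\mu:=B_{r_n^\mu}(0)\cap\mathrm{spt}(\mu),\qquad B_n^\nu:=B_{r_n^\nu}(0)\cap\mathrm{spt}(\nu).$$ Then there is a constant $C$ depending only on $\alpha_\mu,\alpha_\nu,p,C_p,t_0$ such that for all $n\ge 5$ $$\mathbb{E}\big[|\mathcal{C}_\varepsilon(\mu_n,\nu_n)-\mathcal{C}_\varepsilon(\mu,\nu)|\big]\le \frac{C}{\sqrt n}\Big(1+c_\mu^{-\frac p{\alpha_\mu}}+c_\nu^{-\frac p{\alpha_\nu}}\Big)+\frac{C}{\sqrt n}\big(\varepsilon+(r_n^\mu+r_n^\nu)^p\big)\cdot\left(1+e^{\frac{C_\psi\tilde\delta}{2(t_0/2)^\gamma}}\sqrt{\mathcal N\Big(B_n^\mu,\frac{\tilde\delta\varepsilon}{2C_p(r_n^\mu+r_n^\nu)^{p-1}}\Big)\wedge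 \mathcal N\Big(B_n^\nu,\frac{\tilde\delta\varepsilon}{2C_p(r_n^\mu+r_n^\nu)^{p-1}}\Big)}\right).$$
   Context: $|\cdot|$ is the Euclidean norm on $\mathbb{R}^d$, $B_r(x)$ the open ball of radius $r$ around $x$, $B_r=B_r(0)$, $A^c$ the complement of $A$, $\mathrm{spt}$ the support; $a\vee b$ and $a\wedge b$ denote maximum and minimum. Regularized optimal transport: for a cost $c:\mathbb{R}^d\times\mathbb{R}^d\to\mathbb{R}$, $\varphi:[0,\infty)\to\mathbb{R}$ and $\varepsilon>0$, $$\mathcal C_\varepsilon(\mu,\nu):=\inf_{\pi\in\Pi(\mu,\nu)}\int c\,d\pi+\varepsilon D_\varphi(\pi|\mu\otimes\nu),$$ where $\Pi(\mu,\nu)$ is the set of couplings of $\mu$ and $\nu$, $\mu\otimes\nu$ is the product measure, and $D_\varphi(\pi|\rho)=\int\varphi(d\pi/d\rho)\,d\rho$ if $\pi\ll\rho$ and $+\infty$ otherwise. Samples: $X_1,\dots,X_n$ are i.i.d. with law $\mu$, $Y_1,\dots,Y_n$ are i.i.d. with law $\nu$, and the two samples are independent of each other; $\mu_n=\frac1n\sum_{i=1}^n\delta_{X_i}$, $\nu_n=\frac1n\sum_{i=1}^n\delta_{Y_i}$. Covering number: $\mathcal N(A,\eta):=\min\{k\in\mathbb N:\ \exists x_1,\dots,x_k\in\mathbb{R}^d,\ A\subseteq\bigcup_{\ell=1}^kB_\eta(x_\ell)\}$. Assumptions: (A1) There are $c_\mu,c_\nu>0$ and $\alpha_\mu,\alpha_\nu\ge1$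 with $\mu(B_r^c)\le 2\exp(-c_\mu r^{\alpha_\mu})$ and $\nu(B_s^c)\le2\exp(-c_\nu s^{\alpha_\nu})$ for all $r,s>0$. (A2) $c(x,y)=h(|x-y|)$ for some continuous $h:[0,\infty)\to[0,\infty)$ with $h(0)=0$, and there are $p\ge1$, $C_p>0$ such that $|h(t)-h(t')|\le C_p(t\vee t')^{p-1}|t-t'|$ for all $t,t'>0$. (A3) $\varphi:[0,\infty)\to\mathbb{R}$ is strictly convex, $\varphi(1)=0$, $\lim_{x\to\infty}\varphi(x)/x=+\infty$, and $\psi(y):=\sup_{x\ge0}\{xy-\varphi(x)\}$ is in $C^1(\mathbb{R})$. There exist $t_0>0$ and $\delta\in(0,t_0)$ such that $\psi'(t_0)=1$ and $\psi$ is strictly convex and $C^2$ on $[t_0-\delta,\infty)$; and there exist $C_\psi>0$, $\gamma\ge0$ such that $|\psi''(x)/\psi'(x)|\le C_\psi/|x|^\gamma$ for all $x\in[t_0-\delta,\infty)$. *)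

theory Defs
  imports "HOL-Probability.Probability"
begin

section \<open>The space \<open>\<real>\<^sup>d\<close> for a natural number \<open>d\<close>\<close>

text \<open>
  The dimension \<open>d\<close> is a term and not a type, so that a constant can be quantified
  \<^emph>\<open>before\<close> the dimension.  A point of \<open>\<real>\<^sup>d\<close> is an extensional function on
  \<open>{..<d}\<close>, and \<open>Rd d\<close> carries the Borel (product) sigma-algebra.  Only the space and the
  sigma-algebra of \<open>Rd d\<close> are ever used, never its (arbitrary) measure.
\<close>

definition Rd :: "nat \<Rightarrow> (nat \<Rightarrow> real) measure" where
  "Rd d = Pi\<^sub>M {..<d} (\<lambda>_. borel)"

definition dist_Rd :: "nat \<Rightarrow> (nat \<Rightarrow> real) \<Rightarrow> (nat \<Rightarrow> real) \<Rightarrow> real" where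
  "dist_Rd d x y = L2_set (\<lambda>i. x i - y i) {..<d}"

definition zero_Rd :: "nat \<Rightarrow> nat \<Rightarrow> real" where
  "zero_Rd d = (\<lambda>i\<in>{..<d}. 0)"

definition ball_Rd :: "nat \<Rightarrow> (nat \<Rightarrow> real) \<Rightarrow> real \<Rightarrow> (nat \<Rightarrow> real) set" where
  "ball_Rd d x r = {y \<in> space (Rd d). dist_Rd d x y < r}"

definition spt :: "nat \<Rightarrow> (nat \<Rightarrow> real) measure \<Rightarrow> (nat \<Rightarrow> real) set" where
  "spt d \<mu> = {x \<in> space (Rd d). \<forall>r>0. emeasure \<mu> (ball_Rd d x r) > 0}"

definition covering_number :: "nat \<Rightarrow> (nat \<Rightarrow> real) set \<Rightarrow> real \<Rightarrow> nat" where
  "covering_number d A \<eta> =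
    (LEAST k. \<exists>x. (\<forall>l<k. x l \<in> space (Rd d)) \<and> A \<subseteq> (\<Union>l<k. ball_Rd d (x l) \<eta>))"

definition prob_on_Rd :: "nat \<Rightarrow> (nat \<Rightarrow> real) measure \<Rightarrow> bool" where
  "prob_on_Rd d \<mu> \<longleftrightarrow> prob_space \<mu> \<and> sets \<mu> = sets (Rd d)"


section \<open>Regularized optimal transport\<close>

text \<open>
  Integral of a real function with values in the extended reals, as positive part minus
  negative part.  It is meaningful whenever one of the parts is finite; a convex \<open>\<phi>\<close> with
  superlinear growth and a nonnegative cost are bounded below, so in the theorem the negative
  parts are finite.
\<close>

definition ext_integral :: "'a measure \<Rightarrow> ('a \<Rightarrow> real) \<Rightarrow> ereal" where
  "ext_integral M f =
    enn2ereal (\<integral>\<^sup>+ x. ennreal (f x) \<partial>M) - enn2ereal (\<integral>\<^sup>+ x. ennreal (- f x) \<partial>M)"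

definition couplings :: "'a measure \<Rightarrow> 'b measure \<Rightarrow> ('a \<times> 'b) measure set" where
  "couplings \<mu> \<nu> =
    {\<pi>. sets \<pi> = sets (\<mu> \<Otimes>\<^sub>M \<nu>) \<and> distr \<pi> \<mu> fst = \<mu> \<and> distr \<pi> \<nu> snd = \<nu>}"

text \<open>Functions on \<open>[0,\<infinity>)\<close> are total functions whose values at negative arguments are
  irrelevant.\<close>

definition phi_divergence :: "(real \<Rightarrow> real) \<Rightarrow> 'a measure \<Rightarrow> 'a measure \<Rightarrow> ereal" where
  "phi_divergence \<phi> \<pi> \<rho> =
    (if absolutely_continuous \<rho> \<pi>
     then ext_integral \<rho> (\<lambda>z. \<phi> (enn2real (RN_deriv \<rho> \<pi> z)))
     else \<infinity>)"

definition reg_OT ::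
    "('a \<Rightarrow> 'b \<Rightarrow> real) \<Rightarrow> (real \<Rightarrow> real) \<Rightarrow> real \<Rightarrow> 'a measure \<Rightarrow> 'b measure \<Rightarrow> ereal" where
  "reg_OT c \<phi> \<epsilon> \<mu> \<nu> =
    (INF \<pi>\<in>couplings \<mu> \<nu>.
       ext_integral \<pi> (\<lambda>(x, y). c x y) + ereal \<epsilon> * phi_divergence \<phi> \<pi> (\<mu> \<Otimes>\<^sub>M \<nu>))"


section \<open>Samples\<close>

text \<open>The empirical measure is the image of the uniform distribution on the indices.\<close>

definition empirical_measure :: "'a measure \<Rightarrow> nat \<Rightarrow> (nat \<Rightarrow> 'a) \<Rightarrow> 'a measure" where
  "empirical_measure M n x = distr (uniform_count_measure {..<n}) M x"

definition iid_sample ::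
    "'w measure \<Rightarrow> 'a measure \<Rightarrow> nat \<Rightarrow> (nat \<Rightarrow> 'w \<Rightarrow> 'a) \<Rightarrow> bool" where
  "iid_sample P \<mu> n X \<longleftrightarrow>
    prob_space.indep_vars P (\<lambda>_. \<mu>) X {..<n} \<and> (\<forall>i<n. distr P \<mu> (X i) = \<mu>)"

definition indep_samples ::
    "'w measure \<Rightarrow> 'a measure \<Rightarrow> 'a measure \<Rightarrow> nat
      \<Rightarrow> (nat \<Rightarrow> 'w \<Rightarrow> 'a) \<Rightarrow> (nat \<Rightarrow> 'w \<Rightarrow> 'a) \<Rightarrow> bool" where
  "indep_samples P \<mu> \<nu> n X Y \<longleftrightarrow>
    prob_space.indep_var P
      (Pi\<^sub>M {..<n} (\<lambda>_. \<mu>)) (\<lambda>\<omega>. \<lambda>i\<in>{..<n}. X i \<omega>)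
      (Pi\<^sub>M {..<n} (\<lambda>_. \<nu>)) (\<lambda>\<omega>. \<lambda>i\<in>{..<n}. Y i \<omega>)"


section \<open>Assumptions\<close>

definition tail_assumption ::
    "nat \<Rightarrow> (nat \<Rightarrow> real) measure \<Rightarrow> real \<Rightarrow> real \<Rightarrow> bool" where
  "tail_assumption d \<mu> c\<^sub>\<mu> \<alpha> \<longleftrightarrow>
    c\<^sub>\<mu> > 0 \<and> \<alpha> \<ge> 1 \<and>
    (\<forall>r>0. measure \<mu> (space (Rd d) - ball_Rd d (zero_Rd d) r) \<le> 2 * exp (- c\<^sub>\<mu> * r powr \<alpha>))"

definition cost_assumption ::
    "nat \<Rightarrow> ((nat \<Rightarrow> real) \<Rightarrow> (nat \<Rightarrow> real) \<Rightarrow> real) \<Rightarrow> real \<Rightarrow> real \<Rightarrow> bool" where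
  "cost_assumption d c p C\<^sub>p \<longleftrightarrow>
    p \<ge> 1 \<and> C\<^sub>p > 0 \<and>
    (\<exists>h :: real \<Rightarrow> real.
       continuous_on {0..} h \<and> (\<forall>t\<ge>0. h t \<ge> 0) \<and> h 0 = 0 \<and>
       (\<forall>x\<in>space (Rd d). \<forall>y\<in>space (Rd d). c x y = h (dist_Rd d x y)) \<and>
       (\<forall>t>0. \<forall>t'>0. \<bar>h t - h t'\<bar> \<le> C\<^sub>p * max t t' powr (p - 1) * \<bar>t - t'\<bar>))"

definition strictly_convex_on :: "real set \<Rightarrow> (real \<Rightarrow> real) \<Rightarrow> bool" where
  "strictly_convex_on S f \<longleftrightarrow>
    convex S \<and>
    (\<forall>x\<in>S. \<forall>y\<in>S. \<forall>u. x \<noteq> y \<and> 0 < u \<and> u < 1 \<longrightarrow>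
       f ((1 - u) * x + u * y) < (1 - u) * f x + u * f y)"

text \<open>For \<open>\<phi>\<close> convex with superlinear growth the set below is bounded above for every \<open>y\<close>,
  so the supremum is the true one.\<close>

definition conjugate :: "(real \<Rightarrow> real) \<Rightarrow> real \<Rightarrow> real" where
  "conjugate \<phi> y = (SUP x\<in>{0..}. x * y - \<phi> x)"

text \<open>
  Second derivatives on \<open>[t\<^sub>0-\<delta>,\<infinity>)\<close> are one-sided at the left end point.  The derivative in
  the denominator cannot vanish on \<open>[t\<^sub>0-\<delta>,\<infinity>)\<close>: it is positive to the right of the end
  point by strict convexity and monotonicity of the conjugate, and the bound on the
  logarithmic derivative then keeps it away from \<open>0\<close> at the end point.
\<close>

definition divergence_assumption ::
    "(real \<Rightarrow> real) \<Rightarrow> real \<Rightarrow> real \<Rightarrow> real \<Rightarrow> real \<Rightarrow> bool" where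
  "divergence_assumption \<phi> t\<^sub>0 \<delta> C\<^sub>\<psi> \<gamma> \<longleftrightarrow>
    strictly_convex_on {0..} \<phi> \<and> \<phi> 1 = 0 \<and>
    filterlim (\<lambda>x. \<phi> x / x) at_top at_top \<and>
    conjugate \<phi> C1_differentiable_on UNIV \<and>
    t\<^sub>0 > 0 \<and> 0 < \<delta> \<and> \<delta> < t\<^sub>0 \<and>
    deriv (conjugate \<phi>) t\<^sub>0 = 1 \<and>
    strictly_convex_on {t\<^sub>0 - \<delta>..} (conjugate \<phi>) \<and>
    C\<^sub>\<psi> > 0 \<and> \<gamma> \<ge> 0 \<and>
    (\<exists>\<psi>'' :: real \<Rightarrow> real.
       (\<forall>x\<in>{t\<^sub>0 - \<delta>..}.
          (deriv (conjugate \<phi>) has_real_derivative \<psi>'' x) (at x within {t\<^sub>0 - \<delta>..})) \<and>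
       continuous_on {t\<^sub>0 - \<delta>..} \<psi>'' \<and>
       (\<forall>x\<in>{t\<^sub>0 - \<delta>..}. \<bar>\<psi>'' x / deriv (conjugate \<phi>) x\<bar> \<le> C\<^sub>\<psi> / \<bar>x\<bar> powr \<gamma>))"

definition trunc_radius :: "real \<Rightarrow> real \<Rightarrow> real \<Rightarrow> nat \<Rightarrow> real" where
  "trunc_radius p c\<^sub>\<mu> \<alpha> n =
    (4 * p * inverse c\<^sub>\<mu> * max (inverse c\<^sub>\<mu>) 1 * (max (p / \<alpha>) 1)\<^sup>2 * ln (real n)) powr (1 / \<alpha>)"

end

theory Submission
  imports Defs
begin

text \<open>
  Replace the cost by \<open>h (min R |T x - T' y|)\<close>, where \<open>R\<close> is the sum of the two truncation radii
  and \<open>T\<close>, \<open>T'\<close> map into finite nets of \<open>B\<^sub>\<mu>\<close> and \<open>B\<^sub>\<nu>\<close>.  By stability of the value in the cost,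
  the price is the tail moments of \<open>\<mu>\<close>, \<open>\<nu>\<close> and of their empirical versions, and now both the
  population and the empirical problem are finite-dimensional, with the same cost matrix and
  different weights.  For these there are dual potentials bounded by \<open>\<epsilon> t\<^sub>0 + C\<^sub>p R\<^sup>p\<close>.
  Comparing the two concave dual problems at the population potentials, to first order from above
  and by optimality from below, bounds the error by empirical averages of centered functions.
  These are of order \<open>1 / sqrt n\<close> times the \<open>L\<^sup>2\<close> norm of the optimal density \<open>p\<close>.  On each covering
  ball the density is, where it exceeds \<open>1\<close>, at most \<open>exp (C\<^sub>\<psi> \<delta>' / (t\<^sub>0/2)\<^sup>\<gamma>)\<close> times its value
  at the center, and \<open>p\<close> has unit marginals also at the centers, so that the squared norm is at most
  \<open>1\<close> plus that factor times the covering number.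
\<close>

section \<open>The conjugate function\<close>

text \<open>The obstacle is that the empirical potentials are random, so a direct estimate would
  need uniform control over a class of functions. Linearizing at the population potentials avoids
  this: the empirical potentials enter only through sup bounds on their difference from the
  population ones, and what remains are averages of fixed functions, for which a variance
  computation suffices. Where weights of one sample multiply fluctuations of the other, independence
  lets the expectation factor.

  The nets can be as fine as wanted, because their cardinality never enters the bound: the density
  is controlled only through the covering centers, adjoined to the index sets as points that may
  have weight zero. Truncation at \<open>R\<close> makes the cost Lipschitz with constant
  \<open>L\<close>, and the covering radius is chosen so that \<open>L\<close> times it is
  \<open>\<delta>' * \<epsilon> / 2\<close>. Passing to a center changes cost and potential by that
  much each, hence lowers the argument of \<open>\<psi>'\<close> by at most
  \<open>\<delta>'\<close>; from a value at least \<open>t\<^sub>0\<close> this stays where the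
  bound on the logarithmic derivative holds. The theorem shows half of the exponent because the norm
  is the square root of what is estimated.\<close>

locale divergence =
  fixes \<phi> :: "real \<Rightarrow> real" and t\<^sub>0 \<delta> C\<^sub>\<psi> \<gamma> :: real
  assumes divergence: "divergence_assumption \<phi> t\<^sub>0 \<delta> C\<^sub>\<psi> \<gamma>"
begin

abbreviation \<psi> :: "real \<Rightarrow> real" where "\<psi> \<equiv> conjugate \<phi>"
abbreviation \<psi>' :: "real \<Rightarrow> real" where "\<psi>' \<equiv> deriv (conjugate \<phi>)"

lemma t0_pos: "t\<^sub>0 > 0" and delta_pos: "0 < \<delta>"
  and psi'_t0: "\<psi>' t\<^sub>0 = 1" and phi_1: "\<phi> 1 = 0" and C_psi_pos: "C\<^sub>\<psi> > 0" and gamma_nonneg: "\<gamma> \<ge> 0"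
  using divergence by (auto simp: divergence_assumption_def)

lemma phi_convex: "convex_on {0..} \<phi>"
proof (rule convex_onI)
  fix t x y :: real assume t: "0 < t" "t < 1" and xy: "x \<in> {0..}" "y \<in> {0..}"
  then show "\<phi> ((1 - t) *\<^sub>R x + t *\<^sub>R y) \<le> (1 - t) * \<phi> x + t * \<phi> y"
  proof (cases "x = y")
    case True
    then show ?thesis by (simp add: algebra_simps)
  next
    case False
    have "\<forall>x\<in>{0..}. \<forall>y\<in>{0..}. \<forall>u. x \<noteq> y \<and> 0 < u \<and> u < 1 \<longrightarrow>
       \<phi> ((1 - u) * x + u * y) < (1 - u) * \<phi> x + u * \<phi> y"
      using divergence unfolding divergence_assumption_def strictly_convex_on_def by blast
    with False t xy show ?thesis by (simp add: less_imp_le)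
  qed
qed auto

text \<open>Only interior points: at \<open>0\<close> the function may jump or have an infinite
  slope, as for x log x.\<close>

lemma phi_subgradient:
  assumes "x > 0" obtains b where "\<And>z. z \<ge> 0 \<Longrightarrow> \<phi> x + b * (z - x) \<le> \<phi> z"
proof -
  have "x \<in> interior {0..}" using assms by (simp add: interior_real_atLeast)
  from convex_le_Inf_differential[OF phi_convex this] show thesis
    by (intro that) auto
qed

text \<open>For large \<open>x\<close> superlinear growth makes the expression nonpositive; on the
  remaining bounded range the supporting line of \<open>\<phi>\<close> at \<open>1\<close> controls
  it. Without boundedness the real-valued \<open>SUP\<close> in \<open>conjugate\<close> would not
  be a true supremum.\<close>

lemma bdd_above_conjugate: "bdd_above ((\<lambda>x. x * y - \<phi> x) ` {0..})"
proof -
  obtain b where b: "\<And>z. z \<ge> 0 \<Longrightarrow> \<phi> 1 + b * (z - 1) \<le> \<phi> z"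
    using phi_subgradient[of 1] by auto
  have "filterlim (\<lambda>x. \<phi> x / x) at_top at_top"
    using divergence by (auto simp: divergence_assumption_def)
  then have "eventually (\<lambda>x. \<phi> x / x \<ge> y) at_top" by (auto simp: filterlim_at_top)
  then obtain N where N: "\<And>x. x \<ge> N \<Longrightarrow> \<phi> x / x \<ge> y" by (auto simp: eventually_at_top_linorder)
  define m where "m = max N 1"
  show ?thesis
  proof (rule bdd_aboveI2)
    fix x :: real assume "x \<in> {0..}"
    then have x: "0 \<le> x" by simp
    show "x * y - \<phi> x \<le> m * \<bar>y\<bar> + \<bar>b\<bar> * (m + 1) + \<bar>\<phi> 1\<bar>"
    proof (cases "x \<ge> m")
      case True
      then have "y \<le> \<phi> x / x" "x > 0" using N by (auto simp: m_def)
      then have "x * y - \<phi> x \<le> 0" by (simp add: field_simps)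
      then show ?thesis using x True by (intro order.trans[OF \<open>x * y - \<phi> x \<le> 0\<close>] add_nonneg_nonneg mult_nonneg_nonneg) (auto simp: m_def)
    next
      case False
      then have "x * \<bar>y\<bar> \<le> m * \<bar>y\<bar>" by (intro mult_right_mono) auto
      moreover have "x * y \<le> x * \<bar>y\<bar>" using x by (intro mult_left_mono) auto
      moreover have "\<bar>b * (x - 1)\<bar> \<le> \<bar>b\<bar> * (m + 1)"
        unfolding abs_mult using False x by (intro mult_left_mono) (auto simp: m_def)
      ultimately show ?thesis using b[OF x] by linarith
    qed
  qed
qed

lemma Fenchel_Young: "x \<ge> 0 \<Longrightarrow> x * y - \<phi> x \<le> \<psi> y"
  unfolding conjugate_def by (rule cSUP_upper[OF _ bdd_above_conjugate]) auto

lemma conjugate_le: "(\<And>x. x \<ge> 0 \<Longrightarrow> x * y - \<phi> x \<le> u) \<Longrightarrow> \<psi> y \<le> u"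
  unfolding conjugate_def by (rule cSUP_least) auto

lemma DERIV_psi: "(\<psi> has_real_derivative \<psi>' x) (at x)"
proof -
  have "\<psi> C1_differentiable_on UNIV" using divergence by (auto simp: divergence_assumption_def)
  then show ?thesis
    using C1_differentiable_on_eq DERIV_deriv_iff_real_differentiable by blast
qed

lemma continuous_on_psi: "continuous_on A \<psi>"
  using DERIV_psi by (meson DERIV_isCont continuous_at_imp_continuous_on)

lemma continuous_on_psi': "continuous_on A \<psi>'"
proof -
  have "\<psi> C1_differentiable_on UNIV" using divergence by (auto simp: divergence_assumption_def)
  then obtain D where D: "\<And>x. (\<psi> has_vector_derivative D x) (at x)" "continuous_on UNIV D"
    unfolding C1_differentiable_on_def by auto
  then have "\<psi>' = D"
    by (intro ext DERIV_imp_deriv) (simp add: has_real_derivative_iff_has_vector_derivative)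
  then show ?thesis using D(2) continuous_on_subset by blast
qed

lemma psi_convex: "convex_on UNIV \<psi>"
proof (rule convex_onI)
  fix t x y :: real assume t: "0 < t" "t < 1"
  show "\<psi> ((1 - t) *\<^sub>R x + t *\<^sub>R y) \<le> (1 - t) * \<psi> x + t * \<psi> y"
  proof (rule conjugate_le)
    fix z :: real assume "z \<ge> 0"
    then have "(1 - t) * (z * x - \<phi> z) + t * (z * y - \<phi> z) \<le> (1 - t) * \<psi> x + t * \<psi> y"
      using t by (intro add_mono mult_left_mono Fenchel_Young) auto
    then show "z * ((1 - t) *\<^sub>R x + t *\<^sub>R y) - \<phi> z \<le> (1 - t) * \<psi> x + t * \<psi> y"
      by (simp add: algebra_simps)
  qed
qed auto

lemma psi_tangent: "\<psi> a + \<psi>' a * (b - a) \<le> \<psi> b"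
  using convex_on_imp_above_tangent[OF psi_convex, of a b "\<psi>' a"] DERIV_psi[of a] by simp

lemma psi'_mono: "a \<le> b \<Longrightarrow> \<psi>' a \<le> \<psi>' b"
proof -
  assume "a \<le> b"
  have "(\<psi>' b - \<psi>' a) * (b - a) \<ge> 0"
    using psi_tangent[of a b] psi_tangent[of b a] by (simp add: algebra_simps)
  then show ?thesis using \<open>a \<le> b\<close> by (cases "a = b") (auto simp: zero_le_mult_iff)
qed

lemma psi_mono: "a \<le> b \<Longrightarrow> \<psi> a \<le> \<psi> b"
proof (rule conjugate_le)
  fix x :: real assume "a \<le> b" "x \<ge> 0"
  then have "x * a \<le> x * b" by (simp add: mult_left_mono)
  then show "x * a - \<phi> x \<le> \<psi> b" using Fenchel_Young[OF \<open>x \<ge> 0\<close>, of b] by linarith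
qed

lemma psi'_nonneg: "\<psi>' a \<ge> 0"
  using psi_tangent[of a "a - 1"] psi_mono[of "a - 1" a] by simp

text \<open>If the derivatives agreed, \<open>\<psi>\<close> would be affine between the two points,
  against strict convexity at the midpoint.\<close>

lemma psi'_strict: "t\<^sub>0 - \<delta> \<le> s \<Longrightarrow> s < t \<Longrightarrow> \<psi>' s < \<psi>' t"
proof (rule ccontr)
  assume st: "t\<^sub>0 - \<delta> \<le> s" "s < t" "\<not> \<psi>' s < \<psi>' t"
  then have eq: "\<psi>' t = \<psi>' s" using psi'_mono[of s t] by linarith
  have "\<psi> ((1 - 1/2) * s + 1/2 * t) < (1 - 1/2) * \<psi> s + 1/2 * \<psi> t"
  proof -
    have "\<forall>x\<in>{t\<^sub>0 - \<delta>..}. \<forall>y\<in>{t\<^sub>0 - \<delta>..}. \<forall>u. x \<noteq> y \<and> 0 < u \<and> u < 1 \<longrightarrow>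
       \<psi> ((1 - u) * x + u * y) < (1 - u) * \<psi> x + u * \<psi> y"
      using divergence unfolding divergence_assumption_def strictly_convex_on_def by blast
    from this[rule_format, of s t "1/2"] show ?thesis using st by simp
  qed
  moreover have "\<psi> t + \<psi>' s * (s - t) \<le> \<psi> s" using psi_tangent[of t s] eq by simp
  moreover have "\<psi> s + \<psi>' s * (((1 - 1/2) * s + 1/2 * t) - s) \<le> \<psi> ((1 - 1/2) * s + 1/2 * t)"
    by (rule psi_tangent)
  ultimately show False by (simp add: algebra_simps)
qed

lemma psi'_gt_1: "t > t\<^sub>0 \<Longrightarrow> \<psi>' t > 1"
  using psi'_strict[of t\<^sub>0 t] psi'_t0 delta_pos by simp

text \<open>The affine function of \<open>y\<close> with slope \<open>x\<close> lies below
  \<open>\<psi>\<close> and touches it at \<open>b\<close>, so the difference has a minimum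
  there.\<close>

lemma psi'_touch:
  assumes "x \<ge> 0" "\<psi> b = x * b - \<phi> x" shows "\<psi>' b = x"
proof -
  have "((\<lambda>y. \<psi> y - (x * y - \<phi> x)) has_real_derivative (\<psi>' b - x)) (at b)"
    by (auto intro!: derivative_eq_intros DERIV_psi)
  moreover have "\<forall>y. \<bar>b - y\<bar> < 1 \<longrightarrow> \<psi> b - (x * b - \<phi> x) \<le> \<psi> y - (x * y - \<phi> x)"
    using assms(2) Fenchel_Young[OF assms(1)] by auto
  ultimately have "\<psi>' b - x = 0" by (rule DERIV_local_min[OF _ zero_less_one])
  then show ?thesis by simp
qed

text \<open>The witness \<open>b\<close> is a subgradient of \<open>\<phi>\<close> at the interior
  point \<open>x\<close>.\<close>

lemma psi'_surj:
  assumes "x > 0" obtains b where "\<psi>' b = x" "\<psi> b = x * b - \<phi> x"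
proof -
  obtain b where b: "\<And>z. z \<ge> 0 \<Longrightarrow> \<phi> x + b * (z - x) \<le> \<phi> z"
    using phi_subgradient[OF assms] by blast
  have "\<psi> b \<le> x * b - \<phi> x"
    by (rule conjugate_le) (use b in \<open>force simp: algebra_simps\<close>)
  then have "\<psi> b = x * b - \<phi> x" using Fenchel_Young[of x b] assms by simp
  then show thesis using psi'_touch[of x b] assms that by simp
qed

text \<open>Two points with the same derivative of \<open>\<psi>\<close> share a tangent line, so
  the equality known at the subgradient \<open>b\<close> transfers to \<open>a\<close>.\<close>

lemma Fenchel_Young_eq: "\<psi>' a > 0 \<Longrightarrow> \<phi> (\<psi>' a) = \<psi>' a * a - \<psi> a"
proof -
  assume "\<psi>' a > 0"
  then obtain b where b: "\<psi>' b = \<psi>' a" "\<psi> b = \<psi>' a * b - \<phi> (\<psi>' a)" using psi'_surj by blast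
  then show ?thesis using psi_tangent[of a b] psi_tangent[of b a] by (simp add: algebra_simps)
qed

lemma psi_t0: "\<psi> t\<^sub>0 = t\<^sub>0"
  using Fenchel_Young_eq[of t\<^sub>0] psi'_t0 phi_1 by simp

text \<open>Since \<open>\<phi>\<close> may jump at \<open>0\<close>, equality in the Fenchel-Young inequality can fail where the
  derivative of the conjugate vanishes; moving slightly towards \<open>1\<close> repairs this.\<close>

lemma Fenchel_Young_approx:
  obtains M where "\<And>s. 0 < s \<Longrightarrow> s \<le> 1 \<Longrightarrow>
    \<phi> ((1 - s) * \<psi>' a + s) \<le> (1 - s) * (\<psi>' a * a - \<psi> a) + s * M"
proof (cases "\<psi>' a > 0")
  case True
  have "\<phi> ((1 - s) * \<psi>' a + s) \<le> (1 - s) * (\<psi>' a * a - \<psi> a) + s * 0" if "0 < s" "s \<le> 1" for s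
    using convex_onD[OF phi_convex, of s "\<psi>' a" 1] that True phi_1 Fenchel_Young_eq[OF True] by simp
  then show thesis by (rule that)
next
  case False
  then have 0: "\<psi>' a = 0" using psi'_nonneg[of a] by simp
  \<comment> \<open>With \<open>\<psi>' a = 0\<close> the left side is \<open>\<phi> s\<close>,
    which is known exactly through the point \<open>b\<close> where \<open>\<psi>'\<close> equals
    \<open>s\<close>. From \<open>a \<le> b\<close> and \<open>b \<le> t\<^sub>0\<close> it is at
    most \<open>s * t\<^sub>0 - \<psi> a\<close>.\<close>
  have "\<phi> ((1 - s) * \<psi>' a + s) \<le> (1 - s) * (\<psi>' a * a - \<psi> a) + s * (t\<^sub>0 - \<psi> a)"
    if s: "0 < s" "s \<le> 1" for s
  proof -
    obtain b where b: "\<psi>' b = s" "\<psi> b = s * b - \<phi> s" using psi'_surj s(1) by blast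
    have "a \<le> b" using psi'_mono[of b a] 0 s b by (cases "a \<le> b") auto
    moreover have "b \<le> t\<^sub>0" using psi'_gt_1[of b] s b by (cases "b \<le> t\<^sub>0") auto
    ultimately have "\<psi> a \<le> \<psi> b" "s * b \<le> s * t\<^sub>0" using psi_mono s by auto
    then show ?thesis using 0 b(2) by (simp add: algebra_simps)
  qed
  then show thesis by (rule that)
qed

lemma psi_ge: "a \<le> \<psi> a"
  using psi_tangent[of t\<^sub>0 a] psi_t0 psi'_t0 by simp

text \<open>Bounds the nonlinear term of the dual by the density \<open>\<psi>'\<close>, so that one
  estimate of the squared density controls the fluctuations of both. From above this is the tangent
  at \<open>a\<close> evaluated at \<open>t\<^sub>0\<close>, from below
  \<open>psi_ge\<close>.\<close>

lemma abs_psi_le: "\<bar>\<psi> a\<bar> \<le> (\<bar>a\<bar> + t\<^sub>0) * (1 + \<psi>' a)"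
proof -
  have 1: "\<psi> a \<le> t\<^sub>0 + \<psi>' a * (a - t\<^sub>0)"
    using psi_tangent[of a t\<^sub>0] psi_t0 by (simp add: algebra_simps)
  have "\<psi>' a * (a - t\<^sub>0) \<le> \<psi>' a * \<bar>a\<bar>" "0 \<le> \<psi>' a * \<bar>a\<bar>" "0 \<le> \<psi>' a * t\<^sub>0"
    using psi'_nonneg[of a] t0_pos by (auto intro!: mult_left_mono)
  moreover have "(\<bar>a\<bar> + t\<^sub>0) * (1 + \<psi>' a) = \<bar>a\<bar> + t\<^sub>0 + \<psi>' a * \<bar>a\<bar> + \<psi>' a * t\<^sub>0"
    by (simp add: algebra_simps)
  ultimately show ?thesis using 1 psi_ge[of a] t0_pos by linarith
qed

text \<open>A Gronwall argument: \<open>exp (- A * x) * \<psi>' x\<close> is nonincreasing because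
  the logarithmic derivative of \<open>\<psi>'\<close> is at most \<open>A\<close>. The minimum with
  \<open>t\<^sub>0 / 2\<close> in \<open>\<delta>'\<close> keeps \<open>x\<close> above
  \<open>t\<^sub>0 / 2\<close>, where the assumed bound is at most \<open>A\<close>.\<close>

lemma psi'_growth:
  fixes s t :: real
  defines "\<delta>' \<equiv> min \<delta> (t\<^sub>0 / 2)"
  assumes "t\<^sub>0 - \<delta>' \<le> s" "s \<le> t"
  shows "\<psi>' t \<le> exp (C\<^sub>\<psi> / (t\<^sub>0 / 2) powr \<gamma> * (t - s)) * \<psi>' s"
proof (cases "s = t")
  case False
  then have "s < t" using assms by simp
  obtain \<psi>'' where D: "\<And>x. x \<ge> t\<^sub>0 - \<delta> \<Longrightarrow> (\<psi>' has_real_derivative \<psi>'' x) (at x within {t\<^sub>0 - \<delta>..})"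
    and B: "\<And>x. x \<ge> t\<^sub>0 - \<delta> \<Longrightarrow> \<bar>\<psi>'' x / \<psi>' x\<bar> \<le> C\<^sub>\<psi> / \<bar>x\<bar> powr \<gamma>"
    using divergence unfolding divergence_assumption_def by force
  define A where "A = C\<^sub>\<psi> / (t\<^sub>0 / 2) powr \<gamma>"
  have lo: "t\<^sub>0 - \<delta> < x" "t\<^sub>0 / 2 < x" if "s < x" for x
    using that assms delta_pos t0_pos by (auto simp: \<delta>'_def)
  define F where "F x = exp (- A * x) * \<psi>' x" for x
  have "F t \<le> F s"
  proof (rule DERIV_nonpos_imp_decreasing_open[OF less_imp_le[OF \<open>s < t\<close>]])
    fix x assume x: "s < x" "x < t"
    have "(\<psi>' has_real_derivative \<psi>'' x) (at x)"
      using D[of x] lo[OF x(1)] at_within_interior[of x "{t\<^sub>0 - \<delta>..}"] by (simp add: interior_real_atLeast)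
    then have 1: "(F has_real_derivative exp (- A * x) * (\<psi>'' x - A * \<psi>' x)) (at x)"
      unfolding F_def by (auto intro!: derivative_eq_intros simp: algebra_simps)
    have pos: "\<psi>' x > 0"
      using psi'_strict[of "(t\<^sub>0 - \<delta> + x) / 2" x] lo[OF x(1)] psi'_nonneg[of "(t\<^sub>0 - \<delta> + x) / 2"] by simp
    have "\<psi>'' x / \<psi>' x \<le> C\<^sub>\<psi> / \<bar>x\<bar> powr \<gamma>" using B[of x] lo[OF x(1)] abs_ge_self[of "\<psi>'' x / \<psi>' x"] by linarith
    also have "\<dots> \<le> A"
      unfolding A_def using lo[OF x(1)] t0_pos C_psi_pos gamma_nonneg
      by (intro divide_left_mono powr_mono2 mult_pos_pos) auto
    finally have "\<psi>'' x - A * \<psi>' x \<le> 0" using pos by (simp add: field_simps)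
    then show "\<exists>y. (F has_real_derivative y) (at x) \<and> y \<le> 0"
      using 1 by (meson exp_ge_zero mult_nonneg_nonpos)
  next
    show "continuous_on {s..t} F"
      unfolding F_def by (intro continuous_intros continuous_on_psi')
  qed
  then have "exp (A * t) * F t \<le> exp (A * t) * F s" by simp
  moreover have "exp (A * t) * F t = \<psi>' t"
    unfolding F_def mult.assoc[symmetric] mult_exp_exp by simp
  moreover have "exp (A * t) * F s = exp (A * (t - s)) * \<psi>' s"
    unfolding F_def mult.assoc[symmetric] mult_exp_exp by (simp add: right_diff_distrib)
  ultimately show ?thesis unfolding A_def[symmetric] by linarith
qed simp

end

section \<open>The finite dual problem\<close>

definition weights :: "'a set \<Rightarrow> ('a \<Rightarrow> real) \<Rightarrow> bool" where
  "weights A a \<longleftrightarrow> finite A \<and> (\<forall>x\<in>A. 0 \<le> a x) \<and> sum a A = 1"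

lemma weights_nonneg: "weights A a \<Longrightarrow> x \<in> A \<Longrightarrow> 0 \<le> a x"
  and weights_sum: "weights A a \<Longrightarrow> sum a A = 1"
  and weights_finite: "weights A a \<Longrightarrow> finite A"
  by (auto simp: weights_def)

lemma weights_nonempty: "weights A a \<Longrightarrow> A \<noteq> {}"
  by (auto simp: weights_def)

section \<open>One potential value when the other potential is fixed\<close>

context divergence
begin

lemma psi'_lt_1: "t < t\<^sub>0 \<Longrightarrow> \<psi>' t < 1"
  using psi'_strict[of "max t (t\<^sub>0 - \<delta>)" t\<^sub>0] psi'_mono[of t "max t (t\<^sub>0 - \<delta>)"] psi'_t0 delta_pos by auto

text \<open>With \<open>v\<close> the other potential minus the cost, the root \<open>s\<close> is
  the potential value that makes one marginal condition hold. Shifting so that all arguments lie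
  below \<open>t\<^sub>0\<close> makes the sum at most \<open>1\<close>, shifting them above makes
  it at least \<open>1\<close>.\<close>

lemma response_exists:
  fixes \<epsilon> :: real
  assumes w: "weights J b" and e: "\<epsilon> > 0"
  obtains s where "(\<Sum>j\<in>J. b j * \<psi>' ((s + v j) / \<epsilon>)) = 1"
proof -
  have fin: "finite J" "J \<noteq> {}" using w weights_finite weights_nonempty by auto
  define m where "m = Min (v ` J)"
  define M where "M = Max (v ` J)"
  have mM: "m \<le> v j" "v j \<le> M" if "j \<in> J" for j using fin that by (auto simp: m_def M_def)
  have "m \<le> M" using mM fin by force
  have lo: "(\<Sum>j\<in>J. b j * \<psi>' ((\<epsilon> * t\<^sub>0 - M + v j) / \<epsilon>)) \<le> (\<Sum>j\<in>J. b j * 1)"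
  proof (intro sum_mono mult_left_mono)
    fix j assume j: "j \<in> J"
    have "(\<epsilon> * t\<^sub>0 - M + v j) / \<epsilon> \<le> t\<^sub>0" using mM(2)[OF j] e by (simp add: field_simps)
    then show "\<psi>' ((\<epsilon> * t\<^sub>0 - M + v j) / \<epsilon>) \<le> 1" using psi'_mono psi'_t0 by fastforce
  qed (use weights_nonneg[OF w] in auto)
  have hi: "(\<Sum>j\<in>J. b j * 1) \<le> (\<Sum>j\<in>J. b j * \<psi>' ((\<epsilon> * t\<^sub>0 - m + v j) / \<epsilon>))"
  proof (intro sum_mono mult_left_mono)
    fix j assume j: "j \<in> J"
    have "t\<^sub>0 \<le> (\<epsilon> * t\<^sub>0 - m + v j) / \<epsilon>" using mM(1)[OF j] e by (simp add: field_simps)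
    then show "1 \<le> \<psi>' ((\<epsilon> * t\<^sub>0 - m + v j) / \<epsilon>)" using psi'_mono psi'_t0 by fastforce
  qed (use weights_nonneg[OF w] in auto)
  have cont: "continuous_on {\<epsilon> * t\<^sub>0 - M..\<epsilon> * t\<^sub>0 - m} (\<lambda>s. \<Sum>j\<in>J. b j * \<psi>' ((s + v j) / \<epsilon>))"
    using e by (intro continuous_intros continuous_on_compose2[OF continuous_on_psi'[of UNIV]]) auto
  have "\<exists>s. \<epsilon> * t\<^sub>0 - M \<le> s \<and> s \<le> \<epsilon> * t\<^sub>0 - m \<and> (\<Sum>j\<in>J. b j * \<psi>' ((s + v j) / \<epsilon>)) = 1"
    by (rule IVT') (use lo hi weights_sum[OF w] \<open>m \<le> M\<close> cont in auto)
  then show thesis using that by blast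
qed

text \<open>A comparison principle; in particular the root is unique. Since \<open>\<psi>'\<close>
  is known to increase strictly only from \<open>t\<^sub>0 - \<delta>\<close> on, monotonicity alone
  does not suffice. But a weighted mean equal to \<open>1\<close> forces some index of positive
  weight to have its argument at or above \<open>t\<^sub>0\<close>, and there the increase is
  strict.\<close>

lemma response_le:
  fixes \<epsilon> :: real
  assumes w: "weights J b" and e: "\<epsilon> > 0"
    and s: "(\<Sum>j\<in>J. b j * \<psi>' ((s + v j) / \<epsilon>)) = 1"
    and s': "(\<Sum>j\<in>J. b j * \<psi>' ((s' + v' j) / \<epsilon>)) = 1"
    and v: "\<And>j. j \<in> J \<Longrightarrow> v' j \<le> v j + c"
  shows "s \<le> s' + c"
proof (rule ccontr)
  assume "\<not> s \<le> s' + c"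
  then have less: "(s' + v' j) / \<epsilon> < (s + v j) / \<epsilon>" if "j \<in> J" for j
    using v[OF that] e by (simp add: divide_strict_right_mono)
  have "\<exists>j\<in>J. b j > 0 \<and> \<psi>' ((s' + v' j) / \<epsilon>) \<ge> 1"
  proof (rule ccontr)
    assume no: "\<not> ?thesis"
    obtain j0 where j0: "j0 \<in> J" "b j0 > 0"
      using weights_sum[OF w] weights_nonneg[OF w] by (metis less_eq_real_def sum.neutral zero_neq_one)
    have "(\<Sum>j\<in>J. b j * \<psi>' ((s' + v' j) / \<epsilon>)) < (\<Sum>j\<in>J. b j)"
    proof (rule sum_strict_mono_ex1[OF weights_finite[OF w]])
      show "\<forall>j\<in>J. b j * \<psi>' ((s' + v' j) / \<epsilon>) \<le> b j"
      proof
        fix j assume "j \<in> J"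
        then show "b j * \<psi>' ((s' + v' j) / \<epsilon>) \<le> b j"
          using no weights_nonneg[OF w, of j] mult_left_mono[of "\<psi>' ((s' + v' j) / \<epsilon>)" 1 "b j"]
          by (cases "b j = 0") force+
      qed
      show "\<exists>j\<in>J. b j * \<psi>' ((s' + v' j) / \<epsilon>) < b j" using j0 no by force
    qed
    then show False using s' weights_sum[OF w] by simp
  qed
  then obtain j where j: "j \<in> J" "b j > 0" "\<psi>' ((s' + v' j) / \<epsilon>) \<ge> 1" by blast
  then have "(s' + v' j) / \<epsilon> \<ge> t\<^sub>0" using psi'_lt_1[of "(s' + v' j) / \<epsilon>"] by linarith
  then have "\<psi>' ((s' + v' j) / \<epsilon>) < \<psi>' ((s + v j) / \<epsilon>)"
    using less[OF j(1)] delta_pos by (intro psi'_strict) auto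
  then have "(\<Sum>j\<in>J. b j * \<psi>' ((s' + v' j) / \<epsilon>)) < (\<Sum>j\<in>J. b j * \<psi>' ((s + v j) / \<epsilon>))"
    using j weights_nonneg[OF w]
    by (intro sum_strict_mono_ex1 weights_finite[OF w] ballI bexI[of _ j] mult_left_mono
          psi'_mono less_imp_le[OF less] mult_strict_left_mono) auto
  then show False using s s' by simp
qed

text \<open>Comparison with the constant \<open>v = 0\<close>, whose root is
  \<open>\<epsilon> * t\<^sub>0\<close>.\<close>

lemma response_bounds:
  fixes \<epsilon> :: real
  assumes w: "weights J b" and e: "\<epsilon> > 0"
    and s: "(\<Sum>j\<in>J. b j * \<psi>' ((s + v j) / \<epsilon>)) = 1"
    and v: "\<And>j. j \<in> J \<Longrightarrow> m \<le> v j \<and> v j \<le> M"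
  shows "\<epsilon> * t\<^sub>0 - M \<le> s" "s \<le> \<epsilon> * t\<^sub>0 - m"
proof -
  have 0: "(\<Sum>j\<in>J. b j * \<psi>' ((\<epsilon> * t\<^sub>0 + 0) / \<epsilon>)) = 1"
    using e psi'_t0 weights_sum[OF w] by (simp flip: sum_distrib_right)
  show "s \<le> \<epsilon> * t\<^sub>0 - m" using response_le[OF w e s 0, of "- m"] v by auto
  show "\<epsilon> * t\<^sub>0 - M \<le> s" using response_le[OF w e 0 s, of M] v by auto
qed

text \<open>The part of the dual objective that sees a single potential value. It is concave in
  \<open>t\<close>, and its critical points are the roots studied above.\<close>

definition partial_dual :: "real \<Rightarrow> 'j set \<Rightarrow> ('j \<Rightarrow> real) \<Rightarrow> ('j \<Rightarrow> real) \<Rightarrow> real \<Rightarrow> real" where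
  "partial_dual \<epsilon> J b v t = t - \<epsilon> * (\<Sum>j\<in>J. b j * \<psi> ((t + v j) / \<epsilon>))"

lemma partial_dual_le:
  fixes \<epsilon> :: real
  assumes w: "weights J b" and e: "\<epsilon> > 0"
    and s: "(\<Sum>j\<in>J. b j * \<psi>' ((s + v j) / \<epsilon>)) = 1"
  shows "partial_dual \<epsilon> J b v t \<le> partial_dual \<epsilon> J b v s"
proof -
  have "(\<Sum>j\<in>J. b j * (\<psi> ((s + v j) / \<epsilon>) + \<psi>' ((s + v j) / \<epsilon>) * ((t + v j) / \<epsilon> - (s + v j) / \<epsilon>)))
      \<le> (\<Sum>j\<in>J. b j * \<psi> ((t + v j) / \<epsilon>))"
    using weights_nonneg[OF w] by (intro sum_mono mult_left_mono psi_tangent) auto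
  also have "(\<Sum>j\<in>J. b j * (\<psi> ((s + v j) / \<epsilon>) + \<psi>' ((s + v j) / \<epsilon>) * ((t + v j) / \<epsilon> - (s + v j) / \<epsilon>)))
      = (\<Sum>j\<in>J. b j * \<psi> ((s + v j) / \<epsilon>)) + (\<Sum>j\<in>J. b j * \<psi>' ((s + v j) / \<epsilon>)) * ((t - s) / \<epsilon>)"
    unfolding sum_distrib_right sum.distrib[symmetric]
    by (intro sum.cong refl) (simp add: algebra_simps diff_divide_distrib[symmetric] add_divide_distrib)
  finally have "(\<Sum>j\<in>J. b j * \<psi> ((s + v j) / \<epsilon>)) + (t - s) / \<epsilon> \<le> (\<Sum>j\<in>J. b j * \<psi> ((t + v j) / \<epsilon>))"
    using s by simp
  then have "\<epsilon> * ((\<Sum>j\<in>J. b j * \<psi> ((s + v j) / \<epsilon>)) + (t - s) / \<epsilon>) \<le> \<epsilon> * (\<Sum>j\<in>J. b j * \<psi> ((t + v j) / \<epsilon>))"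
    using e by (intro mult_left_mono) auto
  then show ?thesis using e by (simp add: partial_dual_def distrib_left)
qed

text \<open>Turns maximality, which is what a compactness argument provides, into the marginal
  condition.\<close>

lemma response_if_max:
  fixes \<epsilon> :: real
  assumes e: "\<epsilon> > 0" and max: "\<And>t. partial_dual \<epsilon> J b v t \<le> partial_dual \<epsilon> J b v s"
  shows "(\<Sum>j\<in>J. b j * \<psi>' ((s + v j) / \<epsilon>)) = 1"
proof -
  have "((\<lambda>t. \<psi> ((t + v j) / \<epsilon>)) has_real_derivative \<psi>' ((s + v j) / \<epsilon>) * (1 / \<epsilon>)) (at s)" for j
    using e by (intro DERIV_chain2[OF DERIV_psi]) (auto intro!: derivative_eq_intros)
  then have "((\<lambda>t. t - \<epsilon> * (\<Sum>j\<in>J. b j * \<psi> ((t + v j) / \<epsilon>))) has_real_derivative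
      1 - \<epsilon> * (\<Sum>j\<in>J. b j * (\<psi>' ((s + v j) / \<epsilon>) * (1 / \<epsilon>)))) (at s)"
    by (intro DERIV_diff DERIV_ident DERIV_cmult DERIV_sum)
  then have "1 - \<epsilon> * (\<Sum>j\<in>J. b j * (\<psi>' ((s + v j) / \<epsilon>) * (1 / \<epsilon>))) = 0"
    by (rule DERIV_local_max[OF _ zero_less_one]) (use max in \<open>auto simp: partial_dual_def\<close>)
  moreover have "\<epsilon> * (\<Sum>j\<in>J. b j * (\<psi>' ((s + v j) / \<epsilon>) * (1 / \<epsilon>))) = (\<Sum>j\<in>J. b j * \<psi>' ((s + v j) / \<epsilon>))"
    unfolding sum_distrib_left using e by (intro sum.cong) auto
  ultimately show ?thesis by simp
qed

end

section \<open>Existence and bounds of dual potentials on finite index sets\<close>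

locale finite_ot = divergence +
  fixes I :: "'i set" and J :: "'j set" and k :: "'i \<Rightarrow> 'j \<Rightarrow> real" and K \<epsilon> :: real
  assumes eps_pos: "\<epsilon> > 0"
    and k_bounds: "\<And>i j. i \<in> I \<Longrightarrow> j \<in> J \<Longrightarrow> 0 \<le> k i j \<and> k i j \<le> K"
begin

text \<open>At optimal potentials, \<open>\<psi>'\<close> of this quantity is the density of the
  coupling with respect to the product measure.\<close>

definition slack :: "('i \<Rightarrow> real) \<Rightarrow> ('j \<Rightarrow> real) \<Rightarrow> 'i \<Rightarrow> 'j \<Rightarrow> real" where
  "slack f g i j = (f i + g j - k i j) / \<epsilon>"

definition dual :: "('i \<Rightarrow> real) \<Rightarrow> ('j \<Rightarrow> real) \<Rightarrow> ('i \<Rightarrow> real) \<Rightarrow> ('j \<Rightarrow> real) \<Rightarrow> real" where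
  "dual a b f g = (\<Sum>i\<in>I. a i * f i) + (\<Sum>j\<in>J. b j * g j)
     - \<epsilon> * (\<Sum>i\<in>I. \<Sum>j\<in>J. a i * b j * \<psi> (slack f g i j))"

definition rows_ok :: "('j \<Rightarrow> real) \<Rightarrow> ('i \<Rightarrow> real) \<Rightarrow> ('j \<Rightarrow> real) \<Rightarrow> bool" where
  "rows_ok b f g \<longleftrightarrow> (\<forall>i\<in>I. (\<Sum>j\<in>J. b j * \<psi>' (slack f g i j)) = 1)"

definition cols_ok :: "('i \<Rightarrow> real) \<Rightarrow> ('i \<Rightarrow> real) \<Rightarrow> ('j \<Rightarrow> real) \<Rightarrow> bool" where
  "cols_ok a f g \<longleftrightarrow> (\<forall>j\<in>J. (\<Sum>i\<in>I. a i * \<psi>' (slack f g i j)) = 1)"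

text \<open>The optimality conditions are imposed on all of \<open>I\<close> and \<open>J\<close>, including indices of weight
  zero: this is what makes it possible to compare the density at an atom with its value at a point
  that carries no mass.\<close>

definition potentials where
  "potentials a b f g \<longleftrightarrow> rows_ok b f g \<and> cols_ok a f g"

lemma slack_row: "slack f g i j = (f i + (g j - k i j)) / \<epsilon>"
  and slack_col: "slack f g i j = (g j + (f i - k i j)) / \<epsilon>"
  by (simp_all add: slack_def algebra_simps)

lemma dual_rows: "dual a b f g =
    (\<Sum>i\<in>I. a i * partial_dual \<epsilon> J b (\<lambda>j. g j - k i j) (f i)) + (\<Sum>j\<in>J. b j * g j)"
  unfolding dual_def slack_row partial_dual_def
  by (simp add: right_diff_distrib sum_subtractf sum_distrib_left mult.assoc mult.left_commute)

lemma dual_cols: "dual a b f g =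
    (\<Sum>j\<in>J. b j * partial_dual \<epsilon> I a (\<lambda>i. f i - k i j) (g j)) + (\<Sum>i\<in>I. a i * f i)"
  unfolding dual_def slack_col partial_dual_def
  by (subst sum.swap[of _ J])
     (simp add: right_diff_distrib sum_subtractf sum_distrib_left mult.assoc mult.left_commute)

lemma ex_rows_ok:
  assumes "weights J b" obtains f where "rows_ok b f g"
proof -
  have "\<exists>s. (\<Sum>j\<in>J. b j * \<psi>' ((s + (g j - k i j)) / \<epsilon>)) = 1" for i
    using response_exists[OF assms eps_pos, of "\<lambda>j. g j - k i j"] by blast
  then obtain f where "\<And>i. (\<Sum>j\<in>J. b j * \<psi>' ((f i + (g j - k i j)) / \<epsilon>)) = 1" by metis
  then show thesis by (intro that) (auto simp: rows_ok_def slack_row)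
qed

lemma ex_cols_ok:
  assumes "weights I a" obtains g where "cols_ok a f g"
proof -
  have "\<exists>s. (\<Sum>i\<in>I. a i * \<psi>' ((s + (f i - k i j)) / \<epsilon>)) = 1" for j
    using response_exists[OF assms eps_pos, of "\<lambda>i. f i - k i j"] by blast
  then obtain g where "\<And>j. (\<Sum>i\<in>I. a i * \<psi>' ((g j + (f i - k i j)) / \<epsilon>)) = 1" by metis
  then show thesis by (intro that) (auto simp: cols_ok_def slack_col)
qed

lemma dual_le_rows: "weights I a \<Longrightarrow> weights J b \<Longrightarrow> rows_ok b f g \<Longrightarrow> dual a b f' g \<le> dual a b f g"
  unfolding dual_rows
  by (intro add_right_mono sum_mono mult_left_mono partial_dual_le eps_pos)
     (auto simp: rows_ok_def slack_row intro: weights_nonneg)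

lemma dual_le_cols: "weights I a \<Longrightarrow> weights J b \<Longrightarrow> cols_ok a f g \<Longrightarrow> dual a b f g' \<le> dual a b f g"
  unfolding dual_cols
  by (intro add_right_mono sum_mono mult_left_mono partial_dual_le eps_pos)
     (auto simp: cols_ok_def slack_col intro: weights_nonneg)

lemma slack_shift: "slack (\<lambda>i. f i + s) (\<lambda>j. g j - s) = slack f g"
  by (intro ext) (simp add: slack_def)

lemma dual_shift:
  assumes "weights I a" "weights J b"
  shows "dual a b (\<lambda>i. f i + s) (\<lambda>j. g j - s) = dual a b f g"
  using weights_sum[OF assms(1)] weights_sum[OF assms(2)] unfolding dual_def slack_shift
  by (simp add: distrib_left right_diff_distrib sum.distrib sum_subtractf flip: sum_distrib_right)

text \<open>Both values are roots whose data differ by at most \<open>c\<close>, so the modulus of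
  continuity of the cost passes to the potential. This includes indices of weight zero.\<close>

lemma rows_osc:
  assumes "weights J b" "rows_ok b f g" "i \<in> I" "i' \<in> I"
    "\<And>j. j \<in> J \<Longrightarrow> k i j \<le> k i' j + c"
  shows "f i \<le> f i' + c"
  using assms unfolding rows_ok_def slack_row
  by (intro response_le[OF assms(1) eps_pos, of "f i" "\<lambda>j. g j - k i j" "f i'" "\<lambda>j. g j - k i' j"])
     (auto simp: algebra_simps)

lemma cols_osc:
  assumes "weights I a" "cols_ok a f g" "j \<in> J" "j' \<in> J"
    "\<And>i. i \<in> I \<Longrightarrow> k i j \<le> k i j' + c"
  shows "g j \<le> g j' + c"
  using assms unfolding cols_ok_def slack_col
  by (intro response_le[OF assms(1) eps_pos, of "g j" "\<lambda>i. f i - k i j" "g j'" "\<lambda>i. f i - k i j'"])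
     (auto simp: algebra_simps)

text \<open>\<open>s\<close> is the minimum of \<open>g\<close>. A potential oscillates no more than
  the cost does, hence by at most \<open>K\<close>.\<close>

lemma cols_normalized:
  assumes w: "weights I a" "weights J b" and ok: "cols_ok a f g"
  obtains s where "\<And>j. j \<in> J \<Longrightarrow> 0 \<le> g j - s \<and> g j - s \<le> K"
proof -
  have fin: "finite J" "J \<noteq> {}" using w weights_finite weights_nonempty by auto
  obtain j0 where j0: "j0 \<in> J" "Min (g ` J) = g j0"
    using Min_in[of "g ` J"] fin by fastforce
  have "0 \<le> g j - g j0 \<and> g j - g j0 \<le> K" if "j \<in> J" for j
  proof
    show "0 \<le> g j - g j0" using Min_le[of "g ` J" "g j"] fin that j0 by auto
    have "k i j \<le> k i j0 + K" if "i \<in> I" for i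
      using k_bounds[OF that \<open>j \<in> J\<close>] k_bounds[OF that j0(1)] by linarith
    then have "g j \<le> g j0 + K" by (rule cols_osc[OF w(1) ok that j0(1)])
    then show "g j - g j0 \<le> K" by simp
  qed
  then show thesis by (rule that)
qed

lemma rows_bounds:
  assumes "weights J b" "rows_ok b f g" "\<And>j. j \<in> J \<Longrightarrow> 0 \<le> g j \<and> g j \<le> K" "i \<in> I"
  shows "\<epsilon> * t\<^sub>0 - K \<le> f i" "f i \<le> \<epsilon> * t\<^sub>0 + K"
proof -
  have v: "- K \<le> g j - k i j \<and> g j - k i j \<le> K" if "j \<in> J" for j
    using assms(3)[OF that] k_bounds[OF assms(4) that] by linarith
  have "(\<Sum>j\<in>J. b j * \<psi>' ((f i + (g j - k i j)) / \<epsilon>)) = 1"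
    using assms(2,4) by (auto simp: rows_ok_def slack_row)
  from response_bounds[OF assms(1) eps_pos this v]
  show "\<epsilon> * t\<^sub>0 - K \<le> f i" "f i \<le> \<epsilon> * t\<^sub>0 + K" by auto
qed

lemma dual_cong:
  assumes "\<And>i. i \<in> I \<Longrightarrow> f i = f' i" "\<And>j. j \<in> J \<Longrightarrow> g j = g' j"
  shows "dual a b f g = dual a b f' g'"
  unfolding dual_def slack_def using assms by simp

text \<open>The potentials range over an unbounded space, and the dual is invariant under opposite
  shifts, so compactness has to be produced. One alternating sweep (rows, columns, shift, rows)
  never lowers the dual and ends in a compact box; hence a maximum over the box is global.\<close>

lemma ex_dual_max:
  assumes w: "weights I a" "weights J b"
  obtains f0 g0 where "\<And>f g. dual a b f g \<le> dual a b f0 g0"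
proof -
  \<comment> \<open>Coordinates outside \<open>I\<close> and \<open>J\<close> are pinned to
    \<open>0\<close>, which makes the box compact in the product topology on all functions; by
    \<open>dual_cong\<close> they do not influence the value.\<close>
  define A where "A = PiE UNIV (\<lambda>i. if i \<in> I then {\<epsilon> * t\<^sub>0 - K..\<epsilon> * t\<^sub>0 + K} else {0::real})"
  define B where "B = PiE UNIV (\<lambda>j. if j \<in> J then {0..K} else {0::real})"
  have compact: "compact (PiE UNIV S)" if "\<And>x. compact (S x)" for S :: "'c \<Rightarrow> real set"
    using that by (simp add: compactin_PiE flip: compactin_euclidean_iff euclidean_product_topology)
  have comp: "compact (A \<times> B)"
    unfolding A_def B_def by (intro compact_Times compact) auto
  have reach: "\<exists>(f', g')\<in>A \<times> B. dual a b f g \<le> dual a b f' g'" for f g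
  proof -
    obtain f1 where f1: "rows_ok b f1 g" using ex_rows_ok[OF w(2)] by blast
    obtain g1 where g1: "cols_ok a f1 g1" using ex_cols_ok[OF w(1)] by blast
    obtain s where s: "\<And>j. j \<in> J \<Longrightarrow> 0 \<le> g1 j - s \<and> g1 j - s \<le> K"
      using cols_normalized[OF w g1] by blast
    obtain f2 where f2: "rows_ok b f2 (\<lambda>j. g1 j - s)" using ex_rows_ok[OF w(2)] by blast
    have "dual a b f g \<le> dual a b f1 g" by (rule dual_le_rows[OF w f1])
    also have "\<dots> \<le> dual a b f1 g1" by (rule dual_le_cols[OF w g1])
    also have "\<dots> = dual a b (\<lambda>i. f1 i + s) (\<lambda>j. g1 j - s)" by (simp add: dual_shift[OF w])
    also have "\<dots> \<le> dual a b f2 (\<lambda>j. g1 j - s)" by (rule dual_le_rows[OF w f2])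
    also have "\<dots> = dual a b (\<lambda>i. if i \<in> I then f2 i else 0) (\<lambda>j. if j \<in> J then g1 j - s else 0)"
      by (rule dual_cong) auto
    finally have "dual a b f g \<le> \<dots>" .
    moreover have "(\<lambda>i. if i \<in> I then f2 i else 0) \<in> A"
      unfolding A_def using rows_bounds[OF w(2) f2 s] by auto
    moreover have "(\<lambda>j. if j \<in> J then g1 j - s else 0) \<in> B"
      unfolding B_def using s by auto
    ultimately show ?thesis by blast
  qed
  then have "A \<times> B \<noteq> {}" by blast
  moreover have "continuous_on (A \<times> B) (\<lambda>(f, g). dual a b f g)"
  proof -
    have c1: "continuous_on S (\<lambda>x. fst x i)" for S :: "(('i \<Rightarrow> real) \<times> ('j \<Rightarrow> real)) set" and i
      by (rule continuous_on_product_then_coordinatewise) (intro continuous_intros)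
    have c2: "continuous_on S (\<lambda>x. snd x i)" for S :: "(('i \<Rightarrow> real) \<times> ('j \<Rightarrow> real)) set" and i
      by (rule continuous_on_product_then_coordinatewise) (intro continuous_intros)
    show ?thesis
      unfolding dual_def slack_def case_prod_beta using eps_pos
      by (intro continuous_intros c1 c2 continuous_on_compose2[OF continuous_on_psi[of UNIV]]) auto
  qed
  ultimately obtain x where x: "x \<in> A \<times> B"
    "\<And>y. y \<in> A \<times> B \<Longrightarrow> (\<lambda>(f, g). dual a b f g) y \<le> (\<lambda>(f, g). dual a b f g) x"
    using continuous_attains_sup[OF comp] by blast
  show thesis
  proof (rule that[of "fst x" "snd x"])
    fix f g
    show "dual a b f g \<le> dual a b (fst x) (snd x)"
      using reach[of f g] x(2) by (force simp: case_prod_beta)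
  qed
qed

text \<open>At a maximizer the marginal conditions follow only at indices of positive weight. Where
  the weight is zero the dual does not see the potential, so it can be redefined there as the exact
  response without disturbing the other marginal.\<close>

lemma ex_potentials:
  assumes w: "weights I a" "weights J b"
  obtains f g where "potentials a b f g"
proof -
  obtain f0 g0 where max0: "\<And>f g. dual a b f g \<le> dual a b f0 g0" using ex_dual_max[OF w] by blast
  obtain f1 where f1: "rows_ok b f1 g0" using ex_rows_ok[OF w(2)] by blast
  obtain g1 where g1: "cols_ok a f1 g1" using ex_cols_ok[OF w(1)] by blast
  have "dual a b f0 g0 \<le> dual a b f1 g1"
    using dual_le_rows[OF w f1, of f0] dual_le_cols[OF w g1, of g0] by linarith
  then have max1: "dual a b f g \<le> dual a b f1 g1" for f g using max0[of f g] by linarith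
  \<comment> \<open>\<open>f1\<close> is the response to \<open>g0\<close>, not to
    \<open>g1\<close>. Maximality of \<open>(f1, g1)\<close> shows that passing to the response
    \<open>f2\<close> gains nothing, so wherever the weight is positive \<open>f1\<close> also
    maximizes its partial dual. Keeping \<open>f1\<close> there preserves the column
    conditions.\<close>
  obtain f2 where f2: "rows_ok b f2 g1" using ex_rows_ok[OF w(2)] by blast
  let ?R = "\<lambda>i. partial_dual \<epsilon> J b (\<lambda>j. g1 j - k i j)"
  have le: "?R i t \<le> ?R i (f2 i)" if "i \<in> I" for i t
    using f2 that by (intro partial_dual_le[OF w(2) eps_pos]) (auto simp: rows_ok_def slack_row)
  have "(\<Sum>i\<in>I. a i * (?R i (f2 i) - ?R i (f1 i))) \<le> 0"
    using max1[of f2 g1] unfolding dual_rows by (simp add: right_diff_distrib sum_subtractf)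
  moreover have nn: "0 \<le> a i * (?R i (f2 i) - ?R i (f1 i))" if "i \<in> I" for i
    using weights_nonneg[OF w(1) that] le[OF that, of "f1 i"] by simp
  ultimately have "(\<Sum>i\<in>I. a i * (?R i (f2 i) - ?R i (f1 i))) = 0"
    by (simp add: antisym sum_nonneg)
  then have zero: "a i = 0 \<or> ?R i (f1 i) = ?R i (f2 i)" if "i \<in> I" for i
    using sum_nonneg_eq_0_iff[OF weights_finite[OF w(1)], of "\<lambda>i. a i * (?R i (f2 i) - ?R i (f1 i))"] nn that
    by force
  define f where "f i = (if a i = 0 then f2 i else f1 i)" for i
  have "rows_ok b f g1"
    unfolding rows_ok_def slack_row
  proof
    fix i assume i: "i \<in> I"
    have "?R i t \<le> ?R i (f i)" for t using zero[OF i] le[OF i, of t] by (auto simp: f_def)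
    then show "(\<Sum>j\<in>J. b j * \<psi>' ((f i + (g1 j - k i j)) / \<epsilon>)) = 1"
      by (rule response_if_max[OF eps_pos])
  qed
  moreover have "cols_ok a f g1"
  proof -
    have "a i * \<psi>' (slack f g1 i j) = a i * \<psi>' (slack f1 g1 i j)" for i j
      by (simp add: f_def slack_def)
    then show ?thesis using g1 unfolding cols_ok_def by (simp only: refl)
  qed
  ultimately show thesis using that by (auto simp: potentials_def)
qed

text \<open>These ranges are the only information about empirical potentials that later estimates
  use.\<close>

lemma ex_bounded_potentials:
  assumes w: "weights I a" "weights J b"
  obtains f g where "potentials a b f g" "\<And>j. j \<in> J \<Longrightarrow> 0 \<le> g j \<and> g j \<le> K"
    "\<And>i. i \<in> I \<Longrightarrow> \<epsilon> * t\<^sub>0 - K \<le> f i \<and> f i \<le> \<epsilon> * t\<^sub>0 + K"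
proof -
  obtain f g where fg: "potentials a b f g" using ex_potentials[OF w] by blast
  obtain s where s: "\<And>j. j \<in> J \<Longrightarrow> 0 \<le> g j - s \<and> g j - s \<le> K"
    using cols_normalized[OF w, of f g] fg unfolding potentials_def by blast
  have p: "potentials a b (\<lambda>i. f i + s) (\<lambda>j. g j - s)"
    using fg unfolding potentials_def rows_ok_def cols_ok_def slack_shift .
  then show thesis
    using that[OF p s] rows_bounds[OF w(2) _ s, of "\<lambda>i. f i + s"] unfolding potentials_def by auto
qed

text \<open>The tangent inequality for \<open>\<psi>\<close> at the slack of \<open>(f, g)\<close>.
  The linear term pairs the change of each potential with a marginal defect, and the defects vanish
  at potentials that are optimal for the same weights.\<close>

lemma dual_le_linearization:
  assumes w: "weights I a" "weights J b"
  shows "dual a b f' g' \<le> dual a b f g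
    + (\<Sum>i\<in>I. a i * ((f' i - f i) * (1 - (\<Sum>j\<in>J. b j * \<psi>' (slack f g i j)))))
    + (\<Sum>j\<in>J. b j * ((g' j - g j) * (1 - (\<Sum>i\<in>I. a i * \<psi>' (slack f g i j)))))"
proof -
  let ?p = "\<lambda>i j. \<psi>' (slack f g i j)"
  have diff: "\<epsilon> * (slack f' g' i j - slack f g i j) = (f' i - f i) + (g' j - g j)" for i j
    using eps_pos by (simp add: slack_def diff_divide_distrib[symmetric])
  have "\<epsilon> * (\<Sum>i\<in>I. \<Sum>j\<in>J. a i * b j * (\<psi> (slack f g i j) + ?p i j * (slack f' g' i j - slack f g i j)))
      \<le> \<epsilon> * (\<Sum>i\<in>I. \<Sum>j\<in>J. a i * b j * \<psi> (slack f' g' i j))"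
    using eps_pos weights_nonneg[OF w(1)] weights_nonneg[OF w(2)]
    by (intro mult_left_mono sum_mono psi_tangent mult_nonneg_nonneg) auto
  moreover have "\<epsilon> * (\<Sum>i\<in>I. \<Sum>j\<in>J. a i * b j * (\<psi> (slack f g i j) + ?p i j * (slack f' g' i j - slack f g i j)))
     = \<epsilon> * (\<Sum>i\<in>I. \<Sum>j\<in>J. a i * b j * \<psi> (slack f g i j))
     + (\<Sum>i\<in>I. \<Sum>j\<in>J. a i * b j * ?p i j * (\<epsilon> * (slack f' g' i j - slack f g i j)))"
    unfolding sum_distrib_left sum.distrib[symmetric]
    by (intro sum.cong refl) (simp add: algebra_simps)
  moreover have "(\<Sum>i\<in>I. \<Sum>j\<in>J. a i * b j * ?p i j * (\<epsilon> * (slack f' g' i j - slack f g i j)))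
     = (\<Sum>i\<in>I. \<Sum>j\<in>J. a i * ((f' i - f i) * (b j * ?p i j)))
       + (\<Sum>j\<in>J. \<Sum>i\<in>I. b j * ((g' j - g j) * (a i * ?p i j)))"
    unfolding diff sum.swap[of _ I J] sum.distrib[symmetric]
    by (intro sum.cong refl) (simp add: algebra_simps)
  moreover have "(\<Sum>i\<in>I. a i * ((f' i - f i) * (1 - (\<Sum>j\<in>J. b j * ?p i j))))
     = (\<Sum>i\<in>I. a i * f' i) - (\<Sum>i\<in>I. a i * f i) - (\<Sum>i\<in>I. \<Sum>j\<in>J. a i * ((f' i - f i) * (b j * ?p i j)))"
    unfolding sum_subtractf[symmetric] sum_distrib_left[symmetric]
    by (intro sum.cong refl) (simp add: algebra_simps)
  moreover have "(\<Sum>j\<in>J. b j * ((g' j - g j) * (1 - (\<Sum>i\<in>I. a i * ?p i j))))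
     = (\<Sum>j\<in>J. b j * g' j) - (\<Sum>j\<in>J. b j * g j) - (\<Sum>j\<in>J. \<Sum>i\<in>I. b j * ((g' j - g j) * (a i * ?p i j)))"
    unfolding sum_subtractf[symmetric] sum_distrib_left[symmetric]
    by (intro sum.cong refl) (simp add: algebra_simps)
  ultimately show ?thesis
    unfolding dual_def by linarith
qed

lemma dual_le_potentials:
  assumes w: "weights I a" "weights J b" and p: "potentials a b f g"
  shows "dual a b f' g' \<le> dual a b f g"
  using dual_le_linearization[OF w, of f' g' f g] p by (simp add: potentials_def rows_ok_def cols_ok_def)

definition optimal_value :: "('i \<Rightarrow> real) \<Rightarrow> ('j \<Rightarrow> real) \<Rightarrow> real" where
  "optimal_value a b = (SUP fg. dual a b (fst fg) (snd fg))"

lemma optimal_value_eq: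
  assumes w: "weights I a" "weights J b" and p: "potentials a b f g"
  shows "optimal_value a b = dual a b f g"
  unfolding optimal_value_def
  by (rule cSup_eq_maximum) (auto intro!: dual_le_potentials[OF w p] rev_image_eqI[of "(f, g)"])

text \<open>Where the density exceeds \<open>1\<close> the slack is above \<open>t\<^sub>0\<close>,
  and passing to a covering center lowers it by at most \<open>D\<close>, one half due to the cost
  and one half due to \<open>f\<close>. Hence \<open>psi'_growth\<close> compares the density with
  its value at the center. In the square one factor is replaced by \<open>1\<close> plus
  \<open>E\<close> times the sum over all centers; summing over \<open>i\<close> uses the column
  condition, then summing over \<open>j\<close> uses the row condition at each center. So every
  center costs \<open>E\<close>, whatever the number of indices.\<close>

lemma sum_density_squared_le:
  fixes r :: real
  assumes w: "weights I a" "weights J b" and p: "potentials a b f g"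
    and X: "X \<subseteq> I"
    and cover: "\<And>i. i \<in> I \<Longrightarrow> a i \<noteq> 0 \<Longrightarrow> \<exists>l\<in>X. \<forall>j\<in>J. \<bar>k i j - k l j\<bar> \<le> min \<delta> (t\<^sub>0 / 2) * \<epsilon> / 2"
  shows "(\<Sum>i\<in>I. a i * (\<Sum>j\<in>J. b j * (\<psi>' (slack f g i j))\<^sup>2))
    \<le> 1 + exp (C\<^sub>\<psi> * min \<delta> (t\<^sub>0 / 2) / (t\<^sub>0 / 2) powr \<gamma>) * card X"
proof -
  define D where "D = min \<delta> (t\<^sub>0 / 2)"
  define E where "E = exp (C\<^sub>\<psi> * D / (t\<^sub>0 / 2) powr \<gamma>)"
  have "D > 0" using delta_pos t0_pos by (simp add: D_def)
  have "C\<^sub>\<psi> / (t\<^sub>0 / 2) powr \<gamma> > 0" using C_psi_pos t0_pos by simp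
  let ?p = "\<lambda>i j. \<psi>' (slack f g i j)"
  have rows: "(\<Sum>j\<in>J. b j * ?p i j) = 1" if "i \<in> I" for i
    using p that by (auto simp: potentials_def rows_ok_def)
  have cols: "(\<Sum>i\<in>I. a i * ?p i j) = 1" if "j \<in> J" for j
    using p that by (auto simp: potentials_def cols_ok_def)
  have "E \<ge> 1" unfolding E_def using C_psi_pos t0_pos \<open>D > 0\<close> by simp
  have pt: "?p i j \<le> 1 + E * (\<Sum>l\<in>X. ?p l j)" if i: "i \<in> I" "a i \<noteq> 0" and j: "j \<in> J" for i j
  proof (cases "slack f g i j \<ge> t\<^sub>0")
    case False
    then have "?p i j \<le> 1" using psi'_lt_1[of "slack f g i j"] by simp
    also have "\<dots> \<le> 1 + E * (\<Sum>l\<in>X. ?p l j)"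
      using \<open>E \<ge> 1\<close> by (simp add: sum_nonneg psi'_nonneg)
    finally show ?thesis .
  next
    case True
    obtain l where l: "l \<in> X" "\<And>j. j \<in> J \<Longrightarrow> \<bar>k i j - k l j\<bar> \<le> D * \<epsilon> / 2"
      using cover[OF i] unfolding D_def by blast
    have "l \<in> I" using l X by blast
    have "rows_ok b f g" using p by (simp add: potentials_def)
    moreover have "k i j \<le> k l j + D * \<epsilon> / 2" if "j \<in> J" for j using l(2)[OF that] by linarith
    ultimately have "f i \<le> f l + D * \<epsilon> / 2" using rows_osc[OF w(2) _ i(1) \<open>l \<in> I\<close>] by blast
    then have "f i + g j - k i j \<le> f l + g j - k l j + D * \<epsilon>" using l(2)[OF j] by linarith
    then have "(f i + g j - k i j) / \<epsilon> \<le> (f l + g j - k l j + D * \<epsilon>) / \<epsilon>"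
      using eps_pos by (intro divide_right_mono) auto
    then have le: "slack f g i j \<le> slack f g l j + D"
      using eps_pos by (simp add: slack_def add_divide_distrib)
    have "?p i j \<le> E * ?p l j"
    proof (cases "slack f g i j \<le> slack f g l j")
      case True
      then have "?p i j \<le> 1 * ?p l j" by (simp add: psi'_mono)
      also have "\<dots> \<le> E * ?p l j" using \<open>E \<ge> 1\<close> psi'_nonneg by (intro mult_right_mono) auto
      finally show ?thesis .
    next
      case False
      have "?p i j \<le> exp (C\<^sub>\<psi> / (t\<^sub>0 / 2) powr \<gamma> * (slack f g i j - slack f g l j)) * ?p l j"
        using False True le by (intro psi'_growth) (auto simp: D_def)
      also have "\<dots> \<le> exp (C\<^sub>\<psi> / (t\<^sub>0 / 2) powr \<gamma> * D) * ?p l j"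
        using le \<open>C\<^sub>\<psi> / (t\<^sub>0 / 2) powr \<gamma> > 0\<close> psi'_nonneg
        by (intro mult_right_mono iffD2[OF exp_le_cancel_iff] mult_left_mono) (auto simp: less_imp_le)
      finally show ?thesis by (simp add: E_def)
    qed
    \<comment> \<open>The center depends on \<open>i\<close>; summing over all of \<open>X\<close>
      removes this dependence.\<close>
    also have "\<dots> \<le> E * (\<Sum>l\<in>X. ?p l j)"
      using \<open>E \<ge> 1\<close> l(1) finite_subset[OF X weights_finite[OF w(1)]] psi'_nonneg
      by (intro mult_left_mono member_le_sum) auto
    finally show ?thesis by simp
  qed
  have "(\<Sum>i\<in>I. a i * (\<Sum>j\<in>J. b j * (?p i j)\<^sup>2))
      \<le> (\<Sum>i\<in>I. a i * (\<Sum>j\<in>J. b j * (?p i j * (1 + E * (\<Sum>l\<in>X. ?p l j)))))"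
  proof (intro sum_mono)
    fix i assume i: "i \<in> I"
    show "a i * (\<Sum>j\<in>J. b j * (?p i j)\<^sup>2) \<le> a i * (\<Sum>j\<in>J. b j * (?p i j * (1 + E * (\<Sum>l\<in>X. ?p l j))))"
    proof (cases "a i = 0")
      case False
      then show ?thesis
        using i weights_nonneg[OF w(1)] weights_nonneg[OF w(2)] pt psi'_nonneg
        unfolding power2_eq_square
        by (intro mult_left_mono sum_mono) auto
    qed simp
  qed
  also have "\<dots> = (\<Sum>i\<in>I. a i * (\<Sum>j\<in>J. b j * ?p i j))
      + (\<Sum>i\<in>I. \<Sum>j\<in>J. \<Sum>l\<in>X. E * (a i * ?p i j) * (b j * ?p l j))"
    by (simp add: distrib_left sum.distrib sum_distrib_left mult.assoc mult.left_commute)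
  also have "(\<Sum>i\<in>I. a i * (\<Sum>j\<in>J. b j * ?p i j)) = 1"
    using rows weights_sum[OF w(1)] by simp
  also have "(\<Sum>i\<in>I. \<Sum>j\<in>J. \<Sum>l\<in>X. E * (a i * ?p i j) * (b j * ?p l j))
      = (\<Sum>j\<in>J. \<Sum>l\<in>X. \<Sum>i\<in>I. E * (a i * ?p i j) * (b j * ?p l j))"
    by (subst sum.swap[of _ J I], subst sum.swap[of _ X I], rule refl)
  also have "\<dots> = (\<Sum>j\<in>J. \<Sum>l\<in>X. E * (b j * ?p l j))"
    using cols by (simp flip: sum_distrib_right sum_distrib_left)
  also have "\<dots> = (\<Sum>l\<in>X. E * (\<Sum>j\<in>J. b j * ?p l j))"
    by (subst sum.swap) (simp add: sum_distrib_left)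
  \<comment> \<open>The row condition is applied at the centers, including those of weight
    zero.\<close>
  also have "\<dots> = E * card X"
    using rows X by (simp add: subset_eq)
  finally show ?thesis unfolding E_def D_def by simp
qed

end

section \<open>Regularized transport with a finitely valued cost\<close>

definition law :: "'a measure \<Rightarrow> ('a \<Rightarrow> 'i) \<Rightarrow> 'i \<Rightarrow> real" where
  "law M T i = measure M (T -` {i} \<inter> space M)"

lemma law_nonneg: "0 \<le> law M T i"
  by (simp add: law_def)

lemma
  fixes F :: "'i \<Rightarrow> real"
  assumes M: "finite_measure M" and T: "T \<in> measurable M (count_space I)" and fin: "finite I"
  shows integrable_finite_valued: "integrable M (\<lambda>x. F (T x))"
    and integral_finite_valued: "(\<integral>x. F (T x) \<partial>M) = (\<Sum>i\<in>I. law M T i * F i)"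
proof -
  interpret finite_measure M by fact
  have meas: "T -` {i} \<inter> space M \<in> sets M" if "i \<in> I" for i
    using measurable_sets[OF T, of "{i}"] that by simp
  have eq: "F (T x) = (\<Sum>i\<in>I. indicator (T -` {i} \<inter> space M) x * F i)" if "x \<in> space M" for x
  proof -
    have "T x \<in> I" using measurable_space[OF T that] by simp
    have "(\<Sum>i\<in>I. indicator (T -` {i} \<inter> space M) x * F i) = (\<Sum>i\<in>I. if i = T x then F i else 0)"
      using that by (intro sum.cong) (auto simp: indicator_def)
    then show ?thesis using \<open>T x \<in> I\<close> fin by simp
  qed
  have int: "integrable M (\<lambda>x. indicator (T -` {i} \<inter> space M) x * F i)" if "i \<in> I" for i
    using meas[OF that] by (intro integrable_mult_left integrable_real_indicator) (auto simp: emeasure_eq_measure)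
  show "integrable M (\<lambda>x. F (T x))"
    using int by (subst Bochner_Integration.integrable_cong[OF refl eq]) auto
  have "(\<integral>x. F (T x) \<partial>M) = (\<integral>x. (\<Sum>i\<in>I. indicator (T -` {i} \<inter> space M) x * F i) \<partial>M)"
    by (rule Bochner_Integration.integral_cong[OF refl eq])
  also have "\<dots> = (\<Sum>i\<in>I. law M T i * F i)"
    using int meas by (simp add: law_def)
  finally show "(\<integral>x. F (T x) \<partial>M) = (\<Sum>i\<in>I. law M T i * F i)" .
qed

lemma integral_indicator_law:
  assumes M: "finite_measure M" and T: "T \<in> measurable M (count_space I)" and I: "finite I" "i \<in> I"
  shows "(\<integral>x. indicator {i} (T x) \<partial>M) = law M T i"
  using integral_finite_valued[OF M T I(1), of "indicator {i}"] I by (simp add: indicator_def)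

lemma weights_law:
  assumes M: "prob_space M" and T: "T \<in> measurable M (count_space I)" and fin: "finite I"
  shows "weights I (law M T)"
proof -
  interpret prob_space M by fact
  have "(\<Sum>i\<in>I. law M T i) = 1"
    using integral_finite_valued[OF finite_measure_axioms T fin, of "\<lambda>_. 1"] by (simp add: prob_space)
  then show ?thesis using fin by (simp add: weights_def law_nonneg)
qed

lemma measurable_finite_pair:
  assumes "T \<in> measurable M (count_space I)" "T' \<in> measurable N (count_space J)" "finite I" "finite J"
  shows "(\<lambda>z. (T (fst z), T' (snd z))) \<in> measurable (M \<Otimes>\<^sub>M N) (count_space (I \<times> J))"
proof -
  have "(\<lambda>z. (T (fst z), T' (snd z))) \<in> measurable (M \<Otimes>\<^sub>M N) (count_space I \<Otimes>\<^sub>M count_space J)"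
    using assms by measurable
  then show ?thesis using assms by (simp add: pair_measure_countable countable_finite)
qed

lemma law_pair:
  assumes M: "prob_space M" "prob_space N"
    and T: "T \<in> measurable M (count_space I)" "T' \<in> measurable N (count_space J)"
    and i: "i \<in> I" "j \<in> J"
  shows "law (M \<Otimes>\<^sub>M N) (\<lambda>z. (T (fst z), T' (snd z))) (i, j) = law M T i * law N T' j"
proof -
  interpret M: prob_space M by fact
  interpret N: prob_space N by fact
  have "(\<lambda>z. (T (fst z), T' (snd z))) -` {(i, j)} \<inter> space (M \<Otimes>\<^sub>M N)
      = (T -` {i} \<inter> space M) \<times> (T' -` {j} \<inter> space N)"
    by (auto simp: space_pair_measure)
  moreover have "T -` {i} \<inter> space M \<in> sets M" "T' -` {j} \<inter> space N \<in> sets N"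
    using measurable_sets[OF T(1), of "{i}"] measurable_sets[OF T(2), of "{j}"] i by auto
  ultimately show ?thesis
    by (simp add: law_def measure_def N.emeasure_pair_measure_Times enn2real_mult)
qed

lemma
  fixes F :: "'i \<Rightarrow> 'j \<Rightarrow> real"
  assumes M: "prob_space M" "prob_space N"
    and T: "T \<in> measurable M (count_space I)" "T' \<in> measurable N (count_space J)"
    and fin: "finite I" "finite J"
  shows integrable_finite_pair: "integrable (M \<Otimes>\<^sub>M N) (\<lambda>z. F (T (fst z)) (T' (snd z)))"
    and integral_finite_pair: "(\<integral>z. F (T (fst z)) (T' (snd z)) \<partial>(M \<Otimes>\<^sub>M N))
      = (\<Sum>i\<in>I. \<Sum>j\<in>J. law M T i * law N T' j * F i j)"
proof -
  interpret M: prob_space M by fact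
  interpret N: prob_space N by fact
  interpret pair_prob_space M N ..
  note * = P.finite_measure_axioms measurable_finite_pair[OF T fin] finite_cartesian_product[OF fin]
  show "integrable (M \<Otimes>\<^sub>M N) (\<lambda>z. F (T (fst z)) (T' (snd z)))"
    using integrable_finite_valued[OF *, of "case_prod F"] by simp
  show "(\<integral>z. F (T (fst z)) (T' (snd z)) \<partial>(M \<Otimes>\<^sub>M N))
      = (\<Sum>i\<in>I. \<Sum>j\<in>J. law M T i * law N T' j * F i j)"
  proof -
    have "law (M \<Otimes>\<^sub>M N) (\<lambda>z. (T (fst z), T' (snd z))) z = law M T (fst z) * law N T' (snd z)"
      if "z \<in> I \<times> J" for z
      using law_pair[OF M T, of "fst z" "snd z"] that by auto
    then show ?thesis
      using integral_finite_valued[OF *, of "case_prod F"]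
      by (simp add: sum.cartesian_product case_prod_beta)
  qed
qed

text \<open>An integrable minorant keeps the negative part of \<open>f\<close> finite, so that the
  difference in \<open>ext_integral\<close> is meaningful even if the positive part is
  infinite.\<close>

lemma ext_integral_ge:
  assumes g: "integrable M g" and le: "\<And>x. x \<in> space M \<Longrightarrow> g x \<le> f x"
  shows "ereal (\<integral>x. g x \<partial>M) \<le> ext_integral M f"
proof -
  have 1: "(\<integral>\<^sup>+x. ennreal (g x) \<partial>M) \<le> (\<integral>\<^sup>+x. ennreal (f x) \<partial>M)"
    by (intro nn_integral_mono ennreal_leI le)
  have 2: "(\<integral>\<^sup>+x. ennreal (- f x) \<partial>M) \<le> (\<integral>\<^sup>+x. ennreal (- g x) \<partial>M)"
    using le by (intro nn_integral_mono ennreal_leI) simp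
  have fin: "(\<integral>\<^sup>+x. ennreal (g x) \<partial>M) < \<infinity>" "(\<integral>\<^sup>+x. ennreal (- g x) \<partial>M) < \<infinity>"
    using g by (simp_all add: real_integrable_def less_top)
  obtain a b where ab: "(\<integral>\<^sup>+x. ennreal (g x) \<partial>M) = ennreal a" "a \<ge> 0"
      "(\<integral>\<^sup>+x. ennreal (- g x) \<partial>M) = ennreal b" "b \<ge> 0"
    using fin by (auto simp: less_top_ennreal)
  have "ereal (\<integral>x. g x \<partial>M) = enn2ereal (ennreal a) - enn2ereal (ennreal b)"
    using ab by (simp add: real_lebesgue_integral_def[OF g])
  also have "\<dots> \<le> ext_integral M f"
    unfolding ext_integral_def
    by (intro ereal_minus_mono) (use 1 2 ab in \<open>simp_all add: less_eq_ennreal.rep_eq\<close>)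
  finally show ?thesis .
qed

lemma ext_integral_eq:
  assumes g: "integrable M g" and eq: "AE x in M. f x = g x"
  shows "ext_integral M f = ereal (\<integral>x. g x \<partial>M)"
proof -
  have fin: "(\<integral>\<^sup>+x. ennreal (g x) \<partial>M) < \<infinity>" "(\<integral>\<^sup>+x. ennreal (- g x) \<partial>M) < \<infinity>"
    using g by (simp_all add: real_integrable_def less_top)
  obtain a b where ab: "(\<integral>\<^sup>+x. ennreal (g x) \<partial>M) = ennreal a" "a \<ge> 0"
      "(\<integral>\<^sup>+x. ennreal (- g x) \<partial>M) = ennreal b" "b \<ge> 0"
    using fin by (auto simp: less_top_ennreal)
  have "(\<integral>\<^sup>+x. ennreal (f x) \<partial>M) = ennreal a" "(\<integral>\<^sup>+x. ennreal (- f x) \<partial>M) = ennreal b"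
    unfolding ab(1,3)[symmetric] using eq by (auto intro!: nn_integral_cong_AE)
  then show ?thesis
    unfolding ext_integral_def using ab by (simp add: real_lebesgue_integral_def[OF g])
qed

lemma ext_integral_nonneg_eq:
  assumes "\<And>x. x \<in> space M \<Longrightarrow> 0 \<le> f x"
  shows "ext_integral M f = enn2ereal (\<integral>\<^sup>+x. ennreal (f x) \<partial>M)"
proof -
  have "(\<integral>\<^sup>+x. ennreal (- f x) \<partial>M) = (\<integral>\<^sup>+x. 0 \<partial>M)"
    using assms by (intro nn_integral_cong) (auto simp: ennreal_eq_0_iff)
  then show ?thesis by (simp add: ext_integral_def zero_ennreal.rep_eq)
qed

lemma
  assumes "\<pi> \<in> couplings M N"
  shows sets_coupling: "sets \<pi> = sets (M \<Otimes>\<^sub>M N)"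
    and space_coupling: "space \<pi> = space (M \<Otimes>\<^sub>M N)"
    and coupling_fst: "fst \<in> measurable \<pi> M" "distr \<pi> M fst = M"
    and coupling_snd: "snd \<in> measurable \<pi> N" "distr \<pi> N snd = N"
proof -
  show s: "sets \<pi> = sets (M \<Otimes>\<^sub>M N)" using assms by (simp add: couplings_def)
  then show "space \<pi> = space (M \<Otimes>\<^sub>M N)" by (rule sets_eq_imp_space_eq)
  show "fst \<in> measurable \<pi> M" "snd \<in> measurable \<pi> N"
    using measurable_cong_sets[OF s refl] by auto
  show "distr \<pi> M fst = M" "distr \<pi> N snd = N" using assms by (auto simp: couplings_def)
qed

lemma prob_space_coupling:
  assumes "prob_space M" "\<pi> \<in> couplings M N" shows "prob_space \<pi>"
  using prob_space_distrD[OF coupling_fst(1)[OF assms(2)]] assms(1) coupling_fst(2)[OF assms(2)] by simp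

text \<open>The cost error is dominated by a function of \<open>x\<close> plus a function of
  \<open>y\<close>, so its integral has the same bound for every coupling and the infima can be
  compared coupling by coupling. The divergence term is common to both sides and may be
  infinite.\<close>

lemma reg_OT_le_reg_OT_add:
  fixes c c' :: "'a \<Rightarrow> 'b \<Rightarrow> real"
  assumes c': "(\<lambda>z. c' (fst z) (snd z)) \<in> borel_measurable (M \<Otimes>\<^sub>M N)"
    and c_nonneg: "\<And>x y. x \<in> space M \<Longrightarrow> y \<in> space N \<Longrightarrow> 0 \<le> c x y \<and> 0 \<le> c' x y"
    and e: "e1 \<in> borel_measurable M" "e2 \<in> borel_measurable N"
    and le: "\<And>x y. x \<in> space M \<Longrightarrow> y \<in> space N \<Longrightarrow> ennreal (c x y) \<le> ennreal (c' x y) + e1 x + e2 y"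
    and D: "(\<integral>\<^sup>+x. e1 x \<partial>M) + (\<integral>\<^sup>+y. e2 y \<partial>N) \<le> ennreal D" "D \<ge> 0"
  shows "reg_OT c \<phi> \<epsilon> M N \<le> reg_OT c' \<phi> \<epsilon> M N + ereal D"
proof -
  have "reg_OT c \<phi> \<epsilon> M N - ereal D \<le> reg_OT c' \<phi> \<epsilon> M N"
    unfolding reg_OT_def[of c']
  proof (rule INF_greatest)
    fix \<pi> assume \<pi>: "\<pi> \<in> couplings M N"
    have nn: "0 \<le> c (fst z) (snd z) \<and> 0 \<le> c' (fst z) (snd z)" if "z \<in> space \<pi>" for z
      using that c_nonneg by (auto simp: space_coupling[OF \<pi>] space_pair_measure)
    note meas [measurable] = coupling_fst(1)[OF \<pi>] coupling_snd(1)[OF \<pi>] e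
    have [measurable]: "(\<lambda>z. c' (fst z) (snd z)) \<in> borel_measurable \<pi>"
      using c' measurable_cong_sets[OF sets_coupling[OF \<pi>] refl] by blast
    have "(\<integral>\<^sup>+z. ennreal (c (fst z) (snd z)) \<partial>\<pi>)
        \<le> (\<integral>\<^sup>+z. (ennreal (c' (fst z) (snd z)) + e1 (fst z)) + e2 (snd z) \<partial>\<pi>)"
      using le by (intro nn_integral_mono) (auto simp: space_coupling[OF \<pi>] space_pair_measure)
    also have "\<dots> = (\<integral>\<^sup>+z. ennreal (c' (fst z) (snd z)) \<partial>\<pi>)
        + ((\<integral>\<^sup>+z. e1 (fst z) \<partial>\<pi>) + (\<integral>\<^sup>+z. e2 (snd z) \<partial>\<pi>))"
      by (simp add: nn_integral_add add.assoc)
    also have "(\<integral>\<^sup>+z. e1 (fst z) \<partial>\<pi>) = (\<integral>\<^sup>+x. e1 x \<partial>M)"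
      using nn_integral_distr[OF meas(1), of e1] coupling_fst(2)[OF \<pi>] e by simp
    also have "(\<integral>\<^sup>+z. e2 (snd z) \<partial>\<pi>) = (\<integral>\<^sup>+x. e2 x \<partial>N)"
      using nn_integral_distr[OF meas(2), of e2] coupling_snd(2)[OF \<pi>] e by simp
    finally have "(\<integral>\<^sup>+z. ennreal (c (fst z) (snd z)) \<partial>\<pi>)
        \<le> (\<integral>\<^sup>+z. ennreal (c' (fst z) (snd z)) \<partial>\<pi>) + ennreal D"
      using D(1) by (meson add_left_mono order_trans)
    then have "enn2ereal (\<integral>\<^sup>+z. ennreal (c (fst z) (snd z)) \<partial>\<pi>)
        \<le> enn2ereal (\<integral>\<^sup>+z. ennreal (c' (fst z) (snd z)) \<partial>\<pi>) + ereal D"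
      using D(2) by (simp add: less_eq_ennreal.rep_eq plus_ennreal.rep_eq)
    then have ext: "ext_integral \<pi> (\<lambda>(x, y). c x y) \<le> ext_integral \<pi> (\<lambda>(x, y). c' x y) + ereal D"
      unfolding case_prod_beta using nn by (subst (1 2) ext_integral_nonneg_eq) auto
    let ?E = "ereal \<epsilon> * phi_divergence \<phi> \<pi> (M \<Otimes>\<^sub>M N)"
    have "reg_OT c \<phi> \<epsilon> M N \<le> ext_integral \<pi> (\<lambda>(x, y). c x y) + ?E"
      unfolding reg_OT_def by (rule INF_lower[OF \<pi>])
    also have "\<dots> \<le> (ext_integral \<pi> (\<lambda>(x, y). c' x y) + ereal D) + ?E"
      by (intro add_right_mono ext)
    also have "\<dots> = (ext_integral \<pi> (\<lambda>(x, y). c' x y) + ?E) + ereal D"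
      by (simp add: ac_simps)
    finally show "reg_OT c \<phi> \<epsilon> M N - ereal D \<le> ext_integral \<pi> (\<lambda>(x, y). c' x y) + ?E"
      by (simp add: ereal_minus_le)
  qed
  then show ?thesis by (simp add: ereal_minus_le)
qed

section \<open>Strong duality when the cost depends on finitely many classes\<close>

locale finite_transport = finite_ot \<phi> t\<^sub>0 \<delta> C\<^sub>\<psi> \<gamma> I J k K \<epsilon> + M: prob_space M + N: prob_space N
  for \<phi> t\<^sub>0 \<delta> C\<^sub>\<psi> \<gamma> and I :: "'i set" and J :: "'j set" and k K \<epsilon> and M :: "'a measure" and N :: "'b measure" +
  fixes T :: "'a \<Rightarrow> 'i" and T' :: "'b \<Rightarrow> 'j" and c :: "'a \<Rightarrow> 'b \<Rightarrow> real"
  assumes T: "T \<in> measurable M (count_space I)" and T': "T' \<in> measurable N (count_space J)"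
    and fin: "finite I" "finite J"
    and c_eq: "\<And>x y. x \<in> space M \<Longrightarrow> y \<in> space N \<Longrightarrow> c x y = k (T x) (T' y)"
begin

sublocale MN: pair_prob_space M N ..

abbreviation a where "a \<equiv> law M T"
abbreviation b where "b \<equiv> law N T'"

lemma weights: "weights I a" "weights J b"
  using weights_law T T' fin M.prob_space_axioms N.prob_space_axioms by auto

lemmas integrable_pair = integrable_finite_pair[OF M.prob_space_axioms N.prob_space_axioms T T' fin]
lemmas integral_pair = integral_finite_pair[OF M.prob_space_axioms N.prob_space_axioms T T' fin]

lemma integral_coupling:
  assumes \<pi>: "\<pi> \<in> couplings M N"
  shows "integrable \<pi> (\<lambda>z. F (T (fst z)) (T' (snd z)) :: real)"
    and "(\<integral>z. u (T (fst z)) \<partial>\<pi>) = (\<Sum>i\<in>I. a i * u i)"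
    and "(\<integral>z. v (T' (snd z)) \<partial>\<pi>) = (\<Sum>j\<in>J. b j * v j)"
proof -
  interpret \<pi>: prob_space \<pi> by (rule prob_space_coupling[OF M.prob_space_axioms \<pi>])
  have "(\<lambda>z. (T (fst z), T' (snd z))) \<in> measurable \<pi> (count_space (I \<times> J))"
    using measurable_finite_pair[OF T T' fin] measurable_cong_sets[OF sets_coupling[OF \<pi>] refl] by blast
  from integrable_finite_valued[OF \<pi>.finite_measure_axioms this, of "case_prod F"]
  show "integrable \<pi> (\<lambda>z. F (T (fst z)) (T' (snd z)))" using fin by simp
  have "(\<lambda>x. u (T x)) \<in> borel_measurable M" "(\<lambda>x. v (T' x)) \<in> borel_measurable N"
    using T T' by (auto intro: measurable_compose)
  then show "(\<integral>z. u (T (fst z)) \<partial>\<pi>) = (\<Sum>i\<in>I. a i * u i)"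
    "(\<integral>z. v (T' (snd z)) \<partial>\<pi>) = (\<Sum>j\<in>J. b j * v j)"
    using integral_distr[OF coupling_fst(1)[OF \<pi>], of "\<lambda>x. u (T x)"] coupling_fst(2)[OF \<pi>]
      integral_distr[OF coupling_snd(1)[OF \<pi>], of "\<lambda>x. v (T' x)"] coupling_snd(2)[OF \<pi>]
      integral_finite_valued[OF M.finite_measure_axioms T fin(1), of u]
      integral_finite_valued[OF N.finite_measure_axioms T' fin(2), of v] by auto
qed

lemma ext_integral_cost:
  assumes \<pi>: "\<pi> \<in> couplings M N"
  shows "ext_integral \<pi> (\<lambda>(x, y). c x y) = ereal (\<integral>z. k (T (fst z)) (T' (snd z)) \<partial>\<pi>)"
proof (rule ext_integral_eq)
  show "integrable \<pi> (\<lambda>z. k (T (fst z)) (T' (snd z)))" by (rule integral_coupling(1)[OF \<pi>])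
  show "AE x in \<pi>. (case x of (x, y) \<Rightarrow> c x y) = k (T (fst x)) (T' (snd x))"
    using c_eq by (intro AE_I2) (auto simp: space_coupling[OF \<pi>] space_pair_measure)
qed

text \<open>The Fenchel-Young inequality for the density of \<open>\<pi>\<close> and the slack,
  integrated against the product measure. The marginals of \<open>\<pi>\<close> turn the linear term
  into the potential part of the dual minus the cost.\<close>

lemma weak_duality:
  assumes \<pi>: "\<pi> \<in> couplings M N"
  shows "ereal (dual a b f g) \<le> ext_integral \<pi> (\<lambda>(x, y). c x y) + ereal \<epsilon> * phi_divergence \<phi> \<pi> (M \<Otimes>\<^sub>M N)"
proof (cases "absolutely_continuous (M \<Otimes>\<^sub>M N) \<pi>")
  case False
  then show ?thesis using ext_integral_cost[OF \<pi>] eps_pos by (simp add: phi_divergence_def)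
next
  case True
  interpret \<pi>: prob_space \<pi> by (rule prob_space_coupling[OF M.prob_space_axioms \<pi>])
  let ?\<rho> = "M \<Otimes>\<^sub>M N"
  define r where "r z = enn2real (RN_deriv ?\<rho> \<pi> z)" for z
  define s where "s z = slack f g (T (fst z)) (T' (snd z))" for z
  have r_meas [measurable]: "r \<in> borel_measurable ?\<rho>" unfolding r_def by measurable
  have r_nonneg: "0 \<le> r z" for z by (simp add: r_def)
  have "AE z in ?\<rho>. RN_deriv ?\<rho> \<pi> z \<noteq> \<infinity>"
    by (rule MN.P.RN_deriv_finite[OF \<pi>.sigma_finite_measure_axioms True sets_coupling[OF \<pi>]])
  then have "AE z in ?\<rho>. RN_deriv ?\<rho> \<pi> z = ennreal (r z)"
    by eventually_elim (simp add: r_def ennreal_enn2real_if)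
  then have "density ?\<rho> r = density ?\<rho> (RN_deriv ?\<rho> \<pi>)"
    by (intro density_cong) auto
  then have dens: "density ?\<rho> r = \<pi>"
    using MN.P.density_RN_deriv[OF True sets_coupling[OF \<pi>]] by simp
  have s_int: "integrable ?\<rho> s" "integrable \<pi> s"
    unfolding s_def using integrable_pair[of "slack f g"] integral_coupling(1)[OF \<pi>, of "slack f g"] by auto
  have rs: "integrable ?\<rho> (\<lambda>z. r z * s z)" "(\<integral>z. r z * s z \<partial>?\<rho>) = (\<integral>z. s z \<partial>\<pi>)"
    using s_int integrable_real_density[of r ?\<rho> s] integral_real_density[of r ?\<rho> s] r_nonneg
    by (auto simp: dens)
  have psi_int: "integrable ?\<rho> (\<lambda>z. \<psi> (s z))"
    unfolding s_def using integrable_pair[of "\<lambda>i j. \<psi> (slack f g i j)"] by simp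
  have "ereal (\<integral>z. r z * s z - \<psi> (s z) \<partial>?\<rho>) \<le> ext_integral ?\<rho> (\<lambda>z. \<phi> (r z))"
  proof (intro ext_integral_ge Bochner_Integration.integrable_diff rs psi_int)
    fix z show "r z * s z - \<psi> (s z) \<le> \<phi> (r z)"
      using Fenchel_Young[OF r_nonneg, of z "s z"] by linarith
  qed
  also have "(\<integral>z. r z * s z - \<psi> (s z) \<partial>?\<rho>) = (\<integral>z. s z \<partial>\<pi>) - (\<integral>z. \<psi> (s z) \<partial>?\<rho>)"
    using rs psi_int by simp
  finally have le: "ereal ((\<integral>z. s z \<partial>\<pi>) - (\<integral>z. \<psi> (s z) \<partial>?\<rho>)) \<le> phi_divergence \<phi> \<pi> ?\<rho>"
    using True by (simp add: phi_divergence_def r_def)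
  have s_pi: "(\<integral>z. s z \<partial>\<pi>) = ((\<Sum>i\<in>I. a i * f i) + (\<Sum>j\<in>J. b j * g j) - (\<integral>z. k (T (fst z)) (T' (snd z)) \<partial>\<pi>)) / \<epsilon>"
    unfolding s_def slack_def
    using integral_coupling(1)[OF \<pi>, of "\<lambda>i j. f i"] integral_coupling(1)[OF \<pi>, of "\<lambda>i j. g j"]
      integral_coupling(1)[OF \<pi>, of k]
    by (simp add: integral_coupling(2,3)[OF \<pi>])
  have s_rho: "(\<integral>z. \<psi> (s z) \<partial>?\<rho>) = (\<Sum>i\<in>I. \<Sum>j\<in>J. a i * b j * \<psi> (slack f g i j))"
    unfolding s_def by (rule integral_pair)
  have "ereal (dual a b f g) = ereal (\<integral>z. k (T (fst z)) (T' (snd z)) \<partial>\<pi>)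
      + ereal \<epsilon> * ereal ((\<integral>z. s z \<partial>\<pi>) - (\<integral>z. \<psi> (s z) \<partial>?\<rho>))"
    proof -
    have "\<epsilon> * (A / \<epsilon> - B) = A - \<epsilon> * B" for A B :: real
      using eps_pos by (simp add: right_diff_distrib)
    then show ?thesis unfolding s_pi s_rho dual_def by simp
  qed
  also have "\<dots> \<le> ereal (\<integral>z. k (T (fst z)) (T' (snd z)) \<partial>\<pi>) + ereal \<epsilon> * phi_divergence \<phi> \<pi> ?\<rho>"
    using le eps_pos by (intro add_left_mono ereal_mult_left_mono) auto
  finally show ?thesis by (simp add: ext_integral_cost[OF \<pi>])
qed

text \<open>Integrating out one variable leaves a weighted row or column sum, which is
  \<open>1\<close>.\<close>

lemma finite_density_coupling:
  fixes q :: "'i \<Rightarrow> 'j \<Rightarrow> real"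
  assumes q: "\<And>i j. 0 \<le> q i j" and rows: "\<And>i. i \<in> I \<Longrightarrow> (\<Sum>j\<in>J. b j * q i j) = 1"
    and cols: "\<And>j. j \<in> J \<Longrightarrow> (\<Sum>i\<in>I. a i * q i j) = 1"
  defines "\<pi> \<equiv> density (M \<Otimes>\<^sub>M N) (\<lambda>z. ennreal (q (T (fst z)) (T' (snd z))))"
  shows "\<pi> \<in> couplings M N"
proof -
  have q_meas [measurable]: "(\<lambda>z. q (T (fst z)) (T' (snd z))) \<in> borel_measurable (M \<Otimes>\<^sub>M N)"
    using integrable_pair[of q] by (rule borel_measurable_integrable)
  have row: "(\<integral>\<^sup>+y. ennreal (q (T x) (T' y)) \<partial>N) = 1" if "x \<in> space M" for x
  proof -
    have "T x \<in> I" using measurable_space[OF T that] by simp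
    then show ?thesis
      using integrable_finite_valued[OF N.finite_measure_axioms T' fin(2), of "q (T x)"]
        integral_finite_valued[OF N.finite_measure_axioms T' fin(2), of "q (T x)"] rows q
      by (subst nn_integral_eq_integral) auto
  qed
  have col: "(\<integral>\<^sup>+x. ennreal (q (T x) (T' y)) \<partial>M) = 1" if "y \<in> space N" for y
  proof -
    have "T' y \<in> J" using measurable_space[OF T' that] by simp
    then show ?thesis
      using integrable_finite_valued[OF M.finite_measure_axioms T fin(1), of "\<lambda>i. q i (T' y)"]
        integral_finite_valued[OF M.finite_measure_axioms T fin(1), of "\<lambda>i. q i (T' y)"] cols q
      by (subst nn_integral_eq_integral) auto
  qed
  have "distr \<pi> M fst = M"
  proof (rule measure_eqI)
    fix A assume "A \<in> sets (distr \<pi> M fst)"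
    then have A [measurable]: "A \<in> sets M" by simp
    have [measurable]: "A \<times> space N \<in> sets (M \<Otimes>\<^sub>M N)" by simp
    have "fst -` A \<inter> space \<pi> = A \<times> space N"
      using sets.sets_into_space[OF A] by (auto simp: \<pi>_def space_pair_measure)
    then have "emeasure (distr \<pi> M fst) A = emeasure \<pi> (A \<times> space N)"
      using A by (subst emeasure_distr) (auto simp: \<pi>_def)
    also have "\<dots> = (\<integral>\<^sup>+z. ennreal (q (T (fst z)) (T' (snd z))) * indicator (A \<times> space N) z \<partial>(M \<Otimes>\<^sub>M N))"
      unfolding \<pi>_def by (rule emeasure_density) auto
    also have "\<dots> = (\<integral>\<^sup>+x. \<integral>\<^sup>+y. ennreal (q (T x) (T' y)) * indicator (A \<times> space N) (x, y) \<partial>N \<partial>M)"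
      by (subst N.nn_integral_fst[symmetric]) auto
    also have "\<dots> = (\<integral>\<^sup>+x. indicator A x * (\<integral>\<^sup>+y. ennreal (q (T x) (T' y)) \<partial>N) \<partial>M)"
    proof (rule nn_integral_cong)
      fix x assume "x \<in> space M"
      show "(\<integral>\<^sup>+y. ennreal (q (T x) (T' y)) * indicator (A \<times> space N) (x, y) \<partial>N)
          = indicator A x * (\<integral>\<^sup>+y. ennreal (q (T x) (T' y)) \<partial>N)"
        by (cases "x \<in> A") (auto simp: indicator_def intro!: nn_integral_cong)
    qed
    also have "\<dots> = (\<integral>\<^sup>+x. indicator A x \<partial>M)" using row by (intro nn_integral_cong) auto
    finally show "emeasure (distr \<pi> M fst) A = emeasure M A" using A by simp
  qed simp
  moreover have "distr \<pi> N snd = N"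
  proof (rule measure_eqI)
    fix A assume "A \<in> sets (distr \<pi> N snd)"
    then have A [measurable]: "A \<in> sets N" by simp
    have [measurable]: "space M \<times> A \<in> sets (M \<Otimes>\<^sub>M N)" by simp
    have "snd -` A \<inter> space \<pi> = space M \<times> A"
      using sets.sets_into_space[OF A] by (auto simp: \<pi>_def space_pair_measure)
    then have "emeasure (distr \<pi> N snd) A = emeasure \<pi> (space M \<times> A)"
      using A by (subst emeasure_distr) (auto simp: \<pi>_def)
    also have "\<dots> = (\<integral>\<^sup>+z. ennreal (q (T (fst z)) (T' (snd z))) * indicator (space M \<times> A) z \<partial>(M \<Otimes>\<^sub>M N))"
      unfolding \<pi>_def by (rule emeasure_density) auto
    also have "\<dots> = (\<integral>\<^sup>+y. \<integral>\<^sup>+x. ennreal (q (T x) (T' y)) * indicator (space M \<times> A) (x, y) \<partial>M \<partial>N)"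
      by (subst MN.nn_integral_snd[symmetric]) auto
    also have "\<dots> = (\<integral>\<^sup>+y. indicator A y * (\<integral>\<^sup>+x. ennreal (q (T x) (T' y)) \<partial>M) \<partial>N)"
    proof (rule nn_integral_cong)
      fix y assume "y \<in> space N"
      show "(\<integral>\<^sup>+x. ennreal (q (T x) (T' y)) * indicator (space M \<times> A) (x, y) \<partial>M)
          = indicator A y * (\<integral>\<^sup>+x. ennreal (q (T x) (T' y)) \<partial>M)"
        by (cases "y \<in> A") (auto simp: indicator_def intro!: nn_integral_cong)
    qed
    also have "\<dots> = (\<integral>\<^sup>+y. indicator A y \<partial>N)" using col by (intro nn_integral_cong) auto
    finally show "emeasure (distr \<pi> N snd) A = emeasure N A" using A by simp
  qed simp
  ultimately show ?thesis by (simp add: couplings_def \<pi>_def)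
qed

lemma reg_OT_le_density:
  fixes q :: "'i \<Rightarrow> 'j \<Rightarrow> real"
  assumes q: "\<And>i j. 0 \<le> q i j" and rows: "\<And>i. i \<in> I \<Longrightarrow> (\<Sum>j\<in>J. b j * q i j) = 1"
    and cols: "\<And>j. j \<in> J \<Longrightarrow> (\<Sum>i\<in>I. a i * q i j) = 1"
  shows "reg_OT c \<phi> \<epsilon> M N \<le> ereal (\<Sum>i\<in>I. \<Sum>j\<in>J. a i * b j * (q i j * k i j + \<epsilon> * \<phi> (q i j)))"
proof -
  let ?\<rho> = "M \<Otimes>\<^sub>M N"
  define \<pi> where "\<pi> = density ?\<rho> (\<lambda>z. ennreal (q (T (fst z)) (T' (snd z))))"
  have \<pi>: "\<pi> \<in> couplings M N" unfolding \<pi>_def by (rule finite_density_coupling[OF assms])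
  have q_meas [measurable]: "(\<lambda>z. q (T (fst z)) (T' (snd z))) \<in> borel_measurable ?\<rho>"
    "(\<lambda>z. k (T (fst z)) (T' (snd z))) \<in> borel_measurable ?\<rho>"
    using integrable_pair[of q] integrable_pair[of k] by auto
  have cost: "ext_integral \<pi> (\<lambda>(x, y). c x y) = ereal (\<Sum>i\<in>I. \<Sum>j\<in>J. a i * b j * (q i j * k i j))"
    unfolding ext_integral_cost[OF \<pi>]
    using integral_pair[of "\<lambda>i j. q i j * k i j"] q
    by (simp add: \<pi>_def integral_real_density)
  have ac: "absolutely_continuous ?\<rho> \<pi>"
    unfolding \<pi>_def by (intro absolutely_continuousI_density) measurable
  have "AE z in ?\<rho>. ennreal (q (T (fst z)) (T' (snd z))) = RN_deriv ?\<rho> \<pi> z"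
    unfolding \<pi>_def by (intro MN.P.RN_deriv_unique) auto
  then have "AE z in ?\<rho>. \<phi> (enn2real (RN_deriv ?\<rho> \<pi> z)) = \<phi> (q (T (fst z)) (T' (snd z)))"
    by eventually_elim (metis enn2real_ennreal q)
  then have "phi_divergence \<phi> \<pi> ?\<rho> = ereal (\<integral>z. \<phi> (q (T (fst z)) (T' (snd z))) \<partial>?\<rho>)"
    using ac integrable_pair[of "\<lambda>i j. \<phi> (q i j)"] by (simp add: phi_divergence_def ext_integral_eq)
  also have "\<dots> = ereal (\<Sum>i\<in>I. \<Sum>j\<in>J. a i * b j * \<phi> (q i j))"
    using integral_pair[of "\<lambda>i j. \<phi> (q i j)"] by simp
  finally have div: "phi_divergence \<phi> \<pi> ?\<rho> = \<dots>" .
  have "reg_OT c \<phi> \<epsilon> M N \<le> ext_integral \<pi> (\<lambda>(x, y). c x y) + ereal \<epsilon> * phi_divergence \<phi> \<pi> ?\<rho>"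
    unfolding reg_OT_def by (rule INF_lower[OF \<pi>])
  also have "\<dots> = ereal (\<Sum>i\<in>I. \<Sum>j\<in>J. a i * b j * (q i j * k i j + \<epsilon> * \<phi> (q i j)))"
    unfolding cost div by (simp add: distrib_left sum.distrib sum_distrib_left mult.left_commute)
  finally show ?thesis .
qed

text \<open>The density given by the potentials ought to attain the dual value, but where it
  vanishes \<open>\<phi>\<close> may jump and the Fenchel-Young equality may fail. Mixing it with
  the constant density \<open>1\<close> of the product coupling repairs this at a cost linear in
  \<open>s\<close>, and \<open>s\<close> tends to \<open>0\<close>.\<close>

theorem strong_duality: "reg_OT c \<phi> \<epsilon> M N = ereal (optimal_value a b)"
proof -
  obtain f g where fg: "potentials a b f g" using ex_potentials[OF weights] by blast
  let ?p = "\<lambda>i j. \<psi>' (slack f g i j)"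
  have rows: "(\<Sum>j\<in>J. b j * ?p i j) = 1" if "i \<in> I" for i
    using fg that by (auto simp: potentials_def rows_ok_def)
  have cols: "(\<Sum>i\<in>I. a i * ?p i j) = 1" if "j \<in> J" for j
    using fg that by (auto simp: potentials_def cols_ok_def)
  define V where "V = dual a b f g"
  have "\<exists>m. \<forall>s. 0 < s \<longrightarrow> s \<le> 1 \<longrightarrow> \<phi> ((1 - s) * \<psi>' t + s) \<le> (1 - s) * (\<psi>' t * t - \<psi> t) + s * m" for t
    using Fenchel_Young_approx[of t] by metis
  then obtain m where m: "\<And>t s. 0 < s \<Longrightarrow> s \<le> 1 \<Longrightarrow>
      \<phi> ((1 - s) * \<psi>' t + s) \<le> (1 - s) * (\<psi>' t * t - \<psi> t) + s * m t"
    by metis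
  define W where "W = (\<Sum>i\<in>I. \<Sum>j\<in>J. a i * b j * (k i j + \<epsilon> * m (slack f g i j)))"
  \<comment> \<open>The right side is the primal objective that the density would have if the
    Fenchel-Young equality held everywhere; the marginal conditions reduce it to the dual
    value.\<close>
  have V_eq: "V = (\<Sum>i\<in>I. \<Sum>j\<in>J. a i * b j * (?p i j * k i j + \<epsilon> * (?p i j * slack f g i j - \<psi> (slack f g i j))))"
  proof -
    have pt: "?p i j * k i j + \<epsilon> * (?p i j * slack f g i j - \<psi> (slack f g i j))
        = ?p i j * f i + ?p i j * g j - \<epsilon> * \<psi> (slack f g i j)" for i j
      using eps_pos by (simp add: slack_def field_simps)
    have "(\<Sum>i\<in>I. \<Sum>j\<in>J. a i * b j * (?p i j * f i)) = (\<Sum>i\<in>I. \<Sum>j\<in>J. (a i * f i) * (b j * ?p i j))"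
      by (intro sum.cong refl) (simp add: ac_simps)
    moreover have "(\<Sum>i\<in>I. \<Sum>j\<in>J. (a i * f i) * (b j * ?p i j)) = (\<Sum>i\<in>I. a i * f i)"
      using rows by (intro sum.cong refl) (simp flip: sum_distrib_left)
    moreover have "(\<Sum>i\<in>I. \<Sum>j\<in>J. a i * b j * (?p i j * g j)) = (\<Sum>j\<in>J. \<Sum>i\<in>I. (b j * g j) * (a i * ?p i j))"
      unfolding sum.swap[of _ J I] by (intro sum.cong refl) (simp add: ac_simps)
    moreover have "(\<Sum>j\<in>J. \<Sum>i\<in>I. (b j * g j) * (a i * ?p i j)) = (\<Sum>j\<in>J. b j * g j)"
      using cols by (intro sum.cong refl) (simp flip: sum_distrib_left)
    ultimately show ?thesis
      unfolding pt V_def dual_def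
      by (simp add: distrib_left right_diff_distrib sum.distrib sum_subtractf sum_distrib_left mult.left_commute)
  qed
  have upper: "reg_OT c \<phi> \<epsilon> M N \<le> ereal ((1 - s) * V + s * W)" if s: "0 < s" "s \<le> 1" for s
  proof -
    define q where "q i j = (1 - s) * ?p i j + s" for i j
    have "reg_OT c \<phi> \<epsilon> M N \<le> ereal (\<Sum>i\<in>I. \<Sum>j\<in>J. a i * b j * (q i j * k i j + \<epsilon> * \<phi> (q i j)))"
    proof (rule reg_OT_le_density)
      show "0 \<le> q i j" for i j using s psi'_nonneg by (simp add: q_def)
      show "(\<Sum>j\<in>J. b j * q i j) = 1" if "i \<in> I" for i
        using rows[OF that] weights_sum[OF weights(2)]
        by (simp add: q_def distrib_left sum.distrib mult.left_commute[of _ "1 - s"] flip: sum_distrib_left sum_distrib_right)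
      show "(\<Sum>i\<in>I. a i * q i j) = 1" if "j \<in> J" for j
        using cols[OF that] weights_sum[OF weights(1)]
        by (simp add: q_def distrib_left sum.distrib mult.left_commute[of _ "1 - s"] flip: sum_distrib_left sum_distrib_right)
    qed
    also have "(\<Sum>i\<in>I. \<Sum>j\<in>J. a i * b j * (q i j * k i j + \<epsilon> * \<phi> (q i j)))
        \<le> (\<Sum>i\<in>I. \<Sum>j\<in>J. a i * b j * (q i j * k i j
            + \<epsilon> * ((1 - s) * (?p i j * slack f g i j - \<psi> (slack f g i j)) + s * m (slack f g i j))))"
      using m[OF s] eps_pos weights_nonneg[OF weights(1)] weights_nonneg[OF weights(2)]
      unfolding q_def by (intro sum_mono mult_left_mono add_left_mono mult_nonneg_nonneg) auto
    also have "\<dots> = (\<Sum>i\<in>I. \<Sum>j\<in>J.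
          (1 - s) * (a i * b j * (?p i j * k i j + \<epsilon> * (?p i j * slack f g i j - \<psi> (slack f g i j))))
          + s * (a i * b j * (k i j + \<epsilon> * m (slack f g i j))))"
      unfolding q_def by (intro sum.cong refl) (simp add: algebra_simps)
    also have "\<dots> = (1 - s) * V + s * W"
      unfolding V_eq W_def by (simp add: sum.distrib flip: sum_distrib_left)
    finally show ?thesis by simp
  qed
  have lim: "(\<lambda>n. ereal ((1 - inverse (real (Suc n))) * V + inverse (real (Suc n)) * W)) \<longlonglongrightarrow> ereal ((1 - 0) * V + 0 * W)"
    by (intro tendsto_ereal tendsto_intros LIMSEQ_inverse_real_of_nat)
  have "reg_OT c \<phi> \<epsilon> M N \<le> ereal ((1 - 0) * V + 0 * W)"
  proof (rule LIMSEQ_le_const[OF lim], intro exI allI impI)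
    show "reg_OT c \<phi> \<epsilon> M N \<le> ereal ((1 - inverse (real (Suc n))) * V + inverse (real (Suc n)) * W)" for n
      by (rule upper) (auto simp: field_simps)
  qed
  then have "reg_OT c \<phi> \<epsilon> M N \<le> ereal V" by simp
  moreover have "ereal V \<le> reg_OT c \<phi> \<epsilon> M N"
    unfolding reg_OT_def V_def by (intro INF_greatest weak_duality)
  ultimately show ?thesis
    using optimal_value_eq[OF weights fg] by (simp add: V_def antisym)
qed

end

section \<open>Fluctuations of empirical averages\<close>

lemma uniform_count_measurable:
  "(\<And>l. l < n \<Longrightarrow> y l \<in> space N) \<Longrightarrow> y \<in> measurable (uniform_count_measure {..<n}) N"
  by (auto simp: measurable_def space_uniform_count_measure sets_uniform_count_measure)

lemma sets_empirical_measure [simp]: "sets (empirical_measure N n y) = sets N"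
  and space_empirical_measure [simp]: "space (empirical_measure N n y) = space N"
  by (simp_all add: empirical_measure_def)

lemma prob_space_empirical_measure:
  assumes "n > 0" "\<And>l. l < n \<Longrightarrow> y l \<in> space N"
  shows "prob_space (empirical_measure N n y)"
  unfolding empirical_measure_def
  by (intro prob_space.prob_space_distr prob_space_uniform_count_measure uniform_count_measurable assms)
     (use assms in auto)

lemma integral_empirical_measure:
  fixes q :: "'a \<Rightarrow> real"
  assumes "\<And>l. l < n \<Longrightarrow> y l \<in> space N" "q \<in> borel_measurable N"
  shows "(\<integral>x. q x \<partial>empirical_measure N n y) = (\<Sum>l<n. q (y l)) / n"
  unfolding empirical_measure_def
  by (subst integral_distr[OF uniform_count_measurable])
     (use assms in \<open>auto simp: integral_uniform_count_measure\<close>)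

lemma nn_integral_empirical_measure:
  assumes "\<And>l. l < n \<Longrightarrow> y l \<in> space N" "e \<in> borel_measurable N"
  shows "(\<integral>\<^sup>+x. e x \<partial>empirical_measure N n y) = (\<Sum>l<n. ennreal (1 / n) * e (y l))"
  unfolding empirical_measure_def
  by (subst nn_integral_distr[OF uniform_count_measurable])
     (use assms in \<open>auto simp: uniform_count_measure_def nn_integral_point_measure_finite\<close>)

lemma (in prob_space) expectation_abs_le_sqrt:
  fixes Z :: "'a \<Rightarrow> real"
  assumes "integrable M Z" "integrable M (\<lambda>x. (Z x)\<^sup>2)"
  shows "expectation (\<lambda>x. \<bar>Z x\<bar>) \<le> sqrt (expectation (\<lambda>x. (Z x)\<^sup>2))"
proof -
  have "variance (\<lambda>x. \<bar>Z x\<bar>) = expectation (\<lambda>x. \<bar>Z x\<bar>\<^sup>2) - (expectation (\<lambda>x. \<bar>Z x\<bar>))\<^sup>2"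
    using assms by (intro variance_eq) auto
  then have "(expectation (\<lambda>x. \<bar>Z x\<bar>))\<^sup>2 \<le> expectation (\<lambda>x. (Z x)\<^sup>2)"
    using variance_positive[of "\<lambda>x. \<bar>Z x\<bar>"] by simp
  then show ?thesis by (rule real_le_rsqrt)
qed

locale sample = prob_space P for P :: "'w measure" +
  fixes N :: "'a measure" and n :: nat and Y :: "nat \<Rightarrow> 'w \<Rightarrow> 'a"
  assumes iid: "iid_sample P N n Y" and n_pos: "n > 0"
begin

lemma Y_measurable: "l < n \<Longrightarrow> Y l \<in> measurable P N"
  and Y_distr: "l < n \<Longrightarrow> distr P N (Y l) = N"
  and Y_indep: "indep_vars (\<lambda>_. N) Y {..<n}"
  using iid by (auto simp: iid_sample_def indep_vars_def)

lemma Y_space: "l < n \<Longrightarrow> \<omega> \<in> space P \<Longrightarrow> Y l \<omega> \<in> space N"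
  using measurable_space[OF Y_measurable] by blast

lemma prob_space_N: "prob_space N"
  using prob_space_distr[OF Y_measurable[OF n_pos]] Y_distr[OF n_pos] by simp

lemma expectation_Y:
  assumes "q \<in> borel_measurable N" "l < n"
  shows "(\<integral>\<omega>. q (Y l \<omega>) \<partial>P) = (\<integral>x. q x \<partial>N :: real)"
  using integral_distr[OF Y_measurable[OF assms(2)] assms(1)] Y_distr[OF assms(2)] by simp

text \<open>Unbiasedness of empirical integrals. It makes the tail terms of the empirical problem
  cost, in the mean, exactly what those of the population cost.\<close>

lemma nn_integral_empirical:
  assumes e: "e \<in> borel_measurable N"
  shows "(\<lambda>\<omega>. \<integral>\<^sup>+x. e x \<partial>empirical_measure N n (\<lambda>l. Y l \<omega>)) \<in> borel_measurable P"
    and "(\<integral>\<^sup>+\<omega>. (\<integral>\<^sup>+x. e x \<partial>empirical_measure N n (\<lambda>l. Y l \<omega>)) \<partial>P) = (\<integral>\<^sup>+x. e x \<partial>N)"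
proof -
  have eq: "(\<integral>\<^sup>+x. e x \<partial>empirical_measure N n (\<lambda>l. Y l \<omega>)) = (\<Sum>l<n. ennreal (1 / n) * e (Y l \<omega>))"
    if "\<omega> \<in> space P" for \<omega>
    by (rule nn_integral_empirical_measure) (use e Y_space that in auto)
  have meas: "(\<lambda>\<omega>. e (Y l \<omega>)) \<in> borel_measurable P" if "l < n" for l
    using measurable_compose[OF Y_measurable[OF that] e] .
  show "(\<lambda>\<omega>. \<integral>\<^sup>+x. e x \<partial>empirical_measure N n (\<lambda>l. Y l \<omega>)) \<in> borel_measurable P"
    by (subst measurable_cong[OF eq]) (use meas in \<open>auto intro!: borel_measurable_sum borel_measurable_times_ennreal\<close>)
  have "(\<integral>\<^sup>+\<omega>. (\<integral>\<^sup>+x. e x \<partial>empirical_measure N n (\<lambda>l. Y l \<omega>)) \<partial>P)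
      = (\<integral>\<^sup>+\<omega>. (\<Sum>l<n. ennreal (1 / n) * e (Y l \<omega>)) \<partial>P)"
    by (rule nn_integral_cong[OF eq])
  also have "\<dots> = (\<Sum>l<n. ennreal (1 / n) * (\<integral>\<^sup>+\<omega>. e (Y l \<omega>) \<partial>P))"
    using meas by (subst nn_integral_sum) (auto simp: nn_integral_cmult)
  also have "\<dots> = (\<Sum>l<n. ennreal (1 / n) * (\<integral>\<^sup>+x. e x \<partial>N))"
  proof (intro sum.cong refl)
    fix l assume "l \<in> {..<n}"
    then show "ennreal (1 / n) * (\<integral>\<^sup>+\<omega>. e (Y l \<omega>) \<partial>P) = ennreal (1 / n) * (\<integral>\<^sup>+x. e x \<partial>N)"
      using nn_integral_distr[OF Y_measurable, of l e] Y_distr[of l] e by simp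
  qed
  also have "\<dots> = (of_nat n * ennreal (1 / n)) * (\<integral>\<^sup>+x. e x \<partial>N)"
    by (simp add: mult.assoc)
  also have "of_nat n * ennreal (1 / n) = 1"
    using n_pos by (simp add: ennreal_of_nat_eq_real_of_nat flip: ennreal_mult)
  finally show "(\<integral>\<^sup>+\<omega>. (\<integral>\<^sup>+x. e x \<partial>empirical_measure N n (\<lambda>l. Y l \<omega>)) \<partial>P) = (\<integral>\<^sup>+x. e x \<partial>N)"
    by simp
qed

definition fluctuation :: "('a \<Rightarrow> real) \<Rightarrow> 'w \<Rightarrow> real" where
  "fluctuation q \<omega> = (\<integral>x. q x \<partial>empirical_measure N n (\<lambda>l. Y l \<omega>)) - (\<integral>x. q x \<partial>N)"

context
  fixes q :: "'a \<Rightarrow> real" and B :: real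
  assumes q: "q \<in> borel_measurable N" and q_bound: "\<And>x. x \<in> space N \<Longrightarrow> \<bar>q x\<bar> \<le> B"
begin

lemma fluctuation_eq:
  "\<omega> \<in> space P \<Longrightarrow> fluctuation q \<omega> = (\<Sum>l<n. q (Y l \<omega>) - (\<integral>x. q x \<partial>N)) / n"
  using integral_empirical_measure[of n "\<lambda>l. Y l \<omega>" N q] q Y_space n_pos
  by (simp add: fluctuation_def sum_subtractf diff_divide_distrib)

lemma q_Y_measurable: "l < n \<Longrightarrow> (\<lambda>\<omega>. q (Y l \<omega>)) \<in> borel_measurable P"
  by (rule measurable_compose[OF Y_measurable q])

lemma fluctuation_measurable: "fluctuation q \<in> borel_measurable P"
  by (subst measurable_cong[OF fluctuation_eq])
     (auto intro!: borel_measurable_divide borel_measurable_sum borel_measurable_diff q_Y_measurable)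

lemma fluctuation_bound: "\<omega> \<in> space P \<Longrightarrow> \<bar>fluctuation q \<omega>\<bar> \<le> B + \<bar>\<integral>x. q x \<partial>N\<bar>"
proof -
  assume \<omega>: "\<omega> \<in> space P"
  have "\<bar>\<Sum>l<n. q (Y l \<omega>) - (\<integral>x. q x \<partial>N)\<bar> \<le> (\<Sum>l<n. B + \<bar>\<integral>x. q x \<partial>N\<bar>)"
    by (intro order.trans[OF sum_abs] sum_mono order.trans[OF abs_triangle_ineq4] add_right_mono q_bound Y_space \<omega>)
       auto
  then have "\<bar>fluctuation q \<omega>\<bar> \<le> (\<Sum>l<n. B + \<bar>\<integral>x. q x \<partial>N\<bar>) / n"
    unfolding fluctuation_eq[OF \<omega>] abs_divide using n_pos by (simp only: abs_of_nat divide_right_mono of_nat_0_le_iff)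
  then show ?thesis using n_pos by simp
qed

lemma fluctuation_integrable: "integrable P (fluctuation q)" "integrable P (\<lambda>\<omega>. \<bar>fluctuation q \<omega>\<bar>)"
    "integrable P (\<lambda>\<omega>. (fluctuation q \<omega>)\<^sup>2)"
proof -
  note [measurable] = fluctuation_measurable
  show "integrable P (fluctuation q)" "integrable P (\<lambda>\<omega>. \<bar>fluctuation q \<omega>\<bar>)"
    using fluctuation_bound by (auto intro!: integrable_const_bound[where B="B + \<bar>\<integral>x. q x \<partial>N\<bar>"] AE_I2)
  show "integrable P (\<lambda>\<omega>. (fluctuation q \<omega>)\<^sup>2)"
    using fluctuation_bound
    by (intro integrable_const_bound[where B="(B + \<bar>\<integral>x. q x \<partial>N\<bar>)\<^sup>2"] AE_I2)
       (auto simp: abs_le_square_iff[symmetric] intro: order.trans[OF _ abs_ge_self])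
qed

text \<open>Pairwise independence removes the cross terms, and a variance is at most the second
  moment.\<close>

lemma expectation_fluctuation_squared:
  "(\<integral>\<omega>. (fluctuation q \<omega>)\<^sup>2 \<partial>P) \<le> (\<integral>x. (q x)\<^sup>2 \<partial>N) / n"
proof -
  interpret N: prob_space N by (rule prob_space_N)
  define m where "m = (\<integral>x. q x \<partial>N)"
  define Z where "Z l \<omega> = q (Y l \<omega>) - m" for l \<omega>
  have Z_meas [measurable]: "Z l \<in> borel_measurable P" if "l < n" for l
    unfolding Z_def using q_Y_measurable[OF that] by measurable
  have Z_bound: "\<bar>Z l \<omega>\<bar> \<le> B + \<bar>m\<bar>" if "l < n" "\<omega> \<in> space P" for l \<omega>
    unfolding Z_def using q_bound[OF Y_space[OF that]] by linarith
  have int1: "integrable P (Z l)" if "l < n" for l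
    using Z_bound[OF that] Z_meas[OF that] by (intro integrable_const_bound[where B="B + \<bar>m\<bar>"] AE_I2) auto
  have int2: "integrable P (\<lambda>\<omega>. Z l \<omega> * Z k \<omega>)" if "l < n" "k < n" for l k
  proof (intro integrable_const_bound[where B="(B + \<bar>m\<bar>) * (B + \<bar>m\<bar>)"] AE_I2)
    fix \<omega> assume "\<omega> \<in> space P"
    then show "norm (Z l \<omega> * Z k \<omega>) \<le> (B + \<bar>m\<bar>) * (B + \<bar>m\<bar>)"
      unfolding real_norm_def abs_mult using Z_bound that by (intro mult_mono) (auto intro: order.trans[OF abs_ge_zero])
  qed (use that Z_meas in auto)
  have q_int: "integrable N q" "integrable N (\<lambda>x. (q x)\<^sup>2)"
  proof -
    show "integrable N q" using q q_bound by (intro N.integrable_const_bound[where B=B] AE_I2) auto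
    have "(q x)\<^sup>2 \<le> B\<^sup>2" if "x \<in> space N" for x
      using q_bound[OF that] by (simp add: abs_le_square_iff[symmetric])
    then show "integrable N (\<lambda>x. (q x)\<^sup>2)"
      using q by (intro N.integrable_const_bound[where B="B\<^sup>2"] AE_I2) auto
  qed
  have mean: "(\<integral>\<omega>. Z l \<omega> \<partial>P) = 0" if "l < n" for l
    using expectation_Y[OF _ that, of "\<lambda>x. q x - m"] q q_int by (simp add: Z_def m_def N.prob_space)
  have var: "(\<integral>\<omega>. Z l \<omega> * Z l \<omega> \<partial>P) \<le> (\<integral>x. (q x)\<^sup>2 \<partial>N)" if "l < n" for l
  proof -
    have "(\<integral>\<omega>. Z l \<omega> * Z l \<omega> \<partial>P) = N.variance q"
      using expectation_Y[OF _ that, of "\<lambda>x. (q x - m)\<^sup>2"] q by (simp add: Z_def m_def power2_eq_square)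
    also have "\<dots> = (\<integral>x. (q x)\<^sup>2 \<partial>N) - m\<^sup>2" unfolding m_def by (rule N.variance_eq[OF q_int])
    finally show ?thesis by simp
  qed
  have indep: "indep_vars (\<lambda>_. borel) Z {..<n}"
    unfolding Z_def using q by (intro indep_vars_compose2[OF Y_indep, where Y="\<lambda>_ x. q x - m"]) auto
  have cross: "(\<integral>\<omega>. Z l \<omega> * Z k \<omega> \<partial>P) = 0" if "l < n" "k < n" "l \<noteq> k" for l k
  proof -
    have "indep_vars (\<lambda>_. borel) Z {l, k}" using that by (intro indep_vars_subset[OF indep]) auto
    from indep_vars_lebesgue_integral[OF _ this] int1 that
    have "(\<integral>\<omega>. (\<Prod>i\<in>{l, k}. Z i \<omega>) \<partial>P) = (\<Prod>i\<in>{l, k}. \<integral>\<omega>. Z i \<omega> \<partial>P)" by auto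
    then show ?thesis using that mean by simp
  qed
  have "(\<integral>\<omega>. (fluctuation q \<omega>)\<^sup>2 \<partial>P) = (\<integral>\<omega>. (\<Sum>l<n. \<Sum>k<n. Z l \<omega> * Z k \<omega>) / n\<^sup>2 \<partial>P)"
    by (intro Bochner_Integration.integral_cong refl)
       (simp add: fluctuation_eq Z_def m_def power_divide power2_eq_square sum_product)
  also have "\<dots> = (\<Sum>l<n. \<Sum>k<n. (\<integral>\<omega>. Z l \<omega> * Z k \<omega> \<partial>P)) / n\<^sup>2"
  proof -
    have "(\<integral>\<omega>. (\<Sum>l<n. \<Sum>k<n. Z l \<omega> * Z k \<omega>) \<partial>P) = (\<Sum>l<n. \<integral>\<omega>. (\<Sum>k<n. Z l \<omega> * Z k \<omega>) \<partial>P)"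
      using int2 by (intro Bochner_Integration.integral_sum Bochner_Integration.integrable_sum) auto
    also have "\<dots> = (\<Sum>l<n. \<Sum>k<n. (\<integral>\<omega>. Z l \<omega> * Z k \<omega> \<partial>P))"
      using int2 by (intro sum.cong refl Bochner_Integration.integral_sum) auto
    finally show ?thesis by simp
  qed
  also have "(\<Sum>l<n. \<Sum>k<n. (\<integral>\<omega>. Z l \<omega> * Z k \<omega> \<partial>P)) \<le> (\<Sum>l<n. \<Sum>k<n. if k = l then (\<integral>x. (q x)\<^sup>2 \<partial>N) else 0)"
    using var cross by (intro sum_mono) auto
  also have "\<dots> = n * (\<integral>x. (q x)\<^sup>2 \<partial>N)" by simp
  finally show ?thesis using n_pos by (simp add: power2_eq_square divide_right_mono field_simps)
qed

lemma expectation_abs_fluctuation: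
  "(\<integral>\<omega>. \<bar>fluctuation q \<omega>\<bar> \<partial>P) \<le> sqrt ((\<integral>x. (q x)\<^sup>2 \<partial>N) / n)"
  using expectation_abs_le_sqrt[OF fluctuation_integrable(1,3)] expectation_fluctuation_squared
  by (meson order.trans real_sqrt_le_mono)

lemma nn_integral_abs_fluctuation:
  "(\<integral>\<^sup>+\<omega>. ennreal \<bar>fluctuation q \<omega>\<bar> \<partial>P) \<le> ennreal (sqrt ((\<integral>x. (q x)\<^sup>2 \<partial>N) / n))"
  using expectation_abs_fluctuation
  by (subst nn_integral_eq_integral[OF fluctuation_integrable(2)]) (auto intro: ennreal_leI)

end

end

lemma indep_samples_sym:
  assumes P: "prob_space P" and ind: "indep_samples P \<mu> \<nu> n X Y"
  shows "indep_samples P \<nu> \<mu> n Y X"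
proof -
  interpret prob_space P by fact
  show ?thesis
    using ind unfolding indep_samples_def indep_var_eq indep_sets2_eq
    by (metis (no_types, lifting) Int_commute mult.commute)
qed

text \<open>One factor depends on the first sample only and the other on the second, so the
  expectation of the product factors.\<close>

lemma nn_integral_average_times_fluctuation:
  fixes u q :: "'a \<Rightarrow> real"
  assumes X: "sample P M n X" and Y: "sample P N n Y" and ind: "indep_samples P M N n X Y"
    and u: "u \<in> borel_measurable M" "\<And>x. x \<in> space M \<Longrightarrow> 0 \<le> u x \<and> u x \<le> A"
    and q: "q \<in> borel_measurable N" "\<And>x. x \<in> space N \<Longrightarrow> \<bar>q x\<bar> \<le> B"
  shows "(\<integral>\<^sup>+\<omega>. ennreal ((\<integral>x. u x \<partial>empirical_measure M n (\<lambda>l. X l \<omega>)) * \<bar>sample.fluctuation N n Y q \<omega>\<bar>) \<partial>P)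
    \<le> ennreal ((\<integral>x. u x \<partial>M) * sqrt ((\<integral>x. (q x)\<^sup>2 \<partial>N) / n))"
proof -
  interpret X: sample P M n X by fact
  interpret Y: sample P N n Y by fact
  interpret M: prob_space M by (rule X.prob_space_N)
  let ?XX = "\<lambda>\<omega>. \<lambda>i\<in>{..<n}. X i \<omega>" and ?YY = "\<lambda>\<omega>. \<lambda>i\<in>{..<n}. Y i \<omega>"
  let ?u = "\<lambda>\<omega>. \<integral>x. u x \<partial>empirical_measure M n (\<lambda>l. X l \<omega>)"
  \<comment> \<open>\<open>U\<close> and \<open>G\<close> express the two factors through the whole
    sample vectors, the form in which independence is assumed.\<close>
  define U where "U x = (\<Sum>l<n. u (x l)) / n" for x :: "nat \<Rightarrow> 'a"
  define G where "G y = \<bar>(\<Sum>l<n. q (y l) - (\<integral>x. q x \<partial>N)) / n\<bar>" for y :: "nat \<Rightarrow> 'a"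
  have [measurable]: "U \<in> borel_measurable (Pi\<^sub>M {..<n} (\<lambda>_. M))"
    unfolding U_def using u(1) by measurable
  have [measurable]: "G \<in> borel_measurable (Pi\<^sub>M {..<n} (\<lambda>_. N))"
    unfolding G_def using q(1) by measurable
  have ind': "X.indep_var borel (U \<circ> ?XX) borel (G \<circ> ?YY)"
    using ind unfolding indep_samples_def by (rule X.indep_var_compose) measurable
  have uX: "?u \<omega> = (U \<circ> ?XX) \<omega>" if "\<omega> \<in> space P" for \<omega>
    using integral_empirical_measure[of n "\<lambda>l. X l \<omega>" M u] X.Y_space[OF _ that] u(1)
    by (simp add: U_def)
  have qY: "\<bar>Y.fluctuation q \<omega>\<bar> = (G \<circ> ?YY) \<omega>" if "\<omega> \<in> space P" for \<omega>
    using Y.fluctuation_eq[OF q that] by (simp add: G_def)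
  have intG: "integrable P (G \<circ> ?YY)"
    using Y.fluctuation_integrable(2)[OF q] by (subst Bochner_Integration.integrable_cong[OF refl qY[symmetric]]) auto
  have u_int: "integrable P (\<lambda>\<omega>. u (X l \<omega>))" if "l < n" for l
    using u X.Y_space[OF that] measurable_compose[OF X.Y_measurable[OF that] u(1)]
    by (intro X.integrable_const_bound[where B=A] AE_I2) auto
  have intU: "integrable P (U \<circ> ?XX)" "(\<integral>\<omega>. (U \<circ> ?XX) \<omega> \<partial>P) = (\<integral>x. u x \<partial>M)"
    unfolding U_def comp_def using u_int X.expectation_Y[OF u(1)] X.n_pos
    by (auto intro!: Bochner_Integration.integrable_divide Bochner_Integration.integrable_sum)
  have nn: "0 \<le> (U \<circ> ?XX) \<omega>" "0 \<le> (G \<circ> ?YY) \<omega>" if "\<omega> \<in> space P" for \<omega>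
    using u(2) X.Y_space[OF _ that] by (auto simp: U_def G_def intro!: divide_nonneg_nonneg sum_nonneg)
  have "(\<integral>\<^sup>+\<omega>. ennreal (?u \<omega> * \<bar>Y.fluctuation q \<omega>\<bar>) \<partial>P) = (\<integral>\<^sup>+\<omega>. ennreal ((U \<circ> ?XX) \<omega> * (G \<circ> ?YY) \<omega>) \<partial>P)"
    using uX qY by (intro nn_integral_cong) simp
  also have "\<dots> = ennreal (\<integral>\<omega>. (U \<circ> ?XX) \<omega> * (G \<circ> ?YY) \<omega> \<partial>P)"
    using nn X.indep_var_integrable[OF ind' intU(1) intG]
    by (intro nn_integral_eq_integral AE_I2) auto
  also have "(\<integral>\<omega>. (U \<circ> ?XX) \<omega> * (G \<circ> ?YY) \<omega> \<partial>P) = (\<integral>x. u x \<partial>M) * (\<integral>\<omega>. \<bar>Y.fluctuation q \<omega>\<bar> \<partial>P)"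
    using X.indep_var_lebesgue_integral[OF ind' intU(1) intG] intU(2)
      Bochner_Integration.integral_cong[OF refl qY, of P] by simp
  also have "\<dots> \<le> (\<integral>x. u x \<partial>M) * sqrt ((\<integral>x. (q x)\<^sup>2 \<partial>N) / n)"
    using u(2) by (intro mult_left_mono Y.expectation_abs_fluctuation[OF q] integral_nonneg_AE AE_I2) auto
  finally show ?thesis by (simp add: ennreal_leI)
qed

section \<open>Sampling error for finitely valued costs\<close>

text \<open>Jensen's inequality for the square root, from Cauchy-Schwarz with the factors
  \<open>sqrt (a i)\<close> and \<open>sqrt (a i * t i)\<close>.\<close>

lemma sum_weights_sqrt_le:
  fixes a t :: "'i \<Rightarrow> real"
  assumes a: "\<And>i. i \<in> I \<Longrightarrow> 0 \<le> a i" "(\<Sum>i\<in>I. a i) = 1" and t: "\<And>i. i \<in> I \<Longrightarrow> 0 \<le> t i"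
  shows "(\<Sum>i\<in>I. a i * sqrt (t i)) \<le> sqrt (\<Sum>i\<in>I. a i * t i)"
proof (rule real_le_rsqrt)
  have "(\<Sum>i\<in>I. a i * sqrt (t i))\<^sup>2 = (\<Sum>i\<in>I. sqrt (a i) * sqrt (a i * t i))\<^sup>2"
    using a t by (intro arg_cong[of _ _ "\<lambda>x. x\<^sup>2"] sum.cong refl) (simp add: real_sqrt_mult)
  also have "\<dots> \<le> (\<Sum>i\<in>I. (sqrt (a i))\<^sup>2) * (\<Sum>i\<in>I. (sqrt (a i * t i))\<^sup>2)"
    by (rule Cauchy_Schwarz_ineq_sum)
  also have "\<dots> = (\<Sum>i\<in>I. a i * t i)" using a t by simp
  finally show "(\<Sum>i\<in>I. a i * sqrt (t i))\<^sup>2 \<le> (\<Sum>i\<in>I. a i * t i)" .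
qed

lemma (in sample)
  assumes T: "T \<in> measurable N (count_space J)" and J: "finite J" "j \<in> J"
  shows integral_indicator_empirical: "\<omega> \<in> space P \<Longrightarrow>
      (\<integral>x. indicator {j} (T x) \<partial>empirical_measure N n (\<lambda>l. Y l \<omega>)) = law (empirical_measure N n (\<lambda>l. Y l \<omega>)) T j"
    and law_empirical: "\<omega> \<in> space P \<Longrightarrow>
      law (empirical_measure N n (\<lambda>l. Y l \<omega>)) T j = (\<Sum>l<n. indicator {j} (T (Y l \<omega>))) / n"
    and law_empirical_measurable: "(\<lambda>\<omega>. law (empirical_measure N n (\<lambda>l. Y l \<omega>)) T j) \<in> borel_measurable P"
proof -
  have u: "(\<lambda>x. indicator {j} (T x) :: real) \<in> borel_measurable N" using T by (rule measurable_compose) simp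
  have int: "(\<integral>x. indicator {j} (T x) \<partial>empirical_measure N n (\<lambda>l. Y l \<omega>)) = law (empirical_measure N n (\<lambda>l. Y l \<omega>)) T j"
    if "\<omega> \<in> space P" for \<omega>
  proof (rule integral_indicator_law[OF _ _ J])
    show "finite_measure (empirical_measure N n (\<lambda>l. Y l \<omega>))"
      using that by (intro prob_space.finite_measure prob_space_empirical_measure n_pos Y_space)
    show "T \<in> measurable (empirical_measure N n (\<lambda>l. Y l \<omega>)) (count_space J)"
      using T measurable_cong_sets[OF sets_empirical_measure refl] by blast
  qed
  show "(\<integral>x. indicator {j} (T x) \<partial>empirical_measure N n (\<lambda>l. Y l \<omega>)) = law (empirical_measure N n (\<lambda>l. Y l \<omega>)) T j"
    if "\<omega> \<in> space P" for \<omega> by (rule int[OF that])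
  show eq: "law (empirical_measure N n (\<lambda>l. Y l \<omega>)) T j = (\<Sum>l<n. indicator {j} (T (Y l \<omega>))) / n"
    if "\<omega> \<in> space P" for \<omega>
    unfolding int[OF that, symmetric] using Y_space[OF _ that] u by (intro integral_empirical_measure) auto
  show "(\<lambda>\<omega>. law (empirical_measure N n (\<lambda>l. Y l \<omega>)) T j) \<in> borel_measurable P"
    by (subst measurable_cong[OF eq])
       (auto intro!: borel_measurable_divide borel_measurable_sum measurable_compose[OF Y_measurable u])
qed

lemma (in sample) finite_fluctuation:
  fixes v :: "'j \<Rightarrow> real"
  assumes T: "T \<in> measurable N (count_space J)" and J: "finite J"
  defines "W \<equiv> \<lambda>\<omega>. (\<Sum>j\<in>J. law (empirical_measure N n (\<lambda>l. Y l \<omega>)) T j * v j) - (\<Sum>j\<in>J. law N T j * v j)"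
  shows "\<omega> \<in> space P \<Longrightarrow> W \<omega> = fluctuation (\<lambda>x. v (T x)) \<omega>"
    and "W \<in> borel_measurable P"
    and "(\<integral>\<^sup>+\<omega>. ennreal \<bar>W \<omega>\<bar> \<partial>P) \<le> ennreal (sqrt ((\<Sum>j\<in>J. law N T j * (v j)\<^sup>2) / n))"
proof -
  interpret N: prob_space N by (rule prob_space_N)
  have q: "(\<lambda>x. v (T x)) \<in> borel_measurable N" using T by (auto intro: measurable_compose)
  have b: "\<bar>v (T x)\<bar> \<le> (\<Sum>j\<in>J. \<bar>v j\<bar>)" if "x \<in> space N" for x
    using measurable_space[OF T that] J by (intro member_le_sum[of _ J "\<lambda>j. \<bar>v j\<bar>"]) auto
  show W: "W \<omega> = fluctuation (\<lambda>x. v (T x)) \<omega>" if \<omega>: "\<omega> \<in> space P" for \<omega>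
  proof -
    interpret E: prob_space "empirical_measure N n (\<lambda>l. Y l \<omega>)"
      using \<omega> by (intro prob_space_empirical_measure n_pos Y_space)
    have "T \<in> measurable (empirical_measure N n (\<lambda>l. Y l \<omega>)) (count_space J)"
      using T measurable_cong_sets[OF sets_empirical_measure refl] by blast
    then show ?thesis
      unfolding W_def fluctuation_def
      using integral_finite_valued[OF N.finite_measure_axioms T J]
        integral_finite_valued[OF E.finite_measure_axioms _ J] by simp
  qed
  show "W \<in> borel_measurable P"
    using fluctuation_measurable[OF q b] by (subst measurable_cong[OF W])
  have "(\<integral>\<^sup>+\<omega>. ennreal \<bar>W \<omega>\<bar> \<partial>P) = (\<integral>\<^sup>+\<omega>. ennreal \<bar>fluctuation (\<lambda>x. v (T x)) \<omega>\<bar> \<partial>P)"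
    using W by (intro nn_integral_cong) simp
  also have "\<dots> \<le> ennreal (sqrt ((\<integral>x. (v (T x))\<^sup>2 \<partial>N) / n))"
    by (rule nn_integral_abs_fluctuation[OF q b])
  also have "(\<integral>x. (v (T x))\<^sup>2 \<partial>N) = (\<Sum>j\<in>J. law N T j * (v j)\<^sup>2)"
    by (rule integral_finite_valued[OF N.finite_measure_axioms T J])
  finally show "(\<integral>\<^sup>+\<omega>. ennreal \<bar>W \<omega>\<bar> \<partial>P) \<le> ennreal (sqrt ((\<Sum>j\<in>J. law N T j * (v j)\<^sup>2) / n))" .
qed

text \<open>Random weights from one sample multiply fluctuations of the other. Independence replaces
  the weights by their means, and Jensen's inequality moves the weighted average under the square
  root, so that the cardinality of \<open>I\<close> does not appear.\<close>

lemma
  fixes q :: "'i \<Rightarrow> 'j \<Rightarrow> real"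
  assumes X: "sample P M n X" and Y: "sample P N n Y" and ind: "indep_samples P M N n X Y"
    and T: "T \<in> measurable M (count_space I)" "T' \<in> measurable N (count_space J)"
    and fin: "finite I" "finite J"
  defines "W \<equiv> \<lambda>\<omega>. \<Sum>i\<in>I. law (empirical_measure M n (\<lambda>l. X l \<omega>)) T i *
      \<bar>(\<Sum>j\<in>J. law (empirical_measure N n (\<lambda>l. Y l \<omega>)) T' j * q i j) - (\<Sum>j\<in>J. law N T' j * q i j)\<bar>"
  shows mixed_fluctuation_measurable: "W \<in> borel_measurable P"
    and nn_integral_mixed_fluctuation:
      "(\<integral>\<^sup>+\<omega>. ennreal (W \<omega>) \<partial>P) \<le> ennreal (sqrt ((\<Sum>i\<in>I. law M T i * (\<Sum>j\<in>J. law N T' j * (q i j)\<^sup>2)) / n))"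
proof -
  interpret X: sample P M n X by fact
  interpret Y: sample P N n Y by fact
  interpret M: prob_space M by (rule X.prob_space_N)
  interpret N: prob_space N by (rule Y.prob_space_N)
  let ?a = "\<lambda>\<omega> i. law (empirical_measure M n (\<lambda>l. X l \<omega>)) T i"
  let ?Z = "\<lambda>\<omega> i. (\<Sum>j\<in>J. law (empirical_measure N n (\<lambda>l. Y l \<omega>)) T' j * q i j) - (\<Sum>j\<in>J. law N T' j * q i j)"
  have W: "W \<omega> = (\<Sum>i\<in>I. ?a \<omega> i * \<bar>?Z \<omega> i\<bar>)" for \<omega> by (simp add: W_def)
  note a_meas = X.law_empirical_measurable[OF T(1) fin(1)]
  note Z_meas = Y.finite_fluctuation(2)[OF T(2) fin(2)]
  have prod_meas: "(\<lambda>\<omega>. ?a \<omega> i * \<bar>?Z \<omega> i\<bar>) \<in> borel_measurable P" if "i \<in> I" for i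
    by (intro borel_measurable_times a_meas[OF that] borel_measurable_abs Z_meas)
  then show "W \<in> borel_measurable P" unfolding W by (rule borel_measurable_sum)
  have term_le: "(\<integral>\<^sup>+\<omega>. ennreal (?a \<omega> i * \<bar>?Z \<omega> i\<bar>) \<partial>P) \<le> ennreal (law M T i * sqrt ((\<Sum>j\<in>J. law N T' j * (q i j)\<^sup>2) / n))"
    if i: "i \<in> I" for i
  proof -
    have u: "(\<lambda>x. indicator {i} (T x) :: real) \<in> borel_measurable M"
      using T(1) by (rule measurable_compose) simp
    have v: "(\<lambda>x. q i (T' x)) \<in> borel_measurable N"
      using T(2) by (rule measurable_compose) simp
    have b: "\<bar>q i (T' x)\<bar> \<le> (\<Sum>j\<in>J. \<bar>q i j\<bar>)" if "x \<in> space N" for x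
      using measurable_space[OF T(2) that] fin by (intro member_le_sum[of _ J "\<lambda>j. \<bar>q i j\<bar>"]) auto
    have "(\<integral>\<^sup>+\<omega>. ennreal (?a \<omega> i * \<bar>?Z \<omega> i\<bar>) \<partial>P)
        = (\<integral>\<^sup>+\<omega>. ennreal ((\<integral>x. indicator {i} (T x) \<partial>empirical_measure M n (\<lambda>l. X l \<omega>))
            * \<bar>Y.fluctuation (\<lambda>x. q i (T' x)) \<omega>\<bar>) \<partial>P)"
      using X.integral_indicator_empirical[OF T(1) fin(1) i] Y.finite_fluctuation(1)[OF T(2) fin(2), of _ "q i"] by (intro nn_integral_cong) simp
    also have "\<dots> \<le> ennreal ((\<integral>x. indicator {i} (T x) \<partial>M) * sqrt ((\<integral>x. (q i (T' x))\<^sup>2 \<partial>N) / n))"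
      by (rule nn_integral_average_times_fluctuation[OF X Y ind u _ v b, where A=1]) auto
    also have "(\<integral>x. indicator {i} (T x) \<partial>M) = law M T i"
      by (rule integral_indicator_law[OF M.finite_measure_axioms T(1) fin(1) i])
    also have "(\<integral>x. (q i (T' x))\<^sup>2 \<partial>N) = (\<Sum>j\<in>J. law N T' j * (q i j)\<^sup>2)"
      by (rule integral_finite_valued[OF N.finite_measure_axioms T(2) fin(2)])
    finally show ?thesis .
  qed
  have "(\<integral>\<^sup>+\<omega>. ennreal (W \<omega>) \<partial>P) = (\<integral>\<^sup>+\<omega>. (\<Sum>i\<in>I. ennreal (?a \<omega> i * \<bar>?Z \<omega> i\<bar>)) \<partial>P)"
    unfolding W by (intro nn_integral_cong sum_ennreal[symmetric]) (simp add: law_nonneg)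
  also have "\<dots> = (\<Sum>i\<in>I. (\<integral>\<^sup>+\<omega>. ennreal (?a \<omega> i * \<bar>?Z \<omega> i\<bar>) \<partial>P))"
    by (intro nn_integral_sum measurable_compose[OF prod_meas]) auto
  also have "\<dots> \<le> (\<Sum>i\<in>I. ennreal (law M T i * sqrt ((\<Sum>j\<in>J. law N T' j * (q i j)\<^sup>2) / n)))"
    by (intro sum_mono term_le)
  also have "\<dots> = ennreal (\<Sum>i\<in>I. law M T i * sqrt ((\<Sum>j\<in>J. law N T' j * (q i j)\<^sup>2) / n))"
    by (intro sum_ennreal) (auto intro!: mult_nonneg_nonneg divide_nonneg_nonneg sum_nonneg simp: law_nonneg)
  also have "\<dots> \<le> ennreal (sqrt (\<Sum>i\<in>I. law M T i * ((\<Sum>j\<in>J. law N T' j * (q i j)\<^sup>2) / n)))"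
    using weights_sum[OF weights_law[OF M.prob_space_axioms T(1) fin(1)]]
    by (intro ennreal_leI sum_weights_sqrt_le) (auto intro!: divide_nonneg_nonneg sum_nonneg mult_nonneg_nonneg simp: law_nonneg)
  also have "(\<Sum>i\<in>I. law M T i * ((\<Sum>j\<in>J. law N T' j * (q i j)\<^sup>2) / n))
      = (\<Sum>i\<in>I. law M T i * (\<Sum>j\<in>J. law N T' j * (q i j)\<^sup>2)) / n"
    by (simp only: sum_divide_distrib[where A=I] times_divide_eq_right)
  finally show "(\<integral>\<^sup>+\<omega>. ennreal (W \<omega>) \<partial>P) \<le> ennreal (sqrt ((\<Sum>i\<in>I. law M T i * (\<Sum>j\<in>J. law N T' j * (q i j)\<^sup>2)) / n))" .
qed

lemma weighted_sum_le:
  fixes a u z :: "'i \<Rightarrow> real"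
  assumes "\<And>i. i \<in> I \<Longrightarrow> 0 \<le> a i" "\<And>i. i \<in> I \<Longrightarrow> \<bar>u i\<bar> \<le> \<kappa>" "\<And>i. i \<in> I \<Longrightarrow> z' i = 1"
  shows "(\<Sum>i\<in>I. a i * (u i * (1 - z i))) \<le> \<kappa> * (\<Sum>i\<in>I. a i * \<bar>z i - z' i\<bar>)"
  unfolding sum_distrib_left mult.left_commute[of \<kappa>]
proof (intro sum_mono mult_left_mono assms(1))
  fix i assume i: "i \<in> I"
  have "u i * (1 - z i) \<le> \<bar>u i\<bar> * \<bar>z i - z' i\<bar>"
    unfolding assms(3)[OF i] abs_minus_commute[of _ 1] abs_mult[symmetric] by (rule abs_ge_self)
  also have "\<dots> \<le> \<kappa> * \<bar>z i - z' i\<bar>" using assms(2)[OF i] by (rule mult_right_mono) simp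
  finally show "u i * (1 - z i) \<le> \<kappa> * \<bar>z i - z' i\<bar>" .
qed

context finite_ot
begin

text \<open>From below, the population potentials compete in the empirical dual problem; from above,
  the empirical dual is linearized at them. The random empirical potentials survive only in the
  factors \<open>2 * K\<close> and \<open>K\<close>, the lengths of the ranges of \<open>f\<close>
  and \<open>g\<close>; everything else averages fixed functions. The terms \<open>?C\<close> and
  \<open>?D\<close> change the two weights in the \<open>\<psi>\<close> sum one at a time.\<close>

lemma optimal_value_diff_le:
  assumes w: "weights I a" "weights J b" and w': "weights I a'" "weights J b'"
    and p: "potentials a b f g"
    and g: "\<And>j. j \<in> J \<Longrightarrow> 0 \<le> g j \<and> g j \<le> K"
    and f: "\<And>i. i \<in> I \<Longrightarrow> \<epsilon> * t\<^sub>0 - K \<le> f i \<and> f i \<le> \<epsilon> * t\<^sub>0 + K"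
  shows "\<bar>optimal_value a' b' - optimal_value a b\<bar> \<le>
      \<bar>(\<Sum>i\<in>I. a' i * f i) - (\<Sum>i\<in>I. a i * f i)\<bar> + \<bar>(\<Sum>j\<in>J. b' j * g j) - (\<Sum>j\<in>J. b j * g j)\<bar>
    + (\<Sum>i\<in>I. a' i * \<bar>(\<Sum>j\<in>J. b' j * (\<epsilon> * \<psi> (slack f g i j))) - (\<Sum>j\<in>J. b j * (\<epsilon> * \<psi> (slack f g i j)))\<bar>)
    + \<bar>(\<Sum>i\<in>I. a' i * (\<Sum>j\<in>J. b j * (\<epsilon> * \<psi> (slack f g i j))))
        - (\<Sum>i\<in>I. a i * (\<Sum>j\<in>J. b j * (\<epsilon> * \<psi> (slack f g i j))))\<bar>
    + 2 * K * (\<Sum>i\<in>I. a' i * \<bar>(\<Sum>j\<in>J. b' j * \<psi>' (slack f g i j)) - (\<Sum>j\<in>J. b j * \<psi>' (slack f g i j))\<bar>)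
    + K * (\<Sum>j\<in>J. b' j * \<bar>(\<Sum>i\<in>I. a' i * \<psi>' (slack f g i j)) - (\<Sum>i\<in>I. a i * \<psi>' (slack f g i j))\<bar>)"
    (is "_ \<le> ?A + ?B + ?C + ?D + 2 * K * ?E + K * ?F")
proof -
  obtain f' g' where p': "potentials a' b' f' g'" and g': "\<And>j. j \<in> J \<Longrightarrow> 0 \<le> g' j \<and> g' j \<le> K"
    and f': "\<And>i. i \<in> I \<Longrightarrow> \<epsilon> * t\<^sub>0 - K \<le> f' i \<and> f' i \<le> \<epsilon> * t\<^sub>0 + K"
    using ex_bounded_potentials[OF w'] by metis
  let ?q = "\<lambda>i j. \<epsilon> * \<psi> (slack f g i j)"
  let ?p = "\<lambda>i j. \<psi>' (slack f g i j)"
  have rows: "(\<Sum>j\<in>J. b j * ?p i j) = 1" if "i \<in> I" for i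
    using p that by (auto simp: potentials_def rows_ok_def)
  have cols: "(\<Sum>i\<in>I. a i * ?p i j) = 1" if "j \<in> J" for j
    using p that by (auto simp: potentials_def cols_ok_def)
  have dual_eq: "dual \<alpha> \<beta> f g = (\<Sum>i\<in>I. \<alpha> i * f i) + (\<Sum>j\<in>J. \<beta> j * g j) - (\<Sum>i\<in>I. \<alpha> i * (\<Sum>j\<in>J. \<beta> j * ?q i j))"
    for \<alpha> \<beta> unfolding dual_def by (simp add: sum_distrib_left mult.left_commute mult.assoc)
  have split: "(\<Sum>i\<in>I. a' i * (\<Sum>j\<in>J. b' j * ?q i j)) - (\<Sum>i\<in>I. a' i * (\<Sum>j\<in>J. b j * ?q i j))
      = (\<Sum>i\<in>I. a' i * ((\<Sum>j\<in>J. b' j * ?q i j) - (\<Sum>j\<in>J. b j * ?q i j)))"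
    by (simp add: right_diff_distrib sum_subtractf)
  have C: "\<bar>(\<Sum>i\<in>I. a' i * ((\<Sum>j\<in>J. b' j * ?q i j) - (\<Sum>j\<in>J. b j * ?q i j)))\<bar> \<le> ?C"
    using weights_nonneg[OF w'(1)] by (intro order.trans[OF sum_abs] sum_mono) (simp add: abs_mult)
  have dd: "\<bar>dual a' b' f g - dual a b f g\<bar> \<le> ?A + ?B + ?C + ?D"
    using C unfolding dual_eq split[symmetric] by linarith
  have E: "(\<Sum>i\<in>I. a' i * ((f' i - f i) * (1 - (\<Sum>j\<in>J. b' j * ?p i j)))) \<le> 2 * K * ?E"
  proof (rule weighted_sum_le[OF weights_nonneg[OF w'(1)] _ rows])
    show "\<bar>f' i - f i\<bar> \<le> 2 * K" if "i \<in> I" for i using f[OF that] f'[OF that] by linarith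
  qed
  have F: "(\<Sum>j\<in>J. b' j * ((g' j - g j) * (1 - (\<Sum>i\<in>I. a' i * ?p i j)))) \<le> K * ?F"
  proof (rule weighted_sum_le[OF weights_nonneg[OF w'(2)] _ cols])
    show "\<bar>g' j - g j\<bar> \<le> K" if "j \<in> J" for j using g[OF that] g'[OF that] by linarith
  qed
  have nn: "0 \<le> 2 * K * ?E + K * ?F"
  proof -
    obtain j where "j \<in> J" using weights_nonempty[OF w(2)] by blast
    then have "K \<ge> 0" using g[of j] by linarith
    then show ?thesis
      using weights_nonneg[OF w'(1)] weights_nonneg[OF w'(2)]
      by (intro add_nonneg_nonneg mult_nonneg_nonneg sum_nonneg) auto
  qed
  have "dual a' b' f g \<le> dual a' b' f' g'" by (rule dual_le_potentials[OF w' p'])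
  moreover have "dual a' b' f' g' \<le> dual a' b' f g + 2 * K * ?E + K * ?F"
    using dual_le_linearization[OF w', of f' g' f g] E F by linarith
  ultimately show ?thesis
    unfolding optimal_value_eq[OF w p] optimal_value_eq[OF w' p'] using dd nn by linarith
qed

end

section \<open>Expected sampling error of the dual value\<close>

locale finite_sampling = finite_transport \<phi> t\<^sub>0 \<delta> C\<^sub>\<psi> \<gamma> I J k K \<epsilon> M N T T' c
    + X: sample P M n X + Y: sample P N n Y
  for \<phi> t\<^sub>0 \<delta> C\<^sub>\<psi> \<gamma> and I :: "'i set" and J :: "'j set" and k K \<epsilon>
    and M :: "'a measure" and N :: "'a measure" and T T' c and P :: "'w measure" and n X Y +
  assumes ind: "indep_samples P M N n X Y"
begin

abbreviation M' where "M' \<omega> \<equiv> empirical_measure M n (\<lambda>l. X l \<omega>)"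
abbreviation N' where "N' \<omega> \<equiv> empirical_measure N n (\<lambda>l. Y l \<omega>)"

lemma finite_transport_empirical:
  assumes "\<omega> \<in> space P"
  shows "finite_transport \<phi> t\<^sub>0 \<delta> C\<^sub>\<psi> \<gamma> I J k K \<epsilon> (M' \<omega>) (N' \<omega>) T T' c"
proof (intro finite_transport.intro finite_transport_axioms.intro finite_ot_axioms)
  show "prob_space (M' \<omega>)" "prob_space (N' \<omega>)"
    using assms X.Y_space Y.Y_space X.n_pos by (auto intro: prob_space_empirical_measure)
  show "T \<in> measurable (M' \<omega>) (count_space I)"
    using T measurable_cong_sets[OF sets_empirical_measure refl] by blast
  show "T' \<in> measurable (N' \<omega>) (count_space J)"
    using T' measurable_cong_sets[OF sets_empirical_measure refl] by blast
qed (use fin c_eq in auto)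

text \<open>The hypothesis ranges over all potentials, since the bounded ones on which the estimate
  rests are only chosen inside the proof.\<close>

lemma nn_integral_optimal_value_diff:
  fixes Q :: real
  assumes Q: "\<And>f g. potentials a b f g \<Longrightarrow>
      (\<Sum>i\<in>I. a i * (\<Sum>j\<in>J. b j * (\<psi>' (slack f g i j))\<^sup>2)) \<le> Q"
  shows "(\<integral>\<^sup>+\<omega>. ennreal \<bar>optimal_value (law (M' \<omega>) T) (law (N' \<omega>) T') - optimal_value a b\<bar> \<partial>P)
    \<le> ennreal (11 * (\<epsilon> * t\<^sub>0 + K) * sqrt (1 + Q) / sqrt n)"
proof -
  obtain f g where p: "potentials a b f g" and g: "\<And>j. j \<in> J \<Longrightarrow> 0 \<le> g j \<and> g j \<le> K"
    and f: "\<And>i. i \<in> I \<Longrightarrow> \<epsilon> * t\<^sub>0 - K \<le> f i \<and> f i \<le> \<epsilon> * t\<^sub>0 + K"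
    using ex_bounded_potentials[OF weights] by metis
  obtain i0 j0 where "i0 \<in> I" "j0 \<in> J" using weights_nonempty[OF weights(1)] weights_nonempty[OF weights(2)] by blast
  then have K: "K \<ge> 0" using g[of j0] by linarith
  define G where "G = \<epsilon> * t\<^sub>0 + K"
  have G: "0 \<le> G" "K \<le> G" using K eps_pos t0_pos by (auto simp: G_def)
  define R where "R = sqrt (1 + Q)"
  let ?q = "\<lambda>i j. \<epsilon> * \<psi> (slack f g i j)"
  let ?p = "\<lambda>i j. \<psi>' (slack f g i j)"
  have nn: "0 \<le> a i" "0 \<le> b j" for i j by (auto simp: law_nonneg)
  have sums: "(\<Sum>i\<in>I. a i) = 1" "(\<Sum>j\<in>J. b j) = 1" using weights weights_sum by auto
  have Qp: "(\<Sum>i\<in>I. a i * (\<Sum>j\<in>J. b j * (?p i j)\<^sup>2)) \<le> Q" by (rule Q[OF p])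
  have p2_nonneg: "0 \<le> (\<Sum>i\<in>I. a i * (\<Sum>j\<in>J. b j * (?p i j)\<^sup>2))" using nn by (intro sum_nonneg mult_nonneg_nonneg) auto
  then have "0 \<le> Q" using Qp by linarith
  then have R: "1 \<le> R" "sqrt Q \<le> R" by (simp_all add: R_def)
  have fG: "\<bar>f i\<bar> \<le> G" if "i \<in> I" for i
    using f[OF that] mult_pos_pos[OF eps_pos t0_pos] by (simp add: G_def abs_le_iff)
  \<comment> \<open>The ranges of \<open>f\<close>, \<open>g\<close> and \<open>k\<close> give
    \<open>2 * G\<close> for \<open>\<epsilon>\<close> times the first factor in
    \<open>abs_psi_le\<close>; the constant \<open>8\<close> is \<open>2\<close> squared times the
    \<open>2\<close> from squaring the sum \<open>1 + ?p i j\<close>.\<close>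
  have q_le: "(?q i j)\<^sup>2 \<le> 8 * G\<^sup>2 * (1 + (?p i j)\<^sup>2)" if "i \<in> I" "j \<in> J" for i j
  proof -
    have "\<bar>f i + g j - k i j\<bar> \<le> \<epsilon> * t\<^sub>0 + 2 * K"
      using f[OF that(1)] g[OF that(2)] k_bounds[OF that] mult_pos_pos[OF eps_pos t0_pos] by (simp add: abs_le_iff)
    moreover have "\<epsilon> * \<bar>slack f g i j\<bar> = \<bar>f i + g j - k i j\<bar>" using eps_pos by (simp add: slack_def abs_divide)
    ultimately have "\<epsilon> * (\<bar>slack f g i j\<bar> + t\<^sub>0) \<le> 2 * G" by (simp add: G_def distrib_left)
    then have "\<epsilon> * (\<bar>slack f g i j\<bar> + t\<^sub>0) * (1 + ?p i j) \<le> 2 * G * (1 + ?p i j)"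
      using psi'_nonneg by (intro mult_right_mono) auto
    moreover have "\<bar>?q i j\<bar> \<le> \<epsilon> * (\<bar>slack f g i j\<bar> + t\<^sub>0) * (1 + ?p i j)"
      using abs_psi_le[of "slack f g i j"] eps_pos by (simp add: abs_mult mult.assoc)
    ultimately have "\<bar>?q i j\<bar> \<le> 2 * G * (1 + ?p i j)" by linarith
    then have "(?q i j)\<^sup>2 \<le> (2 * G * (1 + ?p i j))\<^sup>2"
      using abs_le_square_iff[of "?q i j" "2 * G * (1 + ?p i j)"] by linarith
    also have "\<dots> = 4 * G\<^sup>2 * (1 + ?p i j)\<^sup>2" by (simp add: power_mult_distrib)
    also have "\<dots> \<le> 4 * G\<^sup>2 * (2 * (1 + (?p i j)\<^sup>2))"
      using sum_squares_bound[of 1 "?p i j"] by (intro mult_left_mono) (auto simp: power2_sum)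
    also have "\<dots> = 8 * G\<^sup>2 * (1 + (?p i j)\<^sup>2)" by (simp add: algebra_simps)
    finally show ?thesis .
  qed
  have q2: "(\<Sum>i\<in>I. a i * (\<Sum>j\<in>J. b j * (?q i j)\<^sup>2)) \<le> (3 * G * R)\<^sup>2"
  proof -
    have "(\<Sum>i\<in>I. a i * (\<Sum>j\<in>J. b j * (?q i j)\<^sup>2)) \<le> (\<Sum>i\<in>I. a i * (\<Sum>j\<in>J. b j * (8 * G\<^sup>2 * (1 + (?p i j)\<^sup>2))))"
      using nn q_le by (intro sum_mono mult_left_mono) auto
    also have "\<dots> = 8 * G\<^sup>2 * (\<Sum>i\<in>I. a i * (\<Sum>j\<in>J. b j * (1 + (?p i j)\<^sup>2)))"
      by (simp add: sum_distrib_left mult.left_commute mult.assoc)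
    also have "(\<Sum>i\<in>I. a i * (\<Sum>j\<in>J. b j * (1 + (?p i j)\<^sup>2))) = 1 + (\<Sum>i\<in>I. a i * (\<Sum>j\<in>J. b j * (?p i j)\<^sup>2))"
      by (simp add: distrib_left sum.distrib sums)
    \<comment> \<open>Enlarging \<open>8\<close> to \<open>9\<close> makes the bound a perfect
      square.\<close>
    also have "8 * G\<^sup>2 * \<dots> \<le> 9 * G\<^sup>2 * (1 + Q)"
      using Qp p2_nonneg by (intro mult_mono add_left_mono add_nonneg_nonneg) auto
    also have "\<dots> = (3 * G * R)\<^sup>2" using \<open>0 \<le> Q\<close> by (simp add: R_def power_mult_distrib)
    finally show ?thesis .
  qed
  have n_pos: "real n > 0" using X.n_pos by simp
  have sqrt_le: "sqrt (x / n) \<le> y / sqrt n" if "x \<le> y\<^sup>2" "0 \<le> y" for x y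
    using that by (simp add: real_sqrt_divide divide_right_mono real_le_lsqrt)
  let ?A = "\<lambda>\<omega>. (\<Sum>i\<in>I. law (M' \<omega>) T i * f i) - (\<Sum>i\<in>I. a i * f i)"
  let ?B = "\<lambda>\<omega>. (\<Sum>j\<in>J. law (N' \<omega>) T' j * g j) - (\<Sum>j\<in>J. b j * g j)"
  let ?C = "\<lambda>\<omega>. \<Sum>i\<in>I. law (M' \<omega>) T i * \<bar>(\<Sum>j\<in>J. law (N' \<omega>) T' j * ?q i j) - (\<Sum>j\<in>J. b j * ?q i j)\<bar>"
  let ?D = "\<lambda>\<omega>. (\<Sum>i\<in>I. law (M' \<omega>) T i * (\<Sum>j\<in>J. b j * ?q i j)) - (\<Sum>i\<in>I. a i * (\<Sum>j\<in>J. b j * ?q i j))"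
  let ?E = "\<lambda>\<omega>. \<Sum>i\<in>I. law (M' \<omega>) T i * \<bar>(\<Sum>j\<in>J. law (N' \<omega>) T' j * ?p i j) - (\<Sum>j\<in>J. b j * ?p i j)\<bar>"
  let ?F = "\<lambda>\<omega>. \<Sum>j\<in>J. law (N' \<omega>) T' j * \<bar>(\<Sum>i\<in>I. law (M' \<omega>) T i * ?p i j) - (\<Sum>i\<in>I. a i * ?p i j)\<bar>"
  note XY = X.sample_axioms Y.sample_axioms ind T T' fin
  \<comment> \<open>The column defects \<open>?F\<close> average over the second sample and
    fluctuate with the first, so the samples exchange roles.\<close>
  note YX = Y.sample_axioms X.sample_axioms indep_samples_sym[OF X.prob_space_axioms ind] T' T fin(2,1)
  have meas: "?A \<in> borel_measurable P" "?B \<in> borel_measurable P" "?C \<in> borel_measurable P"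
     "?D \<in> borel_measurable P" "?E \<in> borel_measurable P" "?F \<in> borel_measurable P"
    by (intro X.finite_fluctuation(2) Y.finite_fluctuation(2) mixed_fluctuation_measurable[OF XY]
        mixed_fluctuation_measurable[OF YX] T T' fin)+
  have A: "(\<integral>\<^sup>+\<omega>. ennreal \<bar>?A \<omega>\<bar> \<partial>P) \<le> ennreal (G / sqrt n)"
  proof (rule order.trans[OF X.finite_fluctuation(3)[OF T fin(1)]], intro ennreal_leI sqrt_le G)
    have "(\<Sum>i\<in>I. a i * (f i)\<^sup>2) \<le> (\<Sum>i\<in>I. a i * G\<^sup>2)"
      using fG nn G by (intro sum_mono mult_left_mono) (auto simp: abs_le_square_iff[symmetric])
    then show "(\<Sum>i\<in>I. a i * (f i)\<^sup>2) \<le> G\<^sup>2" by (simp add: sums flip: sum_distrib_right)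
  qed
  have B: "(\<integral>\<^sup>+\<omega>. ennreal \<bar>?B \<omega>\<bar> \<partial>P) \<le> ennreal (G / sqrt n)"
  proof (rule order.trans[OF Y.finite_fluctuation(3)[OF T' fin(2)]], intro ennreal_leI sqrt_le G)
    have "\<bar>g j\<bar> \<le> \<bar>G\<bar>" if "j \<in> J" for j using g[OF that] G by linarith
    then have "(\<Sum>j\<in>J. b j * (g j)\<^sup>2) \<le> (\<Sum>j\<in>J. b j * G\<^sup>2)"
      using nn by (intro sum_mono mult_left_mono) (auto simp: abs_le_square_iff[symmetric])
    then show "(\<Sum>j\<in>J. b j * (g j)\<^sup>2) \<le> G\<^sup>2" by (simp add: sums flip: sum_distrib_right)
  qed
  have C: "(\<integral>\<^sup>+\<omega>. ennreal (?C \<omega>) \<partial>P) \<le> ennreal (3 * G * R / sqrt n)"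
    using R G by (intro order.trans[OF nn_integral_mixed_fluctuation[OF XY]] ennreal_leI sqrt_le q2) auto
  have D: "(\<integral>\<^sup>+\<omega>. ennreal \<bar>?D \<omega>\<bar> \<partial>P) \<le> ennreal (3 * G * R / sqrt n)"
  proof (rule order.trans[OF X.finite_fluctuation(3)[OF T fin(1)]], intro ennreal_leI sqrt_le)
    have "(\<Sum>j\<in>J. b j * ?q i j)\<^sup>2 \<le> (\<Sum>j\<in>J. b j * (?q i j)\<^sup>2)" for i
    proof -
      have "(\<Sum>j\<in>J. b j * ?q i j)\<^sup>2 = (\<Sum>j\<in>J. sqrt (b j) * (sqrt (b j) * ?q i j))\<^sup>2"
        using nn by (simp add: mult.assoc[symmetric])
      also have "\<dots> \<le> (\<Sum>j\<in>J. (sqrt (b j))\<^sup>2) * (\<Sum>j\<in>J. (sqrt (b j) * ?q i j)\<^sup>2)"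
        by (rule Cauchy_Schwarz_ineq_sum)
      also have "\<dots> = (\<Sum>j\<in>J. b j * (?q i j)\<^sup>2)" using nn by (simp add: sums power_mult_distrib)
      finally show ?thesis .
    qed
    then have "(\<Sum>i\<in>I. a i * (\<Sum>j\<in>J. b j * ?q i j)\<^sup>2) \<le> (\<Sum>i\<in>I. a i * (\<Sum>j\<in>J. b j * (?q i j)\<^sup>2))"
      using nn by (intro sum_mono mult_left_mono)
    then show "(\<Sum>i\<in>I. a i * (\<Sum>j\<in>J. b j * ?q i j)\<^sup>2) \<le> (3 * G * R)\<^sup>2" using q2 by linarith
  qed (use G R in auto)
  have E: "(\<integral>\<^sup>+\<omega>. ennreal (?E \<omega>) \<partial>P) \<le> ennreal (R / sqrt n)"
    using R Qp \<open>0 \<le> Q\<close>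
    by (intro order.trans[OF nn_integral_mixed_fluctuation[OF XY]] ennreal_leI sqrt_le) (auto simp: R_def)
  have F: "(\<integral>\<^sup>+\<omega>. ennreal (?F \<omega>) \<partial>P) \<le> ennreal (R / sqrt n)"
  proof (rule order.trans[OF nn_integral_mixed_fluctuation[OF YX]], intro ennreal_leI sqrt_le)
    have "(\<Sum>j\<in>J. b j * (\<Sum>i\<in>I. a i * (?p i j)\<^sup>2)) = (\<Sum>i\<in>I. a i * (\<Sum>j\<in>J. b j * (?p i j)\<^sup>2))"
      unfolding sum_distrib_left by (subst sum.swap) (simp add: ac_simps)
    then show "(\<Sum>j\<in>J. b j * (\<Sum>i\<in>I. a i * (?p i j)\<^sup>2)) \<le> R\<^sup>2"
      using Qp \<open>0 \<le> Q\<close> by (simp add: R_def)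
  qed (use R in auto)
  have "(\<integral>\<^sup>+\<omega>. ennreal \<bar>optimal_value (law (M' \<omega>) T) (law (N' \<omega>) T') - optimal_value a b\<bar> \<partial>P)
    \<le> (\<integral>\<^sup>+\<omega>. ennreal \<bar>?A \<omega>\<bar> + ennreal \<bar>?B \<omega>\<bar> + ennreal (?C \<omega>) + ennreal \<bar>?D \<omega>\<bar>
        + ennreal (2 * K) * ennreal (?E \<omega>) + ennreal K * ennreal (?F \<omega>) \<partial>P)"
  proof (rule nn_integral_mono)
    fix \<omega> assume "\<omega> \<in> space P"
    interpret E: finite_transport \<phi> t\<^sub>0 \<delta> C\<^sub>\<psi> \<gamma> I J k K \<epsilon> "M' \<omega>" "N' \<omega>" T T' c
      by (rule finite_transport_empirical) fact
    have nn': "0 \<le> ?C \<omega>" "0 \<le> ?E \<omega>" "0 \<le> ?F \<omega>"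
      by (auto intro!: sum_nonneg mult_nonneg_nonneg simp: law_nonneg)
    show "ennreal \<bar>optimal_value (law (M' \<omega>) T) (law (N' \<omega>) T') - optimal_value a b\<bar>
      \<le> ennreal \<bar>?A \<omega>\<bar> + ennreal \<bar>?B \<omega>\<bar> + ennreal (?C \<omega>) + ennreal \<bar>?D \<omega>\<bar>
        + ennreal (2 * K) * ennreal (?E \<omega>) + ennreal K * ennreal (?F \<omega>)"
      using ennreal_leI[OF optimal_value_diff_le[OF weights E.weights p g f]] nn' K
      by (simp add: ennreal_plus ennreal_mult)
  qed
  also have "\<dots> = (\<integral>\<^sup>+\<omega>. ennreal \<bar>?A \<omega>\<bar> \<partial>P) + (\<integral>\<^sup>+\<omega>. ennreal \<bar>?B \<omega>\<bar> \<partial>P)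
      + (\<integral>\<^sup>+\<omega>. ennreal (?C \<omega>) \<partial>P) + (\<integral>\<^sup>+\<omega>. ennreal \<bar>?D \<omega>\<bar> \<partial>P)
      + ennreal (2 * K) * (\<integral>\<^sup>+\<omega>. ennreal (?E \<omega>) \<partial>P) + ennreal K * (\<integral>\<^sup>+\<omega>. ennreal (?F \<omega>) \<partial>P)"
    using meas by (simp add: nn_integral_add nn_integral_cmult)
  also have "\<dots> \<le> ennreal (G / sqrt n) + ennreal (G / sqrt n) + ennreal (3 * G * R / sqrt n) + ennreal (3 * G * R / sqrt n)
      + ennreal (2 * K) * ennreal (R / sqrt n) + ennreal K * ennreal (R / sqrt n)"
    by (intro add_mono mult_left_mono A B C D E F) auto
  also have "\<dots> = ennreal (G / sqrt n + G / sqrt n + 3 * G * R / sqrt n + 3 * G * R / sqrt n + 2 * K * (R / sqrt n) + K * (R / sqrt n))"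
  proof -
    have "0 \<le> G / sqrt n" "0 \<le> 3 * G * R / sqrt n" "0 \<le> R / sqrt n" "0 \<le> 2 * K" using G R K by auto
    with K show ?thesis
      by (simp only: ennreal_plus ennreal_mult add_nonneg_nonneg mult_nonneg_nonneg)
  qed
  \<comment> \<open>The count is \<open>2 + 6 + 3\<close>, using \<open>1 \<le> R\<close> for the
    first two terms and \<open>K \<le> G\<close> for the last two.\<close>
  also have "\<dots> \<le> ennreal (11 * G * R / sqrt n)"
  proof (rule ennreal_leI)
    have "G * 1 \<le> G * R" using G R by (intro mult_left_mono) auto
    moreover have "K * R \<le> G * R" using G R by (intro mult_right_mono) auto
    ultimately have "(2 * G + 6 * (G * R) + 3 * (K * R)) / sqrt n \<le> (11 * (G * R)) / sqrt n"
      using n_pos by (intro divide_right_mono) auto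
    then show "G / sqrt n + G / sqrt n + 3 * G * R / sqrt n + 3 * G * R / sqrt n + 2 * K * (R / sqrt n) + K * (R / sqrt n)
        \<le> 11 * G * R / sqrt n"
      by (simp add: add_divide_distrib mult.assoc)
  qed
  finally show ?thesis by (simp add: G_def R_def)
qed

end

section \<open>Geometry of the space\<close>

lemma space_Rd: "space (Rd d) = PiE {..<d} (\<lambda>_. UNIV)"
  by (simp add: Rd_def space_PiM)

lemma dist_Rd_nonneg [simp]: "0 \<le> dist_Rd d x y"
  by (simp add: dist_Rd_def)

lemma dist_Rd_self [simp]: "dist_Rd d x x = 0"
  by (simp add: dist_Rd_def L2_set_def)

lemma dist_Rd_sym: "dist_Rd d x y = dist_Rd d y x"
  by (simp add: dist_Rd_def L2_set_def power2_commute)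

lemma dist_Rd_triangle: "dist_Rd d x z \<le> dist_Rd d x y + dist_Rd d y z"
  using L2_set_triangle_ineq[of "\<lambda>i. x i - y i" "\<lambda>i. y i - z i" "{..<d}"]
  by (simp add: dist_Rd_def)

lemma dist_Rd_measurable:
  "(\<lambda>z. dist_Rd d (fst z) (snd z)) \<in> borel_measurable (Rd d \<Otimes>\<^sub>M Rd d)"
  unfolding dist_Rd_def L2_set_def Rd_def by measurable

lemma dist_Rd_measurable': "x \<in> space (Rd d) \<Longrightarrow> dist_Rd d x \<in> borel_measurable (Rd d)"
  unfolding dist_Rd_def L2_set_def Rd_def by measurable

lemma zero_Rd_space: "zero_Rd d \<in> space (Rd d)"
  by (auto simp: space_Rd zero_Rd_def)

lemma ball_Rd_sets: "x \<in> space (Rd d) \<Longrightarrow> ball_Rd d x r \<in> sets (Rd d)"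
  unfolding ball_Rd_def using dist_Rd_measurable'[of x d] by measurable

definition grid :: "nat \<Rightarrow> real \<Rightarrow> (nat \<Rightarrow> real) \<Rightarrow> nat \<Rightarrow> real" where
  "grid d s x = (\<lambda>i\<in>{..<d}. s * of_int \<lfloor>x i / s\<rfloor>)"

lemma grid_space: "grid d s x \<in> space (Rd d)"
  by (auto simp: space_Rd grid_def)

lemma dist_grid:
  assumes "s > 0" shows "dist_Rd d (grid d s x) x \<le> d * s"
proof -
  have "dist_Rd d (grid d s x) x \<le> (\<Sum>i<d. \<bar>grid d s x i - x i\<bar>)"
    unfolding dist_Rd_def by (rule L2_set_le_sum_abs)
  also have "\<dots> \<le> (\<Sum>i<d. s)"
  proof (rule sum_mono)
    fix i assume "i \<in> {..<d}"
    have "\<bar>s * (of_int \<lfloor>x i / s\<rfloor> - x i / s)\<bar> \<le> s * 1"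
      unfolding abs_mult using assms by (intro mult_mono) linarith+
    then show "\<bar>grid d s x i - x i\<bar> \<le> s"
      using assms \<open>i \<in> {..<d}\<close> by (simp add: grid_def right_diff_distrib)
  qed
  finally show ?thesis by simp
qed

lemma finite_grid_ball:
  assumes "s > 0" shows "finite (grid d s ` ball_Rd d (zero_Rd d) r)"
proof (rule finite_subset)
  let ?S = "(\<lambda>k. s * of_int k) ` {\<lfloor>- r / s\<rfloor>..\<lfloor>r / s\<rfloor>}"
  show "grid d s ` ball_Rd d (zero_Rd d) r \<subseteq> PiE {..<d} (\<lambda>_. ?S)"
  proof clarify
    fix x assume x: "x \<in> ball_Rd d (zero_Rd d) r"
    have "\<bar>x i\<bar> \<le> r" if "i < d" for i
    proof -
      have "\<bar>zero_Rd d i - x i\<bar> \<le> dist_Rd d (zero_Rd d) x"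
        using member_le_L2_set[of "{..<d}" i "\<lambda>i. \<bar>zero_Rd d i - x i\<bar>"] that
        by (simp add: dist_Rd_def L2_set_def)
      then show ?thesis using x that by (simp add: ball_Rd_def zero_Rd_def)
    qed
    then have "\<lfloor>x i / s\<rfloor> \<in> {\<lfloor>- r / s\<rfloor>..\<lfloor>r / s\<rfloor>}" if "i < d" for i
    proof -
      have "- r / s \<le> x i / s" "x i / s \<le> r / s"
        using \<open>\<And>i. i < d \<Longrightarrow> \<bar>x i\<bar> \<le> r\<close>[OF that] assms divide_right_mono[of "- r" "x i" s] divide_right_mono[of "x i" r s] by auto
      then show ?thesis by (auto intro!: floor_mono)
    qed
    then show "grid d s x \<in> PiE {..<d} (\<lambda>_. ?S)" by (auto simp: grid_def)
  qed
  show "finite (PiE {..<d} (\<lambda>_. ?S))" by (intro finite_PiE) auto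
qed

lemma grid_vimage_sets:
  assumes "q \<in> space (Rd d)" shows "grid d s -` {q} \<inter> space (Rd d) \<in> sets (Rd d)"
proof -
  have "grid d s \<in> measurable (Rd d) (Rd d)"
    unfolding grid_def[abs_def] Rd_def by (intro measurable_restrict) measurable
  moreover have "{q} = PiE {..<d} (\<lambda>i. {q i})"
    using assms by (auto simp: space_Rd intro: PiE_ext)
  then have "{q} \<in> sets (Rd d)" unfolding Rd_def by (auto intro!: sets_PiM_I_finite)
  ultimately show ?thesis by (rule measurable_sets)
qed

text \<open>Two points with the same grid value are at most \<open>2 * (d * s)\<close> apart, so one
  representative per occupied cell suffices. Representatives are taken inside \<open>A\<close>,
  because a cover of \<open>A\<close> must also reach every net point. Points outside
  \<open>A\<close> go to an arbitrary net point \<open>x0\<close>.\<close>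

lemma finite_net:
  assumes A: "A \<in> sets (Rd d)" "A \<subseteq> ball_Rd d (zero_Rd d) r" "A \<noteq> {}" and \<tau>: "\<tau> > 0"
  obtains F T where "finite F" "F \<subseteq> A" "T \<in> measurable (Rd d) (count_space F)"
    "\<And>x. x \<in> A \<Longrightarrow> dist_Rd d (T x) x \<le> \<tau>"
proof -
  \<comment> \<open>The summand \<open>1\<close> keeps \<open>s\<close> positive for
    \<open>d = 0\<close>.\<close>
  define s where "s = \<tau> / (2 * (real d + 1))"
  have "s > 0" using \<tau> by (simp add: s_def)
  have ds: "2 * (d * s) \<le> \<tau>" using \<tau> by (simp add: s_def field_simps)
  obtain x0 where x0: "x0 \<in> A" using A(3) by blast
  define \<rho> where "\<rho> q = (SOME y. y \<in> A \<and> grid d s y = q)" for q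
  have \<rho>: "\<rho> (grid d s x) \<in> A" "grid d s (\<rho> (grid d s x)) = grid d s x" if "x \<in> A" for x
    using someI_ex[of "\<lambda>y. y \<in> A \<and> grid d s y = grid d s x"] that by (auto simp: \<rho>_def)
  define T where "T x = (if x \<in> A then \<rho> (grid d s x) else x0)" for x
  define F where "F = insert x0 (\<rho> ` grid d s ` A)"
  have fin: "finite (grid d s ` A)"
    by (rule finite_subset[OF image_mono[OF A(2)] finite_grid_ball[OF \<open>s > 0\<close>]])
  show thesis
  proof (rule that[of F T])
    show "finite F" using fin by (simp add: F_def)
    show "F \<subseteq> A" using x0 \<rho> by (auto simp: F_def)
    show "T \<in> measurable (Rd d) (count_space F)"
    proof (subst measurable_count_space_eq2[OF \<open>finite F\<close>], intro conjI ballI)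
      show "T \<in> space (Rd d) \<rightarrow> F" by (auto simp: T_def F_def)
      fix a assume "a \<in> F"
      have "T -` {a} \<inter> space (Rd d) = (if a = x0 then space (Rd d) - A else {})
          \<union> (\<Union>q\<in>{q\<in>grid d s ` A. \<rho> q = a}. A \<inter> (grid d s -` {q} \<inter> space (Rd d)))"
        using sets.sets_into_space[OF A(1)] by (auto simp: T_def split: if_splits)
      also have "\<dots> \<in> sets (Rd d)"
        using A(1) fin by (intro sets.Un sets.finite_UN sets.Int grid_vimage_sets) (auto simp: grid_space)
      finally show "T -` {a} \<inter> space (Rd d) \<in> sets (Rd d)" .
    qed
    fix x assume x: "x \<in> A"
    have "dist_Rd d (T x) x \<le> dist_Rd d (T x) (grid d s x) + dist_Rd d (grid d s x) x"
      by (rule dist_Rd_triangle)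
    also have "dist_Rd d (T x) (grid d s x) \<le> d * s"
      using dist_grid[OF \<open>s > 0\<close>, of d "T x"] \<rho>(2)[OF x] x by (simp add: T_def dist_Rd_sym)
    also have "dist_Rd d (grid d s x) x \<le> d * s" by (rule dist_grid[OF \<open>s > 0\<close>])
    finally show "dist_Rd d (T x) x \<le> \<tau>" using ds by linarith
  qed
qed

text \<open>The grid provides some finite cover; only then does the \<open>LEAST\<close> in
  \<open>covering_number\<close> denote an actual minimum.\<close>

lemma covering_number_cover:
  assumes A: "A \<subseteq> ball_Rd d (zero_Rd d) r" and \<eta>: "\<eta> > 0"
  obtains X where "finite X" "card X \<le> covering_number d A \<eta>" "X \<subseteq> space (Rd d)"
    "\<And>x. x \<in> A \<Longrightarrow> \<exists>z\<in>X. dist_Rd d z x < \<eta>"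
proof -
  define s where "s = \<eta> / (real d + 1)"
  have "s > 0" using \<eta> by (simp add: s_def)
  have ds: "d * s < \<eta>" using \<eta> by (simp add: s_def field_simps)
  obtain f where f: "bij_betw f {..<card (grid d s ` ball_Rd d (zero_Rd d) r)} (grid d s ` ball_Rd d (zero_Rd d) r)"
    using ex_bij_betw_nat_finite[OF finite_grid_ball[OF \<open>s > 0\<close>]] by (metis atLeast0LessThan)
  let ?P = "\<lambda>(k::nat) x. (\<forall>l<k. x l \<in> space (Rd d)) \<and> A \<subseteq> (\<Union>l<k. ball_Rd d (x l) \<eta>)"
  have "?P (card (grid d s ` ball_Rd d (zero_Rd d) r)) f"
  proof (intro conjI allI impI subsetI)
    fix l assume "l < card (grid d s ` ball_Rd d (zero_Rd d) r)"
    then have "f l \<in> grid d s ` ball_Rd d (zero_Rd d) r" using f by (auto simp: bij_betw_def)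
    then show "f l \<in> space (Rd d)" using grid_space by auto
  next
    fix x assume "x \<in> A"
    then have x: "x \<in> ball_Rd d (zero_Rd d) r" using A by auto
    then obtain l where "l < card (grid d s ` ball_Rd d (zero_Rd d) r)" "f l = grid d s x"
    proof -
      have "grid d s x \<in> f ` {..<card (grid d s ` ball_Rd d (zero_Rd d) r)}"
        using f x by (simp add: bij_betw_def)
      then show ?thesis using that by auto
    qed
    moreover have "x \<in> ball_Rd d (grid d s x) \<eta>"
      using dist_grid[OF \<open>s > 0\<close>, of d x] ds x by (auto simp: ball_Rd_def)
    ultimately show "x \<in> (\<Union>l<card (grid d s ` ball_Rd d (zero_Rd d) r). ball_Rd d (f l) \<eta>)"
      by (intro UN_I[of l]) auto
  qed
  then have "\<exists>k x. ?P k x" by blast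
  from LeastI_ex[OF this] obtain x where x: "?P (covering_number d A \<eta>) x"
    by (auto simp: covering_number_def)
  show thesis
  proof (rule that[of "x ` {..<covering_number d A \<eta>}"])
    show "card (x ` {..<covering_number d A \<eta>}) \<le> covering_number d A \<eta>"
      using card_image_le[of "{..<covering_number d A \<eta>}" x] by simp
    fix y assume "y \<in> A"
    then have "y \<in> (\<Union>l<covering_number d A \<eta>. ball_Rd d (x l) \<eta>)" using x by blast
    then show "\<exists>z\<in>x ` {..<covering_number d A \<eta>}. dist_Rd d z y < \<eta>" by (auto simp: ball_Rd_def)
  qed (use x in auto)
qed

lemma covering_number_pos:
  assumes "A \<subseteq> ball_Rd d (zero_Rd d) r" "A \<noteq> {}" "\<eta> > 0" shows "covering_number d A \<eta> > 0"
proof -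
  obtain X where X: "finite X" "card X \<le> covering_number d A \<eta>"
    "\<And>x. x \<in> A \<Longrightarrow> \<exists>z\<in>X. dist_Rd d z x < \<eta>"
    using covering_number_cover[OF assms(1,3)] by metis
  then have "X \<noteq> {}" using assms(2) by blast
  then show ?thesis using X(1,2) by (metis card_gt_0_iff order_less_le_trans)
qed

text \<open>A null ball around a point off the support contains a smaller ball from a countable
  family that still contains the point. Countability then yields that the support is measurable and
  has full measure.\<close>

lemma compl_spt_eq_UN_balls:
  assumes \<mu>: "prob_on_Rd d \<mu>"
  obtains Q :: "((nat \<Rightarrow> real) \<times> nat) set" where "countable Q" "\<And>q m. (q, m) \<in> Q \<Longrightarrow> q \<in> space (Rd d) \<and> emeasure \<mu> (ball_Rd d q (1 / Suc m)) = 0"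
      "space (Rd d) - spt d \<mu> = (\<Union>(q, m)\<in>Q. ball_Rd d q (1 / Suc m))"
proof -
  \<comment> \<open>The mesh of the grid with index \<open>m\<close> is so fine that rounding moves
    a point by less than \<open>1 / Suc m\<close>.\<close>
  define D where "D = (\<Union>m. PiE {..<d} (\<lambda>_. range (\<lambda>k::int. 1 / (real (Suc m) * (real d + 1)) * of_int k)))"
  have "countable D" unfolding D_def by (intro countable_UN countable_PiE) auto
  define Q where "Q = {(q, m) \<in> D \<times> UNIV. emeasure \<mu> (ball_Rd d q (1 / Suc m)) = 0}"
  have D: "D \<subseteq> space (Rd d)" by (auto simp: D_def space_Rd)
  have sets_eq: "sets \<mu> = sets (Rd d)" using \<mu> by (simp add: prob_on_Rd_def)
  show thesis
  proof (rule that[of Q])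
    show "countable Q"
      by (rule countable_subset[of _ "D \<times> UNIV"]) (use \<open>countable D\<close> in \<open>auto simp: Q_def\<close>)
    show "q \<in> space (Rd d) \<and> emeasure \<mu> (ball_Rd d q (1 / Suc m)) = 0" if "(q, m) \<in> Q" for q m
      using that D by (auto simp: Q_def)
    show "space (Rd d) - spt d \<mu> = (\<Union>(q, m)\<in>Q. ball_Rd d q (1 / Suc m))"
    proof (intro equalityI subsetI)
      fix x assume "x \<in> space (Rd d) - spt d \<mu>"
      then obtain r where x: "x \<in> space (Rd d)" and r: "r > 0" "emeasure \<mu> (ball_Rd d x r) = 0"
        by (auto simp: spt_def)
      obtain m where m: "1 / real (Suc m) < r / 2" using nat_approx_posE[of "r / 2"] r(1) by auto
      define s where "s = 1 / (real (Suc m) * (real d + 1))"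
      have "s > 0" by (simp add: s_def)
      define q where "q = grid d s x"
      have "q \<in> D" by (auto simp: D_def q_def grid_def s_def)
      have "d * s = 1 / Suc m * (real d / (real d + 1))" by (simp add: s_def)
      also have "\<dots> < 1 / Suc m * 1" by (intro mult_strict_left_mono) auto
      finally have "d * s < 1 / Suc m" by simp
      then have xq: "dist_Rd d q x < 1 / Suc m"
        using dist_grid[OF \<open>s > 0\<close>, of d x] by (simp add: q_def)
      have "ball_Rd d q (1 / Suc m) \<subseteq> ball_Rd d x r"
      proof
        fix z assume "z \<in> ball_Rd d q (1 / Suc m)"
        then show "z \<in> ball_Rd d x r"
          using dist_Rd_triangle[of d x z q] dist_Rd_sym[of d x q] xq m by (auto simp: ball_Rd_def)
      qed
      then have "emeasure \<mu> (ball_Rd d q (1 / Suc m)) = 0"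
        using emeasure_mono[of "ball_Rd d q (1 / Suc m)" "ball_Rd d x r" \<mu>] r(2) ball_Rd_sets[OF x] sets_eq by auto
      then have "(q, m) \<in> Q" using \<open>q \<in> D\<close> by (auto simp: Q_def)
      then show "x \<in> (\<Union>(q, m)\<in>Q. ball_Rd d q (1 / Suc m))" using x xq by (force simp: ball_Rd_def)
    next
      fix x assume "x \<in> (\<Union>(q, m)\<in>Q. ball_Rd d q (1 / Suc m))"
      then obtain q m where q: "q \<in> D" "emeasure \<mu> (ball_Rd d q (1 / Suc m)) = 0" "x \<in> ball_Rd d q (1 / Suc m)"
        by (auto simp: Q_def)
      define r where "r = 1 / Suc m - dist_Rd d q x"
      have "r > 0" using q(3) by (simp add: r_def ball_Rd_def)
      have "ball_Rd d x r \<subseteq> ball_Rd d q (1 / Suc m)"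
      proof
        fix z assume "z \<in> ball_Rd d x r"
        then show "z \<in> ball_Rd d q (1 / Suc m)"
          using dist_Rd_triangle[of d q z x] by (auto simp: ball_Rd_def r_def)
      qed
      then have "emeasure \<mu> (ball_Rd d x r) = 0"
        using emeasure_mono[of "ball_Rd d x r" "ball_Rd d q (1 / Suc m)" \<mu>] q D ball_Rd_sets[of q d] sets_eq by auto
      then show "x \<in> space (Rd d) - spt d \<mu>"
        using \<open>r > 0\<close> q(3) by (auto simp: spt_def ball_Rd_def)
    qed
  qed
qed

lemma
  assumes \<mu>: "prob_on_Rd d \<mu>"
  shows spt_sets: "spt d \<mu> \<in> sets (Rd d)" and AE_spt: "AE x in \<mu>. x \<in> spt d \<mu>"
proof -
  obtain Q where Q: "countable Q"
      "\<And>q m. (q, m) \<in> Q \<Longrightarrow> q \<in> space (Rd d) \<and> emeasure \<mu> (ball_Rd d q (1 / Suc m)) = 0"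
      "space (Rd d) - spt d \<mu> = (\<Union>(q, m)\<in>Q. ball_Rd d q (1 / Suc m))"
    using compl_spt_eq_UN_balls[OF \<mu>] by metis
  have sets_eq: "sets \<mu> = sets (Rd d)" using \<mu> by (simp add: prob_on_Rd_def)
  then have space_eq: "space \<mu> = space (Rd d)" by (rule sets_eq_imp_space_eq)
  have null: "(\<Union>(q, m)\<in>Q. ball_Rd d q (1 / Suc m)) \<in> null_sets \<mu>"
    using Q(2) ball_Rd_sets sets_eq by (intro null_sets_UN' Q(1)) (auto intro!: null_setsI)
  then have "space (Rd d) - spt d \<mu> \<in> sets (Rd d)" using Q(3) sets_eq by (auto simp: null_sets_def)
  moreover have "spt d \<mu> = space (Rd d) - (space (Rd d) - spt d \<mu>)" by (auto simp: spt_def)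
  ultimately show "spt d \<mu> \<in> sets (Rd d)" by (metis sets.compl_sets)
  show "AE x in \<mu>. x \<in> spt d \<mu>"
    using null Q(3) space_eq by (intro AE_I'[OF null]) auto
qed

section \<open>Tail estimates\<close>

text \<open>Slicing by the integer part of \<open>Z\<close>: on the slice from \<open>k\<close> to
  \<open>k + 1\<close> the integrand is at most \<open>exp ((k + 1) / 2)\<close>, against mass at
  most \<open>2 * exp (- k)\<close>. Halving the exponent leaves a geometric series with ratio
  \<open>exp (- (1/2))\<close>.\<close>

lemma nn_integral_exp_half_le:
  fixes Z :: "'a \<Rightarrow> real"
  assumes M: "prob_space M" and Z [measurable]: "Z \<in> borel_measurable M"
    and nn: "\<And>x. x \<in> space M \<Longrightarrow> 0 \<le> Z x"
    and tail: "\<And>t. t > 0 \<Longrightarrow> measure M {x\<in>space M. t \<le> Z x} \<le> 2 * exp (- t)"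
  shows "(\<integral>\<^sup>+x. ennreal (exp (Z x / 2)) \<partial>M) \<le> ennreal (2 * exp (1/2) / (1 - exp (- (1/2))))"
proof -
  interpret prob_space M by fact
  let ?A = "\<lambda>k::nat. {x\<in>space M. real k \<le> Z x}"
  have A: "emeasure M (?A k) \<le> ennreal (2 * exp (- real k))" for k
  proof (cases "k = 0")
    \<comment> \<open>The tail bound is assumed for positive \<open>t\<close> only, so the slice at
      \<open>0\<close> uses total mass \<open>1\<close>.\<close>
    case True
    have "measure M (?A k) \<le> 2 * exp (- real k)" using True order.trans[OF prob_le_1[of "?A k"], of 2] by simp
    then show ?thesis by (simp add: emeasure_eq_measure ennreal_leI)
  next
    case False
    then show ?thesis using tail[of "real k"] by (simp add: emeasure_eq_measure ennreal_leI)
  qed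
  have "(\<integral>\<^sup>+x. ennreal (exp (Z x / 2)) \<partial>M)
      \<le> (\<integral>\<^sup>+x. (\<Sum>k. ennreal (exp ((real k + 1) / 2)) * indicator (?A k) x) \<partial>M)"
  proof (rule nn_integral_mono)
    fix x assume x: "x \<in> space M"
    define k where "k = nat \<lfloor>Z x\<rfloor>"
    have k: "real k \<le> Z x" "Z x \<le> real k + 1" using nn[OF x] by (auto simp: k_def)
    have "ennreal (exp (Z x / 2)) \<le> ennreal (exp ((real k + 1) / 2)) * indicator (?A k) x"
      using k x by (auto intro!: ennreal_leI)
    also have "\<dots> = sum (\<lambda>k. ennreal (exp ((real k + 1) / 2)) * indicator (?A k) x) {k}"
      by (simp only: sum.insert sum.empty finite.emptyI empty_iff not_False_eq_True add_0_right)
    also have "\<dots> \<le> (\<Sum>k. ennreal (exp ((real k + 1) / 2)) * indicator (?A k) x)"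
      by (rule sum_le_suminf[OF summableI]) auto
    finally show "ennreal (exp (Z x / 2)) \<le> (\<Sum>k. ennreal (exp ((real k + 1) / 2)) * indicator (?A k) x)" .
  qed
  also have "\<dots> = (\<Sum>k. ennreal (exp ((real k + 1) / 2)) * emeasure M (?A k))"
    by (subst nn_integral_suminf) (auto intro!: suminf_cong nn_integral_cmult_indicator)
  also have "\<dots> \<le> (\<Sum>k. ennreal (exp ((real k + 1) / 2)) * ennreal (2 * exp (- real k)))"
    by (intro suminf_le mult_left_mono A) auto
  also have "\<dots> = (\<Sum>k. ennreal (2 * exp (1/2) * exp (- (1/2)) ^ k))"
  proof (intro suminf_cong)
    fix k :: nat
    have "exp ((real k + 1) / 2) * (2 * exp (- real k)) = 2 * exp (1/2) * exp (- (1/2)) ^ k"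
      by (simp add: exp_of_nat_mult[symmetric] mult_exp_exp field_simps)
    then show "ennreal (exp ((real k + 1) / 2)) * ennreal (2 * exp (- real k)) = ennreal (2 * exp (1/2) * exp (- (1/2)) ^ k)"
      by (simp flip: ennreal_mult)
  qed
  also have "\<dots> = ennreal (\<Sum>k. 2 * exp (1/2) * exp (- (1/2)) ^ k)"
    by (intro suminf_ennreal2 summable_mult summable_geometric) auto
  also have "(\<Sum>k. 2 * exp (1/2) * exp (- (1/2)) ^ k) = 2 * exp (1/2) / (1 - exp (- (1/2::real)))"
    by (subst suminf_mult) (auto simp: suminf_geometric summable_geometric)
  finally show ?thesis .
qed

text \<open>From \<open>u \<le> exp u\<close> at \<open>u = z / (4 * \<beta>)\<close>.\<close>

lemma powr_le_exp:
  fixes z \<beta> :: real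
  assumes "z \<ge> 0" "\<beta> > 0" shows "z powr \<beta> \<le> (4 * \<beta>) powr \<beta> * exp (z / 4)"
proof -
  have "z / (4 * \<beta>) \<le> exp (z / (4 * \<beta>))"
    using exp_ge_add_one_self[of "z / (4 * \<beta>)"] by linarith
  then have "(z / (4 * \<beta>)) powr \<beta> \<le> exp (z / (4 * \<beta>)) powr \<beta>"
    using assms by (intro powr_mono2) auto
  also have "\<dots> = exp (z / 4)" using assms by (simp add: powr_def)
  finally show ?thesis using assms by (simp add: powr_divide field_simps)
qed

abbreviation norm_Rd :: "nat \<Rightarrow> (nat \<Rightarrow> real) \<Rightarrow> real" where
  "norm_Rd d \<equiv> dist_Rd d (zero_Rd d)"

locale tails =
  fixes d :: nat and \<mu> :: "(nat \<Rightarrow> real) measure" and c\<^sub>\<mu> \<alpha> p :: real and n :: nat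
  assumes \<mu>: "prob_on_Rd d \<mu>" and tail: "tail_assumption d \<mu> c\<^sub>\<mu> \<alpha>" and p: "p \<ge> 1" and n: "n \<ge> 2"
begin

sublocale prob_space \<mu> using \<mu> by (simp add: prob_on_Rd_def)

lemma sets_mu: "sets \<mu> = sets (Rd d)" and space_mu: "space \<mu> = space (Rd d)"
  using \<mu> sets_eq_imp_space_eq[of \<mu> "Rd d"] by (auto simp: prob_on_Rd_def)

lemma c_pos: "c\<^sub>\<mu> > 0" and alpha: "\<alpha> \<ge> 1"
  using tail by (auto simp: tail_assumption_def)

lemma norm_measurable [measurable]: "norm_Rd d \<in> borel_measurable \<mu>"
  using dist_Rd_measurable'[OF zero_Rd_space] measurable_cong_sets[OF sets_mu refl] by blast

abbreviation r where "r \<equiv> trunc_radius p c\<^sub>\<mu> \<alpha> n"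

text \<open>In \<open>c\<^sub>\<mu> * r powr \<alpha>\<close> the powers cancel, and so do
  \<open>c\<^sub>\<mu>\<close> and its inverse; the factors left beside \<open>4 * ln n\<close> are
  at least \<open>1\<close>. The \<open>4\<close> allows a quarter of the exponent to give a decay
  of \<open>1 / n\<close> already.\<close>

lemma r_pos: "r > 0" and r_powr: "c\<^sub>\<mu> * r powr \<alpha> \<ge> 4 * ln n"
proof -
  define q where "q = 4 * p * inverse c\<^sub>\<mu> * max (inverse c\<^sub>\<mu>) 1 * (max (p / \<alpha>) 1)\<^sup>2 * ln (real n)"
  have "ln (real n) > 0" using n by simp
  then have "q > 0"
    unfolding q_def using p c_pos by (intro mult_pos_pos zero_less_power) (auto simp: less_max_iff_disj)
  then show "r > 0" by (simp add: trunc_radius_def q_def[symmetric])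
  have "r powr \<alpha> = q" using \<open>q > 0\<close> alpha by (simp add: trunc_radius_def q_def[symmetric] powr_powr)
  then have eq: "c\<^sub>\<mu> * r powr \<alpha> = 4 * (p * (max (inverse c\<^sub>\<mu>) 1 * (max (p / \<alpha>) 1)\<^sup>2) * ln (real n))"
    using c_pos by (simp add: q_def)
  have m1: "1 \<le> x * y" if "1 \<le> x" "1 \<le> y" for x y :: real
    using mult_mono[of 1 x 1 y] that by simp
  have "1 \<le> p * (max (inverse c\<^sub>\<mu>) 1 * (max (p / \<alpha>) 1)\<^sup>2)"
    using p by (intro m1) (auto simp: power2_eq_square intro: m1)
  then have "1 * ln (real n) \<le> p * (max (inverse c\<^sub>\<mu>) 1 * (max (p / \<alpha>) 1)\<^sup>2) * ln (real n)"
    using \<open>ln (real n) > 0\<close> by (intro mult_right_mono) auto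
  then show "c\<^sub>\<mu> * r powr \<alpha> \<ge> 4 * ln n" unfolding eq by simp
qed

lemma tail_prob: "t > 0 \<Longrightarrow> measure \<mu> {x\<in>space \<mu>. t \<le> norm_Rd d x} \<le> 2 * exp (- (c\<^sub>\<mu> * t powr \<alpha>))"
proof -
  assume "t > 0"
  moreover have "{x\<in>space \<mu>. t \<le> norm_Rd d x} = space (Rd d) - ball_Rd d (zero_Rd d) t"
    by (auto simp: space_mu ball_Rd_def)
  ultimately show ?thesis using tail by (simp add: tail_assumption_def)
qed

text \<open>The exponent without the \<open>1/2\<close> has a standard exponential tail, seen by
  solving \<open>c\<^sub>\<mu> * s powr \<alpha> = t\<close> for \<open>s\<close>.\<close>

lemma exp_moment: "(\<integral>\<^sup>+x. ennreal (exp (c\<^sub>\<mu> * norm_Rd d x powr \<alpha> / 2)) \<partial>\<mu>)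
    \<le> ennreal (2 * exp (1/2) / (1 - exp (- (1/2))))"
proof (rule nn_integral_exp_half_le[OF prob_space_axioms])
  fix t :: real assume "t > 0"
  define s where "s = (t / c\<^sub>\<mu>) powr (1 / \<alpha>)"
  have "s > 0" using \<open>t > 0\<close> c_pos by (simp add: s_def)
  have cs: "c\<^sub>\<mu> * s powr \<alpha> = t" using \<open>t > 0\<close> c_pos alpha by (simp add: s_def powr_powr)
  have "s \<le> norm_Rd d x" if "t \<le> c\<^sub>\<mu> * norm_Rd d x powr \<alpha>" for x
  proof (rule ccontr)
    assume "\<not> s \<le> norm_Rd d x"
    then have "norm_Rd d x powr \<alpha> < s powr \<alpha>" using alpha by (intro powr_less_mono2) auto
    then have "c\<^sub>\<mu> * norm_Rd d x powr \<alpha> < t" using cs c_pos by (simp flip: cs)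
    then show False using that by simp
  qed
  then have "measure \<mu> {x\<in>space \<mu>. t \<le> c\<^sub>\<mu> * norm_Rd d x powr \<alpha>} \<le> measure \<mu> {x\<in>space \<mu>. s \<le> norm_Rd d x}"
    by (intro finite_measure_mono) auto
  also have "\<dots> \<le> 2 * exp (- t)" using tail_prob[OF \<open>s > 0\<close>] by (simp add: cs)
  finally show "measure \<mu> {x\<in>space \<mu>. t \<le> c\<^sub>\<mu> * norm_Rd d x powr \<alpha>} \<le> 2 * exp (- t)" .
qed (use c_pos in auto)

lemma exp_neg_r: "exp (- (c\<^sub>\<mu> * r powr \<alpha>) / 4) \<le> 1 / sqrt n"
proof -
  have "exp (- (c\<^sub>\<mu> * r powr \<alpha>) / 4) \<le> exp (- ln n)" using r_powr by simp
  also have "\<dots> = 1 / n" using n by (simp add: exp_minus inverse_eq_divide)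
  also have "\<dots> \<le> 1 / sqrt n"
    using n sqrt_le_D[of n "n"] by (intro divide_left_mono real_le_lsqrt mult_pos_pos) (auto simp: power2_eq_square)
  finally show ?thesis .
qed

lemma outside_prob: "measure \<mu> {x\<in>space \<mu>. r \<le> norm_Rd d x} \<le> 2 / sqrt n"
proof -
  have "measure \<mu> {x\<in>space \<mu>. r \<le> norm_Rd d x} \<le> 2 * exp (- (c\<^sub>\<mu> * r powr \<alpha>))" by (rule tail_prob[OF r_pos])
  also have "\<dots> \<le> 2 * exp (- (c\<^sub>\<mu> * r powr \<alpha>) / 4)" using c_pos by simp
  also have "\<dots> \<le> 2 * (1 / sqrt n)" by (intro mult_left_mono exp_neg_r) simp
  finally show ?thesis by simp
qed

text \<open>With \<open>Z = c\<^sub>\<mu> * norm_Rd d x powr \<alpha>\<close>, the p-th power of the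
  norm is a multiple of \<open>Z powr (p / \<alpha>)\<close>, hence at most a multiple of
  \<open>exp (Z / 4)\<close>. This equals \<open>exp (- Z / 4) * exp (Z / 2)\<close>: outside the
  radius the first factor is at most \<open>1 / sqrt n\<close>, and the second has a bounded mean.
  The dependence on \<open>c\<^sub>\<mu>\<close> is left in the power alone.\<close>

lemma outside_moment:
  "(\<integral>\<^sup>+x. ennreal (norm_Rd d x powr p) * indicator {x\<in>space \<mu>. r \<le> norm_Rd d x} x \<partial>\<mu>)
    \<le> ennreal ((4 * (p / \<alpha>)) powr (p / \<alpha>) * (2 * exp (1/2) / (1 - exp (- (1/2)))) * c\<^sub>\<mu> powr (- (p / \<alpha>)) / sqrt n)"
proof -
  define \<beta> where "\<beta> = p / \<alpha>"
  have "\<beta> > 0" using p alpha by (simp add: \<beta>_def)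
  define A where "A = (4 * \<beta>) powr \<beta> * c\<^sub>\<mu> powr (- \<beta>) / sqrt n"
  have "A \<ge> 0" by (simp add: A_def)
  have "(\<integral>\<^sup>+x. ennreal (norm_Rd d x powr p) * indicator {x\<in>space \<mu>. r \<le> norm_Rd d x} x \<partial>\<mu>)
    \<le> (\<integral>\<^sup>+x. ennreal A * ennreal (exp (c\<^sub>\<mu> * norm_Rd d x powr \<alpha> / 2)) \<partial>\<mu>)"
  proof (rule nn_integral_mono)
    fix x assume "x \<in> space \<mu>"
    show "ennreal (norm_Rd d x powr p) * indicator {x\<in>space \<mu>. r \<le> norm_Rd d x} x
      \<le> ennreal A * ennreal (exp (c\<^sub>\<mu> * norm_Rd d x powr \<alpha> / 2))"
    proof (cases "r \<le> norm_Rd d x")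
      case True
      define Z where "Z = c\<^sub>\<mu> * norm_Rd d x powr \<alpha>"
      have "Z \<ge> 0" using c_pos by (simp add: Z_def)
      have "c\<^sub>\<mu> * r powr \<alpha> \<le> Z"
        unfolding Z_def using True c_pos alpha r_pos by (intro mult_left_mono powr_mono2) auto
      have "Z powr \<beta> = c\<^sub>\<mu> powr \<beta> * norm_Rd d x powr p"
        using c_pos alpha by (simp add: Z_def powr_mult powr_powr \<beta>_def)
      then have "norm_Rd d x powr p = c\<^sub>\<mu> powr (- \<beta>) * Z powr \<beta>"
        using c_pos by (simp add: powr_minus field_simps)
      also have "\<dots> \<le> c\<^sub>\<mu> powr (- \<beta>) * ((4 * \<beta>) powr \<beta> * exp (Z / 4))"
        by (intro mult_left_mono powr_le_exp \<open>Z \<ge> 0\<close> \<open>\<beta> > 0\<close>) auto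
      also have "exp (Z / 4) \<le> exp (- (c\<^sub>\<mu> * r powr \<alpha>) / 4) * exp (Z / 2)"
        using \<open>c\<^sub>\<mu> * r powr \<alpha> \<le> Z\<close> by (simp add: mult_exp_exp)
      also have "\<dots> \<le> 1 / sqrt n * exp (Z / 2)" by (intro mult_right_mono exp_neg_r) auto
      finally have "norm_Rd d x powr p \<le> A * exp (Z / 2)"
        by (simp add: A_def mult_left_mono mult.assoc mult.left_commute)
      then show ?thesis
        using True \<open>x \<in> space \<mu>\<close> \<open>A \<ge> 0\<close> by (simp add: Z_def ennreal_leI flip: ennreal_mult)
    qed simp
  qed
  also have "\<dots> = ennreal A * (\<integral>\<^sup>+x. ennreal (exp (c\<^sub>\<mu> * norm_Rd d x powr \<alpha> / 2)) \<partial>\<mu>)"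
    by (intro nn_integral_cmult) measurable
  also have "\<dots> \<le> ennreal A * ennreal (2 * exp (1/2) / (1 - exp (- (1/2))))"
    by (intro mult_left_mono exp_moment) auto
  also have "\<dots> = ennreal ((4 * \<beta>) powr \<beta> * (2 * exp (1/2) / (1 - exp (- (1/2)))) * c\<^sub>\<mu> powr (- \<beta>) / sqrt n)"
    using \<open>A \<ge> 0\<close> by (simp add: A_def ennreal_mult[symmetric] ac_simps)
  finally show ?thesis by (simp add: \<beta>_def)
qed

end

section \<open>Truncation and discretization of the cost\<close>

locale radial_cost =
  fixes d :: nat and c :: "(nat \<Rightarrow> real) \<Rightarrow> (nat \<Rightarrow> real) \<Rightarrow> real" and p C\<^sub>p :: real and h :: "real \<Rightarrow> real"
  assumes p: "p \<ge> 1" and C_pos: "C\<^sub>p > 0"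
    and h_cont: "continuous_on {0..} h" and h_nonneg: "\<And>t. t \<ge> 0 \<Longrightarrow> 0 \<le> h t" and h_0: "h 0 = 0"
    and cost_radial: "\<And>x y. x \<in> space (Rd d) \<Longrightarrow> y \<in> space (Rd d) \<Longrightarrow> c x y = h (dist_Rd d x y)"
    and h_lipschitz_pos: "\<And>t t'. t > 0 \<Longrightarrow> t' > 0 \<Longrightarrow> \<bar>h t - h t'\<bar> \<le> C\<^sub>p * max t t' powr (p - 1) * \<bar>t - t'\<bar>"
begin

text \<open>The assumption concerns positive arguments; continuity of \<open>h\<close> at
  \<open>0\<close> extends it along \<open>t / Suc n\<close>.\<close>

lemma h_lipschitz_0:
  assumes t: "t > 0" shows "h t \<le> C\<^sub>p * t powr (p - 1) * t"
proof -
  have lim: "(\<lambda>n. t / real (Suc n)) \<longlonglongrightarrow> 0"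
    using LIMSEQ_inverse_real_of_nat tendsto_mult_right_zero[of _ sequentially t] by (auto simp: divide_inverse)
  have "(\<lambda>n. h (t / real (Suc n))) \<longlonglongrightarrow> h 0"
    by (rule continuous_on_tendsto_compose[OF h_cont lim]) (use t in auto)
  then have lim2: "(\<lambda>n. h t - h (t / real (Suc n))) \<longlonglongrightarrow> h t - h 0" by (intro tendsto_intros)
  have "h t - h 0 \<le> C\<^sub>p * t powr (p - 1) * t"
  proof (rule LIMSEQ_le_const2[OF lim2], intro exI allI impI)
    fix n :: nat
    have s: "0 < t / real (Suc n)" "t / real (Suc n) \<le> t" using t by (auto simp: field_simps)
    have "h t - h (t / real (Suc n)) \<le> C\<^sub>p * max t (t / real (Suc n)) powr (p - 1) * \<bar>t - t / real (Suc n)\<bar>"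
      using h_lipschitz_pos[OF t s(1)] by linarith
    also have "\<dots> \<le> C\<^sub>p * t powr (p - 1) * t"
      using s C_pos by (intro mult_mono) (auto simp: max_absorb1)
    finally show "h t - h (t / real (Suc n)) \<le> C\<^sub>p * t powr (p - 1) * t" .
  qed
  then show ?thesis by (simp add: h_0)
qed

lemma h_lipschitz:
  assumes "t \<ge> 0" "t' \<ge> 0"
  shows "\<bar>h t - h t'\<bar> \<le> C\<^sub>p * max t t' powr (p - 1) * \<bar>t - t'\<bar>"
proof (cases "t = 0 \<or> t' = 0")
  case True
  then consider "t = 0" "t' = 0" | "t = 0" "t' > 0" | "t > 0" "t' = 0" using assms by fastforce
  then show ?thesis
    using h_lipschitz_0[of t] h_lipschitz_0[of t'] h_nonneg[OF assms(1)] h_nonneg[OF assms(2)]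
    by cases (auto simp: h_0 max_def)
next
  case False
  then show ?thesis using assms by (intro h_lipschitz_pos) auto
qed

lemma h_le: "t \<ge> 0 \<Longrightarrow> h t \<le> C\<^sub>p * t powr p"
  using h_lipschitz_0[of t] powr_mult_base[of t "p - 1"]
  by (cases "t = 0") (auto simp: h_0 ac_simps)

text \<open>Truncation of the argument turns the growing local Lipschitz constant into a global
  one.\<close>

lemma h_min_lipschitz:
  assumes "R > 0" "t \<ge> 0" "t' \<ge> 0"
  shows "\<bar>h (min R t) - h (min R t')\<bar> \<le> C\<^sub>p * R powr (p - 1) * \<bar>t - t'\<bar>"
proof -
  have "\<bar>h (min R t) - h (min R t')\<bar> \<le> C\<^sub>p * max (min R t) (min R t') powr (p - 1) * \<bar>min R t - min R t'\<bar>"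
    using assms by (intro h_lipschitz) auto
  also have "\<dots> \<le> C\<^sub>p * R powr (p - 1) * \<bar>t - t'\<bar>"
    using assms p C_pos by (intro mult_mono powr_mono2) (auto simp: min_def)
  finally show ?thesis .
qed

lemma c_measurable: "(\<lambda>z. c (fst z) (snd z)) \<in> borel_measurable (Rd d \<Otimes>\<^sub>M Rd d)"
proof (subst measurable_cong)
  show "c (fst z) (snd z) = h (max 0 (dist_Rd d (fst z) (snd z)))" if "z \<in> space (Rd d \<Otimes>\<^sub>M Rd d)" for z
    using that by (auto simp: space_pair_measure cost_radial max_absorb2)
  have "continuous_on UNIV (\<lambda>t. h (max 0 t))"
    by (rule continuous_on_compose2[OF h_cont]) (auto intro!: continuous_intros)
  then have "(\<lambda>t. h (max 0 t)) \<in> borel_measurable borel" by (rule borel_measurable_continuous_onI)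
  then show "(\<lambda>z. h (max 0 (dist_Rd d (fst z) (snd z)))) \<in> borel_measurable (Rd d \<Otimes>\<^sub>M Rd d)"
    by (rule measurable_compose[OF dist_Rd_measurable])
qed

end

text \<open>\<open>T\<close> and \<open>T'\<close> move the points of \<open>A\<close> and \<open>B\<close> by at most \<open>\<tau>\<close> into finite nets and
  send everything else into these nets as well.  The sets \<open>X\<close> and \<open>X'\<close> contain the centers of
  the covering balls, at which there need not be any mass.\<close>

locale truncation = radial_cost d c p C\<^sub>p h + divergence \<phi> t\<^sub>0 \<delta> C\<^sub>\<psi> \<gamma>
  for d c p C\<^sub>p h \<phi> t\<^sub>0 \<delta> C\<^sub>\<psi> \<gamma> +
  fixes \<epsilon> :: real and A B F G X X' :: "(nat \<Rightarrow> real) set" and T T' :: "(nat \<Rightarrow> real) \<Rightarrow> nat \<Rightarrow> real"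
    and r r' \<tau> :: real
  assumes eps: "\<epsilon> > 0"
    and A: "A \<in> sets (Rd d)" "A \<subseteq> ball_Rd d (zero_Rd d) r"
    and B: "B \<in> sets (Rd d)" "B \<subseteq> ball_Rd d (zero_Rd d) r'"
    and F: "finite F" "F \<subseteq> A" and G: "finite G" "G \<subseteq> B"
    and T: "T \<in> measurable (Rd d) (count_space F)" "\<And>x. x \<in> A \<Longrightarrow> dist_Rd d (T x) x \<le> \<tau>"
    and T': "T' \<in> measurable (Rd d) (count_space G)" "\<And>x. x \<in> B \<Longrightarrow> dist_Rd d (T' x) x \<le> \<tau>"
    and X: "finite X" "X \<subseteq> space (Rd d)" and X': "finite X'" "X' \<subseteq> space (Rd d)"
    and r: "r > 0" "r' > 0" and tau: "\<tau> > 0"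
begin

text \<open>As the sum of the two radii, \<open>R\<close> leaves the cost unchanged on the product
  of \<open>A\<close> and \<open>B\<close>. \<open>L\<close> is the Lipschitz constant and
  \<open>K\<close> the upper bound of the truncated cost.\<close>

definition R where "R = r + r'"
definition L where "L = C\<^sub>p * R powr (p - 1)"
definition K where "K = C\<^sub>p * R powr p"
definition k where "k z w = h (min R (dist_Rd d z w))"
text \<open>Majorant of the cost error charged to one coordinate; it vanishes on \<open>S\<close>,
  so that its integral is a pure tail term. There is one such function per coordinate because
  stability of the value in the cost requires a separated bound.\<close>

definition excess where
  "excess S x = ennreal (C\<^sub>p * (1 + 3 powr p) * (R powr p + norm_Rd d x powr p)) * indicator (space (Rd d) - S) x"

abbreviation excess_mass where "excess_mass S M \<equiv> \<integral>\<^sup>+x. excess S x \<partial>M"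

lemma R_pos: "R > 0" and L_pos: "L > 0" and K_pos: "K > 0"
  using r C_pos by (auto simp: R_def L_def K_def)

lemma k_range: "0 \<le> k z w \<and> k z w \<le> K"
proof
  have m: "0 \<le> min R (dist_Rd d z w)" using R_pos by simp
  then show "0 \<le> k z w" unfolding k_def by (rule h_nonneg)
  have "k z w \<le> C\<^sub>p * min R (dist_Rd d z w) powr p" unfolding k_def by (rule h_le[OF m])
  also have "\<dots> \<le> K" unfolding K_def using m C_pos p by (intro mult_left_mono powr_mono2) auto
  finally show "k z w \<le> K" .
qed

lemma k_lipschitz: "\<bar>k z w - k z' w\<bar> \<le> L * dist_Rd d z z'" "\<bar>k w z - k w z'\<bar> \<le> L * dist_Rd d z z'"
proof -
  have 1: "\<bar>dist_Rd d z w - dist_Rd d z' w\<bar> \<le> dist_Rd d z z'"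
    using dist_Rd_triangle[of d z w z'] dist_Rd_triangle[of d z' w z] dist_Rd_sym[of d z z'] by linarith
  have "\<bar>k z w - k z' w\<bar> \<le> L * \<bar>dist_Rd d z w - dist_Rd d z' w\<bar>"
    unfolding k_def L_def by (rule h_min_lipschitz[OF R_pos]) auto
  also have "\<dots> \<le> L * dist_Rd d z z'" using 1 L_pos by (intro mult_left_mono) auto
  finally show "\<bar>k z w - k z' w\<bar> \<le> L * dist_Rd d z z'" .
  then show "\<bar>k w z - k w z'\<bar> \<le> L * dist_Rd d z z'" by (simp add: k_def dist_Rd_sym[of d w])
qed

sublocale finite_ot \<phi> t\<^sub>0 \<delta> C\<^sub>\<psi> \<gamma> "F \<union> X" "G \<union> X'" k K \<epsilon>
  by unfold_locales (use eps k_range in auto)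

lemma T_space: "x \<in> space (Rd d) \<Longrightarrow> T x \<in> F" and T'_space: "x \<in> space (Rd d) \<Longrightarrow> T' x \<in> G"
  using measurable_space[OF T(1)] measurable_space[OF T'(1)] by auto

lemma count_space_mono: "f \<in> measurable M (count_space S) \<Longrightarrow> S \<subseteq> S' \<Longrightarrow> finite S' \<Longrightarrow> f \<in> measurable M (count_space S')"
  by (rule measurable_compose[where N="count_space S" and g="\<lambda>x. x"]) auto

lemma finite_transport:
  assumes "prob_space M" "prob_space N" "sets M = sets (Rd d)" "sets N = sets (Rd d)"
  shows "finite_transport \<phi> t\<^sub>0 \<delta> C\<^sub>\<psi> \<gamma> (F \<union> X) (G \<union> X') k K \<epsilon> M N T T' (\<lambda>x y. k (T x) (T' y))"
proof (intro finite_transport.intro finite_transport_axioms.intro finite_ot_axioms assms(1,2))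
  have "T \<in> measurable M (count_space F)" "T' \<in> measurable N (count_space G)"
    using T(1) T'(1) measurable_cong_sets[OF assms(3) refl] measurable_cong_sets[OF assms(4) refl] by auto
  then show "T \<in> measurable M (count_space (F \<union> X))" "T' \<in> measurable N (count_space (G \<union> X'))"
    using F G X X' by (auto elim: count_space_mono)
qed (use F G X X' in auto)

text \<open>A coordinate inside its set contributes at most its radius, which \<open>R\<close>
  already contains, so only bad coordinates are charged; at least one is bad and can also carry
  \<open>R powr p\<close>. The distance is at most three times the maximum \<open>m\<close>, whence
  \<open>3 powr p\<close>.\<close>

lemma cost_diff_aux:
  assumes "x \<in> space (Rd d)" "y \<in> space (Rd d)" and bad: "x \<notin> A \<or> y \<notin> B"
  shows "ennreal (C\<^sub>p * (R powr p + dist_Rd d x y powr p)) \<le> excess A x + excess B y"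
proof -
  define u where "u = (if x \<in> A then 0 else norm_Rd d x)"
  define v where "v = (if y \<in> B then 0 else norm_Rd d y)"
  define m where "m = max R (max u v)"
  have uv: "0 \<le> u" "0 \<le> v" by (auto simp: u_def v_def)
  have "norm_Rd d x \<le> r + u" "norm_Rd d y \<le> r' + v"
    using A(2) B(2) r by (auto simp: u_def v_def ball_Rd_def)
  then have "dist_Rd d x y \<le> R + u + v"
    using dist_Rd_triangle[of d x y "zero_Rd d"] dist_Rd_sym[of d x "zero_Rd d"] by (simp add: R_def)
  also have "\<dots> \<le> 3 * m" by (auto simp: m_def)
  finally have "dist_Rd d x y powr p \<le> (3 * m) powr p" using p by (intro powr_mono2) auto
  also have "\<dots> = 3 powr p * m powr p" using R_pos by (simp add: powr_mult m_def)
  also have "m powr p \<le> R powr p + u powr p + v powr p" by (auto simp: m_def max_def)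
  finally have "dist_Rd d x y powr p \<le> 3 powr p * (R powr p + u powr p + v powr p)" by simp
  moreover have "R powr p \<le> R powr p + u powr p + v powr p" by simp
  ultimately have "R powr p + dist_Rd d x y powr p \<le> (1 + 3 powr p) * (R powr p + u powr p + v powr p)"
    by (simp only: distrib_right mult_1)
  then have "C\<^sub>p * (R powr p + dist_Rd d x y powr p) \<le> C\<^sub>p * ((1 + 3 powr p) * (R powr p + u powr p + v powr p))"
    using C_pos by (intro mult_left_mono) auto
  also have "\<dots> \<le> C\<^sub>p * ((1 + 3 powr p) * ((if x \<in> A then 0 else R powr p + norm_Rd d x powr p)
      + (if y \<in> B then 0 else R powr p + norm_Rd d y powr p)))"
    using C_pos bad p by (intro mult_left_mono) (auto simp: u_def v_def)
  also have "\<dots> = (if x \<in> A then 0 else C\<^sub>p * (1 + 3 powr p) * (R powr p + norm_Rd d x powr p))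
      + (if y \<in> B then 0 else C\<^sub>p * (1 + 3 powr p) * (R powr p + norm_Rd d y powr p))"
    by (auto simp: algebra_simps)
  finally have "ennreal (C\<^sub>p * (R powr p + dist_Rd d x y powr p)) \<le>
     ennreal ((if x \<in> A then 0 else C\<^sub>p * (1 + 3 powr p) * (R powr p + norm_Rd d x powr p))
      + (if y \<in> B then 0 else C\<^sub>p * (1 + 3 powr p) * (R powr p + norm_Rd d y powr p)))"
    by (rule ennreal_leI)
  also have "\<dots> = excess A x + excess B y"
    using assms(1,2) C_pos by (subst ennreal_plus) (auto simp: excess_def)
  finally show ?thesis .
qed

text \<open>On the product of \<open>A\<close> and \<open>B\<close> the error consists of two
  Lipschitz moves of length at most \<open>\<tau>\<close>; elsewhere both costs are estimated by
  their size.\<close>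

lemma cost_diff:
  assumes xy: "x \<in> space (Rd d)" "y \<in> space (Rd d)"
  shows "ennreal \<bar>c x y - k (T x) (T' y)\<bar> \<le> ennreal (2 * L * \<tau>) + excess A x + excess B y"
proof (cases "x \<in> A \<and> y \<in> B")
  case True
  then have "dist_Rd d x y \<le> R"
    using A(2) B(2) dist_Rd_triangle[of d x y "zero_Rd d"] dist_Rd_sym[of d x "zero_Rd d"]
    by (fastforce simp: R_def ball_Rd_def)
  then have "c x y = k x y" using xy by (simp add: cost_radial k_def)
  moreover have "dist_Rd d x (T x) \<le> \<tau>" "dist_Rd d y (T' y) \<le> \<tau>"
    using T(2) T'(2) True dist_Rd_sym[of d x] dist_Rd_sym[of d y] by auto
  then have "L * dist_Rd d x (T x) \<le> L * \<tau>" "L * dist_Rd d y (T' y) \<le> L * \<tau>"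
    using L_pos by auto
  then have "\<bar>k x y - k (T x) y\<bar> \<le> L * \<tau>" "\<bar>k (T x) y - k (T x) (T' y)\<bar> \<le> L * \<tau>"
    using k_lipschitz(1)[of x y "T x"] k_lipschitz(2)[of "T x" y "T' y"] by linarith+
  ultimately have "\<bar>c x y - k (T x) (T' y)\<bar> \<le> 2 * L * \<tau>" by linarith
  then have "ennreal \<bar>c x y - k (T x) (T' y)\<bar> \<le> ennreal (2 * L * \<tau>)" by (rule ennreal_leI)
  then show ?thesis unfolding add.assoc by (rule add_increasing2[OF zero_le])
next
  case False
  have "0 \<le> c x y" "c x y \<le> C\<^sub>p * dist_Rd d x y powr p"
    using xy h_nonneg h_le by (auto simp: cost_radial)
  moreover have "0 \<le> C\<^sub>p * dist_Rd d x y powr p" using C_pos by simp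
  ultimately have "\<bar>c x y - k (T x) (T' y)\<bar> \<le> C\<^sub>p * (R powr p + dist_Rd d x y powr p)"
    using k_range[of "T x" "T' y"] K_pos by (simp add: abs_le_iff distrib_left K_def)
  then have "ennreal \<bar>c x y - k (T x) (T' y)\<bar> \<le> ennreal (C\<^sub>p * (R powr p + dist_Rd d x y powr p))"
    by (rule ennreal_leI)
  also have "\<dots> \<le> excess A x + excess B y"
    by (rule cost_diff_aux[OF xy]) (use False in blast)
  finally show ?thesis unfolding add.assoc by (rule add_increasing[OF zero_le])
qed

lemma excess_measurable:
  assumes S: "S \<in> sets (Rd d)" shows "excess S \<in> borel_measurable (Rd d)"
proof -
  have "(\<lambda>x. C\<^sub>p * (1 + 3 powr p) * (R powr p + norm_Rd d x powr p)) \<in> borel_measurable (Rd d)"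
    by (intro borel_measurable_times borel_measurable_add borel_measurable_const powr_real_measurable
        dist_Rd_measurable' zero_Rd_space)
  then show ?thesis
    unfolding excess_def[abs_def] using S
    by (intro borel_measurable_times_ennreal borel_measurable_indicator sets.compl_sets measurable_compose[OF _ measurable_ennreal])
qed

abbreviation discretized_value where
  "discretized_value M N \<equiv> optimal_value (law M T) (law N T')"

text \<open>Finiteness of the value is part of the claim: it lies within \<open>D\<close> of the
  value for the discretized cost, which is real by strong duality.\<close>

lemma reg_OT_approx:
  assumes M: "prob_space M" "prob_space N" "sets M = sets (Rd d)" "sets N = sets (Rd d)"
    and excess_fin: "excess_mass A M < \<infinity>" "excess_mass B N < \<infinity>"
  obtains s where "reg_OT c \<phi> \<epsilon> M N = ereal s"
    "ennreal \<bar>s - discretized_value M N\<bar> \<le> ennreal (2 * L * \<tau>) + excess_mass A M + excess_mass B N"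
proof -
  interpret finite_transport \<phi> t\<^sub>0 \<delta> C\<^sub>\<psi> \<gamma> "F \<union> X" "G \<union> X'" k K \<epsilon> M N T T' "\<lambda>x y. k (T x) (T' y)"
    by (rule finite_transport[OF M])
  note sp = sets_eq_imp_space_eq[OF M(3)] sets_eq_imp_space_eq[OF M(4)]
  obtain D where D: "ennreal (2 * L * \<tau>) + excess_mass A M + excess_mass B N = ennreal D" "D \<ge> 0"
  proof -
    have "ennreal (2 * L * \<tau>) + excess_mass A M + excess_mass B N < top"
      using excess_fin by (simp add: ennreal_add_less_top)
    then show ?thesis using that by (auto simp: less_top_ennreal)
  qed
  have eA: "excess A \<in> borel_measurable M" and eB: "excess B \<in> borel_measurable N"
    using excess_measurable[OF A(1)] excess_measurable[OF B(1)]
      measurable_cong_sets[OF M(3) refl] measurable_cong_sets[OF M(4) refl] by auto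
  then have e: "(\<lambda>x. ennreal (2 * L * \<tau>) + excess A x) \<in> borel_measurable M" "excess A \<in> borel_measurable M"
    "excess B \<in> borel_measurable N"
    by (auto intro: borel_measurable_add)
  have int: "(\<integral>\<^sup>+x. ennreal (2 * L * \<tau>) + excess A x \<partial>M) + excess_mass B N \<le> ennreal D"
  proof -
    have "(\<integral>\<^sup>+x. ennreal (2 * L * \<tau>) + excess A x \<partial>M) = ennreal (2 * L * \<tau>) + excess_mass A M"
      using nn_integral_add[OF _ e(2), of "\<lambda>_. ennreal (2 * L * \<tau>)"]
      by (simp only: borel_measurable_const nn_integral_const M.emeasure_space_1 mult_1_right simp_thms)
    then show ?thesis using D(1) by (simp only: order_refl)
  qed
  have c_meas: "(\<lambda>z. c (fst z) (snd z)) \<in> borel_measurable (M \<Otimes>\<^sub>M N)"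
    using c_measurable measurable_cong_sets[OF sets_pair_measure_cong[OF M(3,4)] refl] by blast
  have k_meas: "(\<lambda>z. k (T (fst z)) (T' (snd z))) \<in> borel_measurable (M \<Otimes>\<^sub>M N)"
    by (rule borel_measurable_integrable[OF integrable_pair])
  have nn: "0 \<le> c x y" "0 \<le> k (T x) (T' y)" if "x \<in> space M" "y \<in> space N" for x y
    using that h_nonneg[OF dist_Rd_nonneg] k_range[of "T x" "T' y"] unfolding sp by (simp_all add: cost_radial)
  have le: "ennreal (c x y) \<le> ennreal (k (T x) (T' y)) + (ennreal (2 * L * \<tau>) + excess A x) + excess B y"
     "ennreal (k (T x) (T' y)) \<le> ennreal (c x y) + (ennreal (2 * L * \<tau>) + excess A x) + excess B y"
    if "x \<in> space M" "y \<in> space N" for x y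
  proof -
    have abs: "ennreal (c x y) \<le> ennreal (k (T x) (T' y)) + ennreal \<bar>c x y - k (T x) (T' y)\<bar>"
      "ennreal (k (T x) (T' y)) \<le> ennreal (c x y) + ennreal \<bar>c x y - k (T x) (T' y)\<bar>"
      using nn[OF that] by (auto simp flip: ennreal_plus intro!: ennreal_leI)
    have "ennreal \<bar>c x y - k (T x) (T' y)\<bar> \<le> ennreal (2 * L * \<tau>) + excess A x + excess B y"
      by (rule cost_diff) (use that sp in auto)
    note abs[THEN order.trans, OF add_left_mono, OF this]
    then show "ennreal (c x y) \<le> ennreal (k (T x) (T' y)) + (ennreal (2 * L * \<tau>) + excess A x) + excess B y"
     "ennreal (k (T x) (T' y)) \<le> ennreal (c x y) + (ennreal (2 * L * \<tau>) + excess A x) + excess B y"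
      unfolding add.assoc by auto
  qed
  have 1: "reg_OT c \<phi> \<epsilon> M N \<le> reg_OT (\<lambda>x y. k (T x) (T' y)) \<phi> \<epsilon> M N + ereal D"
    using nn le(1) by (intro reg_OT_le_reg_OT_add[OF k_meas _ e(1,3) _ int D(2)]) auto
  have 2: "reg_OT (\<lambda>x y. k (T x) (T' y)) \<phi> \<epsilon> M N \<le> reg_OT c \<phi> \<epsilon> M N + ereal D"
    using nn le(2) by (intro reg_OT_le_reg_OT_add[OF c_meas _ e(1,3) _ int D(2)]) auto
  obtain s where s: "reg_OT c \<phi> \<epsilon> M N = ereal s"
    using 1 2 unfolding strong_duality by (cases "reg_OT c \<phi> \<epsilon> M N") auto
  have "\<bar>s - discretized_value M N\<bar> \<le> D" using 1 2 unfolding strong_duality s by simp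
  then have "ennreal \<bar>s - discretized_value M N\<bar> \<le> ennreal D" by (rule ennreal_leI)
  then show thesis using that[OF s] D(1) by simp
qed

text \<open>Centers outside the nets have weight zero, so the covering condition in the density
  bound has to be checked only at points of \<open>A\<close> or \<open>B\<close>.\<close>

lemma law_nonzero: "law M T i \<noteq> 0 \<Longrightarrow> sets M = sets (Rd d) \<Longrightarrow> i \<in> F"
  and law'_nonzero: "law M T' i \<noteq> 0 \<Longrightarrow> sets M = sets (Rd d) \<Longrightarrow> i \<in> G"
proof -
  show "i \<in> F" if "law M T i \<noteq> 0" "sets M = sets (Rd d)"
  proof -
    have "T -` {i} \<inter> space M \<noteq> {}" using that(1) by (metis law_def measure_empty)
    then show ?thesis using T_space sets_eq_imp_space_eq[OF that(2)] by auto
  qed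
  show "i \<in> G" if "law M T' i \<noteq> 0" "sets M = sets (Rd d)"
  proof -
    have "T' -` {i} \<inter> space M \<noteq> {}" using that(1) by (metis law_def measure_empty)
    then show ?thesis using T'_space sets_eq_imp_space_eq[OF that(2)] by auto
  qed
qed

end

context finite_ot
begin

lemma optimal_value_cong:
  assumes "\<And>i. i \<in> I \<Longrightarrow> a i = a' i" "\<And>j. j \<in> J \<Longrightarrow> b j = b' j"
  shows "optimal_value a b = optimal_value a' b'"
  unfolding optimal_value_def dual_def using assms by (simp cong: sum.cong)

text \<open>The same quantity bounded through a cover of the other marginal, by exchanging the two
  sides; this is the source of the minimum of two covering numbers.\<close>

lemma sum_density_squared_le_transposed:
  assumes w: "weights I a" "weights J b" and p: "potentials a b f g"
    and X: "X \<subseteq> J"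
    and cover: "\<And>j. j \<in> J \<Longrightarrow> b j \<noteq> 0 \<Longrightarrow> \<exists>l\<in>X. \<forall>i\<in>I. \<bar>k i j - k i l\<bar> \<le> min \<delta> (t\<^sub>0 / 2) * \<epsilon> / 2"
  shows "(\<Sum>i\<in>I. a i * (\<Sum>j\<in>J. b j * (\<psi>' (slack f g i j))\<^sup>2))
    \<le> 1 + exp (C\<^sub>\<psi> * min \<delta> (t\<^sub>0 / 2) / (t\<^sub>0 / 2) powr \<gamma>) * card X"
proof -
  interpret op: finite_ot \<phi> t\<^sub>0 \<delta> C\<^sub>\<psi> \<gamma> J I "\<lambda>j i. k i j" K \<epsilon>
    by unfold_locales (use eps_pos k_bounds in auto)
  have s: "op.slack g f j i = slack f g i j" for i j by (simp add: op.slack_def slack_def add.commute)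
  have "op.potentials b a g f"
    using p by (auto simp: op.potentials_def potentials_def op.rows_ok_def op.cols_ok_def rows_ok_def cols_ok_def s)
  from op.sum_density_squared_le[OF w(2,1) this X] cover
  have "(\<Sum>j\<in>J. b j * (\<Sum>i\<in>I. a i * (\<psi>' (slack f g i j))\<^sup>2))
    \<le> 1 + exp (C\<^sub>\<psi> * min \<delta> (t\<^sub>0 / 2) / (t\<^sub>0 / 2) powr \<gamma>) * card X" by (simp add: s)
  moreover have "(\<Sum>j\<in>J. b j * (\<Sum>i\<in>I. a i * (\<psi>' (slack f g i j))\<^sup>2)) = (\<Sum>i\<in>I. a i * (\<Sum>j\<in>J. b j * (\<psi>' (slack f g i j))\<^sup>2))"
    unfolding sum_distrib_left by (subst sum.swap) (simp add: ac_simps)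
  ultimately show ?thesis by simp
qed

end

context finite_sampling
begin

text \<open>The value is a function of the finitely many classes into which the samples can fall.\<close>

lemma optimal_value_empirical_measurable:
  "(\<lambda>\<omega>. optimal_value (law (M' \<omega>) T) (law (N' \<omega>) T')) \<in> borel_measurable P"
proof (subst measurable_cong)
  define \<Phi> where "\<Phi> uv = optimal_value (\<lambda>i. (\<Sum>l<n. indicator {i} (fst uv l)) / n)
      (\<lambda>j. (\<Sum>l<n. indicator {j} (snd uv l)) / n)" for uv :: "(nat \<Rightarrow> 'i) \<times> (nat \<Rightarrow> 'j)"
  let ?UV = "\<lambda>\<omega>. (\<lambda>l\<in>{..<n}. T (X l \<omega>), \<lambda>l\<in>{..<n}. T' (Y l \<omega>))"
  show "optimal_value (law (M' \<omega>) T) (law (N' \<omega>) T') = \<Phi> (?UV \<omega>)" if "\<omega> \<in> space P" for \<omega>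
    unfolding \<Phi>_def using that X.law_empirical[OF T fin(1)] Y.law_empirical[OF T' fin(2)]
    by (intro optimal_value_cong) auto
  have "?UV \<in> measurable P (Pi\<^sub>M {..<n} (\<lambda>_. count_space I) \<Otimes>\<^sub>M Pi\<^sub>M {..<n} (\<lambda>_. count_space J))"
    by (intro measurable_Pair measurable_restrict measurable_compose[OF X.Y_measurable T]
          measurable_compose[OF Y.Y_measurable T']) auto
  \<comment> \<open>The product is a finite discrete space, on which every function is
    measurable.\<close>
  also have "Pi\<^sub>M {..<n} (\<lambda>_. count_space I) \<Otimes>\<^sub>M Pi\<^sub>M {..<n} (\<lambda>_. count_space J)
      = count_space ((PiE {..<n} (\<lambda>_. I)) \<times> (PiE {..<n} (\<lambda>_. J)))"
    using fin by (simp add: count_space_PiM_finite countable_finite pair_measure_countable finite_PiE)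
  finally show "(\<lambda>\<omega>. \<Phi> (?UV \<omega>)) \<in> borel_measurable P"
    by (rule measurable_compose) simp
qed

end

section \<open>Sample complexity\<close>

lemma e2ennreal_abs_diff: "e2ennreal \<bar>ereal x - ereal y\<bar> = ennreal \<bar>x - y\<bar>"
  by simp

lemma (in radial_cost) ex_truncation:
  assumes div: "divergence_assumption \<phi> t\<^sub>0 \<delta> C\<^sub>\<psi> \<gamma>" and eps: "\<epsilon> > 0"
    and A: "A \<in> sets (Rd d)" "A \<subseteq> ball_Rd d (zero_Rd d) r" "A \<noteq> {}"
    and B: "B \<in> sets (Rd d)" "B \<subseteq> ball_Rd d (zero_Rd d) r'" "B \<noteq> {}"
    and r: "r > 0" "r' > 0" "\<tau> > 0"
    and Z: "finite Z" "Z \<subseteq> space (Rd d)" "finite Z'" "Z' \<subseteq> space (Rd d)"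
  obtains F G T T' where "truncation d c p C\<^sub>p h \<phi> t\<^sub>0 \<delta> C\<^sub>\<psi> \<gamma> \<epsilon> A B F G Z Z' T T' r r' \<tau>"
proof -
  obtain F T where F: "finite F" "F \<subseteq> A" "T \<in> measurable (Rd d) (count_space F)"
    "\<And>x. x \<in> A \<Longrightarrow> dist_Rd d (T x) x \<le> \<tau>"
    using finite_net[OF A r(3)] by metis
  obtain G T' where G: "finite G" "G \<subseteq> B" "T' \<in> measurable (Rd d) (count_space G)"
    "\<And>x. x \<in> B \<Longrightarrow> dist_Rd d (T' x) x \<le> \<tau>"
    using finite_net[OF B r(3)] by metis
  show thesis
    by (rule that[of F G T T'], intro truncation.intro truncation_axioms.intro divergence.intro)
       (use div eps A B r Z F G radial_cost_axioms in auto)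
qed

section \<open>Measurability of the empirical value, and the error estimate\<close>

locale ot_samples = radial_cost d c p C\<^sub>p h + divergence \<phi> t\<^sub>0 \<delta> C\<^sub>\<psi> \<gamma>
    + X: sample P \<mu> n X + Y: sample P \<nu> n Y
  for d c p C\<^sub>p h \<phi> t\<^sub>0 \<delta> C\<^sub>\<psi> \<gamma> and P :: "'w measure"
    and \<mu> \<nu> :: "(nat \<Rightarrow> real) measure" and n X Y +
  fixes \<epsilon> :: real
  assumes eps: "\<epsilon> > 0" and mu: "prob_on_Rd d \<mu>" and nu: "prob_on_Rd d \<nu>"
    and ind: "indep_samples P \<mu> \<nu> n X Y"
begin

lemma sets_eq: "sets \<mu> = sets (Rd d)" "sets \<nu> = sets (Rd d)"
  and space_eq: "space \<mu> = space (Rd d)" "space \<nu> = space (Rd d)"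
  and prob: "prob_space \<mu>" "prob_space \<nu>"
  using mu nu sets_eq_imp_space_eq[of \<mu> "Rd d"] sets_eq_imp_space_eq[of \<nu> "Rd d"]
  by (auto simp: prob_on_Rd_def)

abbreviation \<mu>' where "\<mu>' \<omega> \<equiv> empirical_measure \<mu> n (\<lambda>l. X l \<omega>)"
abbreviation \<nu>' where "\<nu>' \<omega> \<equiv> empirical_measure \<nu> n (\<lambda>l. Y l \<omega>)"

lemma prob_empirical:
  assumes "\<omega> \<in> space P" shows "prob_space (\<mu>' \<omega>)" "prob_space (\<nu>' \<omega>)"
  using assms X.Y_space Y.Y_space X.n_pos by (auto intro: prob_space_empirical_measure)

context
  fixes A B F G Z Z' T T' r r' \<tau>
  assumes tr: "truncation d c p C\<^sub>p h \<phi> t\<^sub>0 \<delta> C\<^sub>\<psi> \<gamma> \<epsilon> A B F G Z Z' T T' r r' \<tau>"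
begin

interpretation tr: truncation d c p C\<^sub>p h \<phi> t\<^sub>0 \<delta> C\<^sub>\<psi> \<gamma> \<epsilon> A B F G Z Z' T T' r r' \<tau>
  by (rule tr)

lemma finite_sampling_truncation:
  "finite_sampling \<phi> t\<^sub>0 \<delta> C\<^sub>\<psi> \<gamma> (F \<union> Z) (G \<union> Z') tr.k tr.K \<epsilon> \<mu> \<nu> T T' (\<lambda>x y. tr.k (T x) (T' y)) P n X Y"
  by (intro finite_sampling.intro finite_sampling_axioms.intro tr.finite_transport prob sets_eq ind
      X.sample_axioms Y.sample_axioms)

lemma excess_empirical_finite:
  assumes "\<omega> \<in> space P"
  shows "tr.excess_mass A (\<mu>' \<omega>) < \<infinity>" "tr.excess_mass B (\<nu>' \<omega>) < \<infinity>"
proof -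
  have fin: "ennreal (1 / n) * tr.excess S x < top" for S x
    by (auto simp: tr.excess_def ennreal_mult_less_top indicator_def)
  have "tr.excess A \<in> borel_measurable \<mu>" "tr.excess B \<in> borel_measurable \<nu>"
    using tr.excess_measurable[OF tr.A(1)] tr.excess_measurable[OF tr.B(1)]
      measurable_cong_sets[OF sets_eq(1) refl] measurable_cong_sets[OF sets_eq(2) refl] by auto
  then show "tr.excess_mass A (\<mu>' \<omega>) < \<infinity>" "tr.excess_mass B (\<nu>' \<omega>) < \<infinity>"
    using fin X.Y_space[OF _ assms] Y.Y_space[OF _ assms]
    by (simp_all add: nn_integral_empirical_measure ennreal_sum_less_top)
qed

lemma reg_OT_empirical_approx:
  assumes "\<omega> \<in> space P"
  obtains s where "reg_OT c \<phi> \<epsilon> (\<mu>' \<omega>) (\<nu>' \<omega>) = ereal s"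
    "ennreal \<bar>s - tr.discretized_value (\<mu>' \<omega>) (\<nu>' \<omega>)\<bar>
      \<le> ennreal (2 * tr.L * \<tau>) + tr.excess_mass A (\<mu>' \<omega>) + tr.excess_mass B (\<nu>' \<omega>)"
  using tr.reg_OT_approx[OF prob_empirical[OF assms] _ _ excess_empirical_finite[OF assms]] sets_eq
  by auto

lemma discretized_value_empirical_measurable:
  "(\<lambda>\<omega>. tr.discretized_value (\<mu>' \<omega>) (\<nu>' \<omega>)) \<in> borel_measurable P"
  by (rule finite_sampling.optimal_value_empirical_measurable[OF finite_sampling_truncation])

end

text \<open>Serves measurability only, so there are no covering centers, and radius and accuracy are
  both tied to \<open>m\<close>. Once all sample points lie in the ball, the excess vanishes and the
  net error alone remains.\<close>

lemma reg_OT_empirical_finite_approx: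
  obtains V where "V \<in> borel_measurable P"
    "\<And>\<omega>. \<omega> \<in> space P \<Longrightarrow> \<exists>s. reg_OT c \<phi> \<epsilon> (\<mu>' \<omega>) (\<nu>' \<omega>) = ereal s \<and>
      ((\<forall>l<n. norm_Rd d (X l \<omega>) < real (Suc m) \<and> norm_Rd d (Y l \<omega>) < real (Suc m)) \<longrightarrow> \<bar>s - V \<omega>\<bar> \<le> 1 / real (Suc m))"
proof -
  define \<rho> where "\<rho> = real (Suc m)"
  define A where "A = ball_Rd d (zero_Rd d) \<rho>"
  have "\<rho> > 0" by (simp add: \<rho>_def)
  have A: "A \<in> sets (Rd d)" "A \<subseteq> ball_Rd d (zero_Rd d) \<rho>" "A \<noteq> {}"
    using ball_Rd_sets[OF zero_Rd_space, of d \<rho>] zero_Rd_space[of d] \<open>\<rho> > 0\<close>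
    by (auto simp: A_def ball_Rd_def)
  define L where "L = C\<^sub>p * (\<rho> + \<rho>) powr (p - 1)"
  have "L > 0" using C_pos \<open>\<rho> > 0\<close> by (simp add: L_def)
  \<comment> \<open>Chosen to make the net error \<open>2 * L * \<tau>\<close> equal to
    \<open>1 / \<rho>\<close>.\<close>
  define \<tau> where "\<tau> = 1 / (2 * L * \<rho>)"
  have "\<tau> > 0" using \<open>L > 0\<close> \<open>\<rho> > 0\<close> by (simp add: \<tau>_def)
  obtain F G T T' where tr: "truncation d c p C\<^sub>p h \<phi> t\<^sub>0 \<delta> C\<^sub>\<psi> \<gamma> \<epsilon> A A F G {} {} T T' \<rho> \<rho> \<tau>"
    using ex_truncation[OF divergence eps A A \<open>\<rho> > 0\<close> \<open>\<rho> > 0\<close> \<open>\<tau> > 0\<close>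
        finite.emptyI empty_subsetI finite.emptyI empty_subsetI] by metis
  interpret tr: truncation d c p C\<^sub>p h \<phi> t\<^sub>0 \<delta> C\<^sub>\<psi> \<gamma> \<epsilon> A A F G "{}" "{}" T T' \<rho> \<rho> \<tau> by (rule tr)
  have D: "2 * tr.L * \<tau> = 1 / \<rho>"
    unfolding tr.L_def tr.R_def L_def[symmetric] \<tau>_def using \<open>L > 0\<close> by simp
  show thesis
  proof (rule that[OF discretized_value_empirical_measurable[OF tr]])
    fix \<omega> assume \<omega>: "\<omega> \<in> space P"
    obtain s where s: "reg_OT c \<phi> \<epsilon> (\<mu>' \<omega>) (\<nu>' \<omega>) = ereal s"
      "ennreal \<bar>s - tr.discretized_value (\<mu>' \<omega>) (\<nu>' \<omega>)\<bar>
        \<le> ennreal (1 / \<rho>) + tr.excess_mass A (\<mu>' \<omega>) + tr.excess_mass A (\<nu>' \<omega>)"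
      using reg_OT_empirical_approx[OF tr \<omega>] unfolding D by metis
    have "\<bar>s - tr.discretized_value (\<mu>' \<omega>) (\<nu>' \<omega>)\<bar> \<le> 1 / real (Suc m)"
      if small: "\<forall>l<n. norm_Rd d (X l \<omega>) < real (Suc m) \<and> norm_Rd d (Y l \<omega>) < real (Suc m)"
    proof -
      have meas: "tr.excess A \<in> borel_measurable \<mu>" "tr.excess A \<in> borel_measurable \<nu>"
        using tr.excess_measurable[OF tr.A(1)]
          measurable_cong_sets[OF sets_eq(1) refl] measurable_cong_sets[OF sets_eq(2) refl] by auto
      have "tr.excess A (X l \<omega>) = 0" "tr.excess A (Y l \<omega>) = 0" if "l < n" for l
        unfolding tr.excess_def using small that X.Y_space[OF that \<omega>] Y.Y_space[OF that \<omega>] space_eq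
        by (auto simp: A_def ball_Rd_def \<rho>_def)
      then have "tr.excess_mass A (\<mu>' \<omega>) = 0" "tr.excess_mass A (\<nu>' \<omega>) = 0"
        using nn_integral_empirical_measure[OF _ meas(1), of n "\<lambda>l. X l \<omega>"]
          nn_integral_empirical_measure[OF _ meas(2), of n "\<lambda>l. Y l \<omega>"] X.Y_space[OF _ \<omega>] Y.Y_space[OF _ \<omega>]
        by simp_all
      then show ?thesis using s(2) \<open>\<rho> > 0\<close> by (simp add: \<rho>_def)
    qed
    then show "\<exists>s. reg_OT c \<phi> \<epsilon> (\<mu>' \<omega>) (\<nu>' \<omega>) = ereal s \<and>
      ((\<forall>l<n. norm_Rd d (X l \<omega>) < real (Suc m) \<and> norm_Rd d (Y l \<omega>) < real (Suc m)) \<longrightarrow>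
        \<bar>s - tr.discretized_value (\<mu>' \<omega>) (\<nu>' \<omega>)\<bar> \<le> 1 / real (Suc m))"
      using s(1) by blast
  qed
qed

text \<open>For each \<open>\<omega>\<close> the finitely many sample points lie in all sufficiently
  large balls, so the value is a pointwise limit of measurable functions.\<close>

lemma reg_OT_empirical_measurable:
  "(\<lambda>\<omega>. real_of_ereal (reg_OT c \<phi> \<epsilon> (\<mu>' \<omega>) (\<nu>' \<omega>))) \<in> borel_measurable P"
proof -
  let ?s = "\<lambda>\<omega>. real_of_ereal (reg_OT c \<phi> \<epsilon> (\<mu>' \<omega>) (\<nu>' \<omega>))"
  have "\<exists>V. V \<in> borel_measurable P \<and> (\<forall>\<omega>\<in>space P.
      (\<forall>l<n. norm_Rd d (X l \<omega>) < real (Suc m) \<and> norm_Rd d (Y l \<omega>) < real (Suc m)) \<longrightarrow> \<bar>?s \<omega> - V \<omega>\<bar> \<le> 1 / real (Suc m))" for m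
  proof -
    obtain V where "V \<in> borel_measurable P"
      and V: "\<And>\<omega>. \<omega> \<in> space P \<Longrightarrow> \<exists>s. reg_OT c \<phi> \<epsilon> (\<mu>' \<omega>) (\<nu>' \<omega>) = ereal s \<and>
      ((\<forall>l<n. norm_Rd d (X l \<omega>) < real (Suc m) \<and> norm_Rd d (Y l \<omega>) < real (Suc m)) \<longrightarrow> \<bar>s - V \<omega>\<bar> \<le> 1 / real (Suc m))"
      using reg_OT_empirical_finite_approx[of m] by blast
    moreover have "\<bar>?s \<omega> - V \<omega>\<bar> \<le> 1 / real (Suc m)"
      if "\<omega> \<in> space P" "\<forall>l<n. norm_Rd d (X l \<omega>) < real (Suc m) \<and> norm_Rd d (Y l \<omega>) < real (Suc m)" for \<omega>
      using V[OF that(1)] that(2) by (metis real_of_ereal.simps(1))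
    ultimately show ?thesis by blast
  qed
  then obtain V where V: "\<And>m. V m \<in> borel_measurable P"
    "\<And>m \<omega>. \<omega> \<in> space P \<Longrightarrow> (\<forall>l<n. norm_Rd d (X l \<omega>) < real (Suc m) \<and> norm_Rd d (Y l \<omega>) < real (Suc m))
       \<Longrightarrow> \<bar>?s \<omega> - V m \<omega>\<bar> \<le> 1 / real (Suc m)"
    by metis
  show ?thesis
  proof (rule borel_measurable_LIMSEQ_real[OF _ V(1)])
    fix \<omega> assume \<omega>: "\<omega> \<in> space P"
    define m0 where "m0 = nat \<lceil>Max ((\<lambda>l. norm_Rd d (X l \<omega>) + norm_Rd d (Y l \<omega>)) ` {..<n})\<rceil>"
    have small: "\<forall>l<n. norm_Rd d (X l \<omega>) < real (Suc m) \<and> norm_Rd d (Y l \<omega>) < real (Suc m)" if "m \<ge> m0" for m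
    proof (intro allI impI)
      fix l assume "l < n"
      then have "norm_Rd d (X l \<omega>) + norm_Rd d (Y l \<omega>) \<le> Max ((\<lambda>l. norm_Rd d (X l \<omega>) + norm_Rd d (Y l \<omega>)) ` {..<n})"
        by (intro Max_ge) auto
      also have "\<dots> \<le> real m0" by (simp add: m0_def real_nat_ceiling_ge)
      also have "\<dots> < real (Suc m)" using that by simp
      finally show "norm_Rd d (X l \<omega>) < real (Suc m) \<and> norm_Rd d (Y l \<omega>) < real (Suc m)"
        using dist_Rd_nonneg[of d "zero_Rd d" "X l \<omega>"] dist_Rd_nonneg[of d "zero_Rd d" "Y l \<omega>"] by linarith
    qed
    have "(\<lambda>m. V m \<omega> - ?s \<omega>) \<longlonglongrightarrow> 0"
    proof (rule Lim_null_comparison)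
      show "\<forall>\<^sub>F m in sequentially. norm (V m \<omega> - ?s \<omega>) \<le> 1 / real (Suc m)"
        unfolding eventually_sequentially
      proof (intro exI allI impI)
        fix m assume "m0 \<le> m"
        then show "norm (V m \<omega> - ?s \<omega>) \<le> 1 / real (Suc m)"
          using V(2)[OF \<omega> small, of m] by (simp add: abs_minus_commute)
      qed
      show "(\<lambda>m. 1 / real (Suc m)) \<longlonglongrightarrow> 0"
        using LIMSEQ_inverse_real_of_nat by (simp add: inverse_eq_divide)
    qed
    then show "(\<lambda>m. V m \<omega>) \<longlonglongrightarrow> ?s \<omega>" by (simp add: LIM_zero_iff)
  qed
qed

end

definition tail_const :: "real \<Rightarrow> real \<Rightarrow> real" where
  "tail_const \<alpha> p = (4 * (p / \<alpha>)) powr (p / \<alpha>) * (2 * exp (1/2) / (1 - exp (- (1/2))))"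

lemma tail_const_nonneg: "0 \<le> tail_const \<alpha> p"
  by (simp add: tail_const_def)

text \<open>The origin of the bound \<open>5\<close> on \<open>n\<close>: it makes the mass
  \<open>2 / sqrt n\<close> outside the ball smaller than \<open>1\<close>. Nonemptiness is what
  nets and a positive covering number require.\<close>

lemma (in tails) ball_spt_nonempty:
  assumes "n \<ge> 5" shows "ball_Rd d (zero_Rd d) r \<inter> spt d \<mu> \<noteq> {}"
proof
  assume empty: "ball_Rd d (zero_Rd d) r \<inter> spt d \<mu> = {}"
  have "AE x in \<mu>. x \<in> {x\<in>space \<mu>. r \<le> norm_Rd d x}"
    using AE_spt[OF \<mu>] AE_space
    by eventually_elim (use empty in \<open>auto simp: ball_Rd_def space_mu\<close>)
  then have "measure \<mu> {x\<in>space \<mu>. r \<le> norm_Rd d x} = 1"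
    by (subst prob_eq_1) auto
  then have "1 \<le> 2 / sqrt n" using outside_prob by simp
  then have "sqrt n \<le> 2" using assms by (simp add: field_simps)
  then have "real n \<le> 2\<^sup>2" by (rule sqrt_le_D)
  then show False using assms by simp
qed

lemma (in tails) nn_integral_outside:
  assumes q: "0 \<le> q" and \<rho>: "0 \<le> \<rho>"
  shows "(\<integral>\<^sup>+x. ennreal (q * (\<rho> + norm_Rd d x powr p)) * indicator (space (Rd d) - ball_Rd d (zero_Rd d) r \<inter> spt d \<mu>) x \<partial>\<mu>)
    \<le> ennreal (q * (2 * \<rho> + tail_const \<alpha> p * c\<^sub>\<mu> powr (- (p / \<alpha>))) / sqrt n)"
proof -
  let ?S = "{x\<in>space \<mu>. r \<le> norm_Rd d x}"
  have S: "?S \<in> sets \<mu>" by measurable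
  have "(\<integral>\<^sup>+x. ennreal (q * (\<rho> + norm_Rd d x powr p)) * indicator (space (Rd d) - ball_Rd d (zero_Rd d) r \<inter> spt d \<mu>) x \<partial>\<mu>)
      = (\<integral>\<^sup>+x. ennreal (q * \<rho>) * indicator ?S x + ennreal q * (ennreal (norm_Rd d x powr p) * indicator ?S x) \<partial>\<mu>)"
  proof (rule nn_integral_cong_AE)
    show "AE x in \<mu>. ennreal (q * (\<rho> + norm_Rd d x powr p)) * indicator (space (Rd d) - ball_Rd d (zero_Rd d) r \<inter> spt d \<mu>) x
      = ennreal (q * \<rho>) * indicator ?S x + ennreal q * (ennreal (norm_Rd d x powr p) * indicator ?S x)"
      using AE_spt[OF \<mu>] AE_space
      by eventually_elim
         (use q \<rho> in \<open>auto simp: ball_Rd_def space_mu indicator_def distrib_left ennreal_plus ennreal_mult\<close>)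
  qed
  also have "\<dots> = ennreal (q * \<rho>) * emeasure \<mu> ?S + ennreal q * (\<integral>\<^sup>+x. ennreal (norm_Rd d x powr p) * indicator ?S x \<partial>\<mu>)"
    using S by (simp add: nn_integral_add nn_integral_cmult nn_integral_cmult_indicator)
  also have "\<dots> \<le> ennreal (q * \<rho>) * ennreal (2 / sqrt n)
      + ennreal q * ennreal (tail_const \<alpha> p * c\<^sub>\<mu> powr (- (p / \<alpha>)) / sqrt n)"
    using outside_prob outside_moment unfolding tail_const_def
    by (intro add_mono mult_left_mono) (auto simp: emeasure_eq_measure intro: ennreal_leI)
  also have "\<dots> = ennreal (q * \<rho> * (2 / sqrt n) + q * (tail_const \<alpha> p * c\<^sub>\<mu> powr (- (p / \<alpha>)) / sqrt n))"
  proof -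
    have "0 \<le> q * \<rho>" "0 \<le> 2 / sqrt (real n)" "0 \<le> tail_const \<alpha> p * c\<^sub>\<mu> powr (- (p / \<alpha>)) / sqrt n"
      using q \<rho> tail_const_nonneg[of \<alpha> p] by auto
    with q show ?thesis by (simp only: ennreal_plus ennreal_mult mult_nonneg_nonneg)
  qed
  also have "q * \<rho> * (2 / sqrt n) + q * (tail_const \<alpha> p * c\<^sub>\<mu> powr (- (p / \<alpha>)) / sqrt n)
      = q * (2 * \<rho> + tail_const \<alpha> p * c\<^sub>\<mu> powr (- (p / \<alpha>))) / sqrt n"
    by (simp add: distrib_left add_divide_distrib)
  finally show ?thesis .
qed

context ot_samples
begin

text \<open>A triangle inequality through the two discretized values. The approximation error is
  counted twice, once for the population and once, in the mean, for the samples. Here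
  \<open>R\<close> stands for the p-th power of the sum of the radii.\<close>

lemma nn_integral_reg_OT_diff:
  fixes c\<^sub>\<mu> c\<^sub>\<nu> \<alpha>\<^sub>\<mu> \<alpha>\<^sub>\<nu> :: real
  assumes tail_mu: "tail_assumption d \<mu> c\<^sub>\<mu> \<alpha>\<^sub>\<mu>" and tail_nu: "tail_assumption d \<nu> c\<^sub>\<nu> \<alpha>\<^sub>\<nu>" and n: "n \<ge> 5"
  defines "\<delta>' \<equiv> min \<delta> (t\<^sub>0 / 2)" and "r\<^sub>\<mu> \<equiv> trunc_radius p c\<^sub>\<mu> \<alpha>\<^sub>\<mu> n" and "r\<^sub>\<nu> \<equiv> trunc_radius p c\<^sub>\<nu> \<alpha>\<^sub>\<nu> n"
  defines "B\<^sub>\<mu> \<equiv> ball_Rd d (zero_Rd d) r\<^sub>\<mu> \<inter> spt d \<mu>" and "B\<^sub>\<nu> \<equiv> ball_Rd d (zero_Rd d) r\<^sub>\<nu> \<inter> spt d \<nu>"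
    and "\<eta> \<equiv> \<delta>' * \<epsilon> / (2 * C\<^sub>p * (r\<^sub>\<mu> + r\<^sub>\<nu>) powr (p - 1))" and "R \<equiv> (r\<^sub>\<mu> + r\<^sub>\<nu>) powr p"
    and "q \<equiv> C\<^sub>p * (1 + 3 powr p)"
  shows "(\<integral>\<^sup>+\<omega>. e2ennreal \<bar>reg_OT c \<phi> \<epsilon> (\<mu>' \<omega>) (\<nu>' \<omega>) - reg_OT c \<phi> \<epsilon> \<mu> \<nu>\<bar> \<partial>P)
    \<le> ennreal ((2 * (C\<^sub>p * R + q * (2 * R + tail_const \<alpha>\<^sub>\<mu> p * c\<^sub>\<mu> powr (- (p / \<alpha>\<^sub>\<mu>)))
          + q * (2 * R + tail_const \<alpha>\<^sub>\<nu> p * c\<^sub>\<nu> powr (- (p / \<alpha>\<^sub>\<nu>))))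
        + 11 * (\<epsilon> * t\<^sub>0 + C\<^sub>p * R) * sqrt (1 + (1 + exp (C\<^sub>\<psi> * \<delta>' / (t\<^sub>0 / 2) powr \<gamma>)
            * real (min (covering_number d B\<^sub>\<mu> \<eta>) (covering_number d B\<^sub>\<nu> \<eta>))))) / sqrt n)" (is "?err \<le> ?bound")
    and "covering_number d B\<^sub>\<mu> \<eta> > 0" "covering_number d B\<^sub>\<nu> \<eta> > 0"
    and "(\<lambda>\<omega>. e2ennreal \<bar>reg_OT c \<phi> \<epsilon> (\<mu>' \<omega>) (\<nu>' \<omega>) - reg_OT c \<phi> \<epsilon> \<mu> \<nu>\<bar>) \<in> borel_measurable P" (is "?meas")
proof -
  interpret tm: tails d \<mu> c\<^sub>\<mu> \<alpha>\<^sub>\<mu> p n by unfold_locales (use mu tail_mu p n in auto)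
  interpret tn: tails d \<nu> c\<^sub>\<nu> \<alpha>\<^sub>\<nu> p n by unfold_locales (use nu tail_nu p n in auto)
  have r_pos: "r\<^sub>\<mu> > 0" "r\<^sub>\<nu> > 0" using tm.r_pos tn.r_pos by (auto simp: r\<^sub>\<mu>_def r\<^sub>\<nu>_def)
  have n_pos: "real n > 0" using n by simp
  define L where "L = C\<^sub>p * (r\<^sub>\<mu> + r\<^sub>\<nu>) powr (p - 1)"
  have L: "L > 0" using C_pos r_pos by (simp add: L_def)
  have R: "R > 0" using r_pos by (simp add: R_def)
  have q: "q > 0" using C_pos by (auto simp: q_def intro!: mult_pos_pos add_pos_nonneg)
  have "\<delta>' > 0" using delta_pos t0_pos by (simp add: \<delta>'_def)
  \<comment> \<open>The covering radius is exactly the one whose Lipschitz image meets the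
    hypothesis of the density bound.\<close>
  then have \<eta>: "\<eta> > 0" and L\<eta>: "L * \<eta> = \<delta>' * \<epsilon> / 2"
    using eps C_pos r_pos by (auto simp: \<eta>_def L_def)
  \<comment> \<open>Makes the net error \<open>C\<^sub>p * R / sqrt n\<close>, of the order of the
    terms that are present anyway.\<close>
  define \<tau> where "\<tau> = C\<^sub>p * R / (2 * L * sqrt n)"
  have tau: "\<tau> > 0" using C_pos R L n_pos by (simp add: \<tau>_def)
  have Bm: "B\<^sub>\<mu> \<in> sets (Rd d)" "B\<^sub>\<mu> \<subseteq> ball_Rd d (zero_Rd d) r\<^sub>\<mu>" "B\<^sub>\<mu> \<noteq> {}"
    using ball_Rd_sets[OF zero_Rd_space] spt_sets[OF mu] tm.ball_spt_nonempty[OF n] by (auto simp: B\<^sub>\<mu>_def r\<^sub>\<mu>_def)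
  have Bn: "B\<^sub>\<nu> \<in> sets (Rd d)" "B\<^sub>\<nu> \<subseteq> ball_Rd d (zero_Rd d) r\<^sub>\<nu>" "B\<^sub>\<nu> \<noteq> {}"
    using ball_Rd_sets[OF zero_Rd_space] spt_sets[OF nu] tn.ball_spt_nonempty[OF n] by (auto simp: B\<^sub>\<nu>_def r\<^sub>\<nu>_def)
  show "covering_number d B\<^sub>\<mu> \<eta> > 0" "covering_number d B\<^sub>\<nu> \<eta> > 0"
    using covering_number_pos[OF Bm(2,3) \<eta>] covering_number_pos[OF Bn(2,3) \<eta>] by auto
  obtain Z where Z: "finite Z" "card Z \<le> covering_number d B\<^sub>\<mu> \<eta>" "Z \<subseteq> space (Rd d)"
    "\<And>x. x \<in> B\<^sub>\<mu> \<Longrightarrow> \<exists>z\<in>Z. dist_Rd d z x < \<eta>"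
    using covering_number_cover[OF Bm(2) \<eta>] by metis
  obtain Z' where Z': "finite Z'" "card Z' \<le> covering_number d B\<^sub>\<nu> \<eta>" "Z' \<subseteq> space (Rd d)"
    "\<And>x. x \<in> B\<^sub>\<nu> \<Longrightarrow> \<exists>z\<in>Z'. dist_Rd d z x < \<eta>"
    using covering_number_cover[OF Bn(2) \<eta>] by metis
  obtain F G T T' where tr: "truncation d c p C\<^sub>p h \<phi> t\<^sub>0 \<delta> C\<^sub>\<psi> \<gamma> \<epsilon> B\<^sub>\<mu> B\<^sub>\<nu> F G Z Z' T T' r\<^sub>\<mu> r\<^sub>\<nu> \<tau>"
    using ex_truncation[OF divergence eps Bm Bn r_pos tau Z(1,3) Z'(1,3)] by metis
  interpret tr: truncation d c p C\<^sub>p h \<phi> t\<^sub>0 \<delta> C\<^sub>\<psi> \<gamma> \<epsilon> B\<^sub>\<mu> B\<^sub>\<nu> F G Z Z' T T' r\<^sub>\<mu> r\<^sub>\<nu> \<tau> by (rule tr)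
  interpret fs: finite_sampling \<phi> t\<^sub>0 \<delta> C\<^sub>\<psi> \<gamma> "F \<union> Z" "G \<union> Z'" tr.k tr.K \<epsilon> \<mu> \<nu> T T' "\<lambda>x y. tr.k (T x) (T' y)" P n X Y
    by (rule finite_sampling_truncation[OF tr])
  have trL: "tr.L = L" and trK: "tr.K = C\<^sub>p * R" by (simp_all add: tr.L_def tr.K_def tr.R_def L_def R_def)
  have Lt: "2 * tr.L * \<tau> = C\<^sub>p * R / sqrt n" unfolding trL \<tau>_def using L by simp
  define E where "E = exp (C\<^sub>\<psi> * \<delta>' / (t\<^sub>0 / 2) powr \<gamma>)"
  define N where "N = min (covering_number d B\<^sub>\<mu> \<eta>) (covering_number d B\<^sub>\<nu> \<eta>)"
  let ?V = "tr.discretized_value \<mu> \<nu>"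
  let ?V' = "\<lambda>\<omega>. tr.discretized_value (\<mu>' \<omega>) (\<nu>' \<omega>)"
  have main: "(\<integral>\<^sup>+\<omega>. ennreal \<bar>?V' \<omega> - ?V\<bar> \<partial>P) \<le> ennreal (11 * (\<epsilon> * t\<^sub>0 + C\<^sub>p * R) * sqrt (1 + (1 + E * real N)) / sqrt n)"
  proof (rule fs.nn_integral_optimal_value_diff[unfolded trK])
    fix f g assume pot: "tr.potentials fs.a fs.b f g"
    let ?S = "\<Sum>i\<in>F \<union> Z. fs.a i * (\<Sum>j\<in>G \<union> Z'. fs.b j * (\<psi>' (tr.slack f g i j))\<^sup>2)"
    have le: "1 + E * real (card Z) \<le> 1 + E * real (covering_number d B\<^sub>\<mu> \<eta>)"
      "1 + E * real (card Z') \<le> 1 + E * real (covering_number d B\<^sub>\<nu> \<eta>)"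
      using Z(2) Z'(2) by (auto simp: E_def)
    have "?S \<le> 1 + E * real (card Z)"
      unfolding E_def \<delta>'_def
    proof (rule tr.sum_density_squared_le[OF fs.weights pot])
      fix i assume "i \<in> F \<union> Z" "fs.a i \<noteq> 0"
      then have "i \<in> B\<^sub>\<mu>" using tr.law_nonzero[OF _ sets_eq(1)] tr.F by blast
      then obtain z where z: "z \<in> Z" "dist_Rd d z i < \<eta>" using Z(4) by blast
      have "\<bar>tr.k i j - tr.k z j\<bar> \<le> min \<delta> (t\<^sub>0 / 2) * \<epsilon> / 2" for j
        using tr.k_lipschitz(1)[of i j z] mult_left_mono[of "dist_Rd d i z" \<eta> L] z(2) L L\<eta>
        by (simp add: trL dist_Rd_sym[of d i z] \<delta>'_def)
      then show "\<exists>l\<in>Z. \<forall>j\<in>G \<union> Z'. \<bar>tr.k i j - tr.k l j\<bar> \<le> min \<delta> (t\<^sub>0 / 2) * \<epsilon> / 2" using z(1) by blast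
    qed simp
    moreover have "?S \<le> 1 + E * real (card Z')"
      unfolding E_def \<delta>'_def
    proof (rule tr.sum_density_squared_le_transposed[OF fs.weights pot])
      fix j assume "j \<in> G \<union> Z'" "fs.b j \<noteq> 0"
      then have "j \<in> B\<^sub>\<nu>" using tr.law'_nonzero[OF _ sets_eq(2)] tr.G by blast
      then obtain z where z: "z \<in> Z'" "dist_Rd d z j < \<eta>" using Z'(4) by blast
      have "\<bar>tr.k i j - tr.k i z\<bar> \<le> min \<delta> (t\<^sub>0 / 2) * \<epsilon> / 2" for i
        using tr.k_lipschitz(2)[of i j z] mult_left_mono[of "dist_Rd d j z" \<eta> L] z(2) L L\<eta>
        by (simp add: trL dist_Rd_sym[of d j z] \<delta>'_def)
      then show "\<exists>l\<in>Z'. \<forall>i\<in>F \<union> Z. \<bar>tr.k i j - tr.k i l\<bar> \<le> min \<delta> (t\<^sub>0 / 2) * \<epsilon> / 2" using z(1) by blast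
    qed simp
    ultimately show "?S \<le> 1 + E * real N"
      unfolding N_def min_def by (cases "covering_number d B\<^sub>\<mu> \<eta> \<le> covering_number d B\<^sub>\<nu> \<eta>") (use le in simp_all)
  qed
  have excess: "tr.excess S x = ennreal (q * (R + norm_Rd d x powr p)) * indicator (space (Rd d) - S) x" for S x
    by (simp only: tr.excess_def tr.R_def q_def R_def)
  have exc_mu: "tr.excess_mass B\<^sub>\<mu> \<mu> \<le> ennreal (q * (2 * R + tail_const \<alpha>\<^sub>\<mu> p * c\<^sub>\<mu> powr (- (p / \<alpha>\<^sub>\<mu>))) / sqrt n)"
    unfolding excess
    by (rule tm.nn_integral_outside[folded r\<^sub>\<mu>_def, folded B\<^sub>\<mu>_def]) (use q R in auto)
  have exc_nu: "tr.excess_mass B\<^sub>\<nu> \<nu> \<le> ennreal (q * (2 * R + tail_const \<alpha>\<^sub>\<nu> p * c\<^sub>\<nu> powr (- (p / \<alpha>\<^sub>\<nu>))) / sqrt n)"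
    unfolding excess
    by (rule tn.nn_integral_outside[folded r\<^sub>\<nu>_def, folded B\<^sub>\<nu>_def]) (use q R in auto)
  have exc_fin: "tr.excess_mass B\<^sub>\<mu> \<mu> < \<infinity>" "tr.excess_mass B\<^sub>\<nu> \<nu> < \<infinity>"
    using order.strict_trans1[OF exc_mu ennreal_less_top] order.strict_trans1[OF exc_nu ennreal_less_top] by auto
  obtain s where s: "reg_OT c \<phi> \<epsilon> \<mu> \<nu> = ereal s" "ennreal \<bar>s - ?V\<bar>
      \<le> ennreal (C\<^sub>p * R / sqrt n) + tr.excess_mass B\<^sub>\<mu> \<mu> + tr.excess_mass B\<^sub>\<nu> \<nu>"
    using tr.reg_OT_approx[OF prob sets_eq exc_fin] unfolding Lt by metis
  let ?s = "\<lambda>\<omega>. real_of_ereal (reg_OT c \<phi> \<epsilon> (\<mu>' \<omega>) (\<nu>' \<omega>))"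
  have s': "reg_OT c \<phi> \<epsilon> (\<mu>' \<omega>) (\<nu>' \<omega>) = ereal (?s \<omega>)" "ennreal \<bar>?s \<omega> - ?V' \<omega>\<bar>
      \<le> ennreal (C\<^sub>p * R / sqrt n) + tr.excess_mass B\<^sub>\<mu> (\<mu>' \<omega>) + tr.excess_mass B\<^sub>\<nu> (\<nu>' \<omega>)"
    if "\<omega> \<in> space P" for \<omega>
    using reg_OT_empirical_approx[OF tr that] unfolding Lt by (metis real_of_ereal.simps(1))+
  have err: "e2ennreal \<bar>reg_OT c \<phi> \<epsilon> (\<mu>' \<omega>) (\<nu>' \<omega>) - reg_OT c \<phi> \<epsilon> \<mu> \<nu>\<bar> = ennreal \<bar>?s \<omega> - s\<bar>"
    if "\<omega> \<in> space P" for \<omega>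
    unfolding s(1) by (subst s'(1)[OF that]) (rule e2ennreal_abs_diff)
  show ?meas
  proof (subst measurable_cong[OF err])
    show "(\<lambda>\<omega>. ennreal \<bar>?s \<omega> - s\<bar>) \<in> borel_measurable P"
      using reg_OT_empirical_measurable by measurable
  qed
  define a b v where "a = C\<^sub>p * R / sqrt n"
    and "b = q * (2 * R + tail_const \<alpha>\<^sub>\<mu> p * c\<^sub>\<mu> powr (- (p / \<alpha>\<^sub>\<mu>))) / sqrt n"
    and "v = q * (2 * R + tail_const \<alpha>\<^sub>\<nu> p * c\<^sub>\<nu> powr (- (p / \<alpha>\<^sub>\<nu>))) / sqrt n"
  define w where "w = 11 * (\<epsilon> * t\<^sub>0 + C\<^sub>p * R) * sqrt (1 + (1 + E * real N)) / sqrt n"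
  have nn: "0 \<le> a" "0 \<le> b" "0 \<le> v" "0 \<le> w"
    unfolding a_def b_def v_def w_def using C_pos R q tail_const_nonneg eps t0_pos
    by (auto intro!: divide_nonneg_nonneg mult_nonneg_nonneg add_nonneg_nonneg simp: E_def)
  have emu: "tr.excess B\<^sub>\<mu> \<in> borel_measurable \<mu>" "tr.excess B\<^sub>\<nu> \<in> borel_measurable \<nu>"
    using tr.excess_measurable[OF tr.A(1)] tr.excess_measurable[OF tr.B(1)]
      measurable_cong_sets[OF sets_eq(1) refl] measurable_cong_sets[OF sets_eq(2) refl] by auto
  note emp = X.nn_integral_empirical[OF emu(1)] Y.nn_integral_empirical[OF emu(2)]
  have V_meas: "(\<lambda>\<omega>. ennreal \<bar>?V' \<omega> - ?V\<bar>) \<in> borel_measurable P"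
    using discretized_value_empirical_measurable[OF tr] by measurable
  have "?err = (\<integral>\<^sup>+\<omega>. ennreal \<bar>?s \<omega> - s\<bar> \<partial>P)"
    by (rule nn_integral_cong[OF err])
  also have "\<dots> \<le> (\<integral>\<^sup>+\<omega>. ennreal a + tr.excess_mass B\<^sub>\<mu> (\<mu>' \<omega>) + tr.excess_mass B\<^sub>\<nu> (\<nu>' \<omega>)
      + ennreal \<bar>?V' \<omega> - ?V\<bar> + ennreal (a + b + v) \<partial>P)"
  proof (rule nn_integral_mono)
    fix \<omega> assume \<omega>: "\<omega> \<in> space P"
    have sV: "ennreal \<bar>s - ?V\<bar> \<le> ennreal (a + b + v)"
      using order.trans[OF s(2) add_mono[OF add_left_mono[OF exc_mu] exc_nu]] nn
      by (simp add: a_def b_def v_def ennreal_plus)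
    have "ennreal \<bar>?s \<omega> - s\<bar> \<le> ennreal (\<bar>?s \<omega> - ?V' \<omega>\<bar> + \<bar>?V' \<omega> - ?V\<bar> + \<bar>s - ?V\<bar>)"
      by (rule ennreal_leI) linarith
    also have "\<dots> = ennreal \<bar>?s \<omega> - ?V' \<omega>\<bar> + ennreal \<bar>?V' \<omega> - ?V\<bar> + ennreal \<bar>s - ?V\<bar>"
      by (simp add: ennreal_plus)
    also have "\<dots> \<le> ennreal a + tr.excess_mass B\<^sub>\<mu> (\<mu>' \<omega>) + tr.excess_mass B\<^sub>\<nu> (\<nu>' \<omega>)
      + ennreal \<bar>?V' \<omega> - ?V\<bar> + ennreal (a + b + v)"
      using s'(2)[OF \<omega>] sV unfolding a_def[symmetric] by (intro add_mono) auto
    finally show "ennreal \<bar>?s \<omega> - s\<bar> \<le> ennreal a + tr.excess_mass B\<^sub>\<mu> (\<mu>' \<omega>) + tr.excess_mass B\<^sub>\<nu> (\<nu>' \<omega>)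
      + ennreal \<bar>?V' \<omega> - ?V\<bar> + ennreal (a + b + v)" .
  qed
  also have "\<dots> = ennreal a + tr.excess_mass B\<^sub>\<mu> \<mu> + tr.excess_mass B\<^sub>\<nu> \<nu>
      + (\<integral>\<^sup>+\<omega>. ennreal \<bar>?V' \<omega> - ?V\<bar> \<partial>P) + ennreal (a + b + v)"
    using emp V_meas by (simp add: nn_integral_add X.emeasure_space_1 del: ennreal_plus)
  also have "\<dots> \<le> ennreal a + ennreal b + ennreal v + ennreal w + ennreal (a + b + v)"
    using exc_mu exc_nu main unfolding b_def[symmetric] v_def[symmetric] w_def[symmetric]
    by (intro add_mono) auto
  also have "\<dots> = ennreal (a + b + v + w + (a + b + v))"
    using nn by (simp only: ennreal_plus add_nonneg_nonneg)
  also have "a + b + v + w + (a + b + v) = 2 * (a + b + v) + w" by simp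
  also have "\<dots> = (2 * (C\<^sub>p * R + q * (2 * R + tail_const \<alpha>\<^sub>\<mu> p * c\<^sub>\<mu> powr (- (p / \<alpha>\<^sub>\<mu>)))
          + q * (2 * R + tail_const \<alpha>\<^sub>\<nu> p * c\<^sub>\<nu> powr (- (p / \<alpha>\<^sub>\<nu>))))
        + 11 * (\<epsilon> * t\<^sub>0 + C\<^sub>p * R) * sqrt (1 + (1 + E * real N))) / sqrt n"
    unfolding a_def b_def v_def w_def
    by (simp only: times_divide_eq_right add_divide_distrib[symmetric])
  finally show "?err \<le> ?bound"
    by (simp only: E_def N_def)
qed

end

text \<open>\<open>A\<close> is half of the exponent in the density bound, so the square root of
  \<open>exp (2 * A) * N\<close> is \<open>exp A * sqrt N\<close>. Tail moments go to the first
  summand on the right, all terms with \<open>R\<close> to the second.\<close>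

lemma sample_bound_arith:
  fixes R q m1 m2 k1 k2 :: real
  assumes nn: "0 \<le> R" "0 \<le> q" "0 \<le> k1" "0 \<le> k2" "0 \<le> m1" "0 \<le> m2" "0 \<le> \<epsilon>" "0 \<le> t\<^sub>0" "0 \<le> C\<^sub>p"
    and N: "1 \<le> N" and E: "0 \<le> A"
  shows "2 * (C\<^sub>p * R + q * (2 * R + k1 * m1) + q * (2 * R + k2 * m2))
      + 11 * (\<epsilon> * t\<^sub>0 + C\<^sub>p * R) * sqrt (1 + (1 + exp (2 * A) * N))
    \<le> (2 * C\<^sub>p + 8 * q + 2 * q * (k1 + k2) + 22 * (t\<^sub>0 + C\<^sub>p)) * (1 + m1 + m2)
      + (2 * C\<^sub>p + 8 * q + 2 * q * (k1 + k2) + 22 * (t\<^sub>0 + C\<^sub>p)) * (\<epsilon> + R) * (1 + exp A * sqrt N)"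
proof -
  define S where "S = 1 + exp A * sqrt N"
  have S1: "1 \<le> S" using N by (simp add: S_def)
  have "1 + (1 + exp (2 * A) * N) \<le> (2 * S)\<^sup>2"
  proof -
    have "exp (2 * A) = (exp A)\<^sup>2" by (simp add: exp_double)
    then have "(exp A * sqrt N)\<^sup>2 = exp (2 * A) * N" using N by (simp add: power_mult_distrib)
    moreover have "0 \<le> exp A * sqrt N" using N by simp
    moreover have "(2 * S)\<^sup>2 = 4 + 8 * (exp A * sqrt N) + 4 * (exp A * sqrt N)\<^sup>2"
      by (simp add: S_def power2_eq_square algebra_simps)
    moreover have "0 \<le> exp (2 * A) * N" using N by simp
    ultimately show ?thesis by linarith
  qed
  then have sq: "sqrt (1 + (1 + exp (2 * A) * N)) \<le> 2 * S"
    using S1 by (intro real_le_lsqrt) auto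
  have "\<epsilon> * t\<^sub>0 + C\<^sub>p * R \<le> (t\<^sub>0 + C\<^sub>p) * (\<epsilon> + R)"
    using nn by (simp add: algebra_simps)
  then have "11 * (\<epsilon> * t\<^sub>0 + C\<^sub>p * R) * sqrt (1 + (1 + exp (2 * A) * N)) \<le> (11 * ((t\<^sub>0 + C\<^sub>p) * (\<epsilon> + R))) * (2 * S)"
    using nn sq N by (intro mult_mono) auto
  also have "\<dots> = 22 * (t\<^sub>0 + C\<^sub>p) * (\<epsilon> + R) * S" by simp
  finally have 1: "11 * (\<epsilon> * t\<^sub>0 + C\<^sub>p * R) * sqrt (1 + (1 + exp (2 * A) * N)) \<le> 22 * (t\<^sub>0 + C\<^sub>p) * (\<epsilon> + R) * S" .
  have "(2 * C\<^sub>p + 8 * q) * R \<le> ((2 * C\<^sub>p + 8 * q) * (\<epsilon> + R)) * S"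
    using nn S1 mult_mono[of "(2 * C\<^sub>p + 8 * q) * R" "(2 * C\<^sub>p + 8 * q) * (\<epsilon> + R)" 1 S] by (simp add: mult_left_mono)
  moreover have "2 * q * (k1 * m1) + 2 * q * (k2 * m2) \<le> 2 * q * (k1 + k2) * (1 + m1 + m2)"
    using nn by (simp add: algebra_simps)
  moreover have "0 \<le> (2 * C\<^sub>p + 8 * q + 22 * (t\<^sub>0 + C\<^sub>p)) * (1 + m1 + m2)"
    "0 \<le> 2 * q * (k1 + k2) * (\<epsilon> + R) * S"
    using nn S1 by auto
  moreover have "2 * (C\<^sub>p * R + q * (2 * R + k1 * m1) + q * (2 * R + k2 * m2))
      = (2 * C\<^sub>p + 8 * q) * R + (2 * q * (k1 * m1) + 2 * q * (k2 * m2))"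
    by (simp add: algebra_simps)
  moreover have "(c1 + c2 + c3) * M + (c1 + c2 + c3) * e * S = c1 * e * S + c2 * M + (c1 + c3) * M + c2 * e * S + c3 * e * S"
    for c1 c2 c3 M e :: real by (simp add: algebra_simps)
  note this[of "2 * C\<^sub>p + 8 * q" "2 * q * (k1 + k2)" "22 * (t\<^sub>0 + C\<^sub>p)" "1 + m1 + m2" "\<epsilon> + R"]
  ultimately show ?thesis
    using 1 unfolding S_def[symmetric] by linarith
qed

theorem theorem2p5:
  fixes \<alpha>\<^sub>\<mu> \<alpha>\<^sub>\<nu> p C\<^sub>p t\<^sub>0 :: real
  shows "\<exists>C>0.
    \<forall>(d :: nat) (\<epsilon> :: real) \<mu> \<nu> c\<^sub>\<mu> c\<^sub>\<nu> c \<phi> \<delta> C\<^sub>\<psi> \<gamma>.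
      d \<ge> 1 \<longrightarrow> \<epsilon> > 0 \<longrightarrow>
      prob_on_Rd d \<mu> \<longrightarrow> prob_on_Rd d \<nu> \<longrightarrow>
      tail_assumption d \<mu> c\<^sub>\<mu> \<alpha>\<^sub>\<mu> \<longrightarrow> tail_assumption d \<nu> c\<^sub>\<nu> \<alpha>\<^sub>\<nu> \<longrightarrow>
      cost_assumption d c p C\<^sub>p \<longrightarrow>
      divergence_assumption \<phi> t\<^sub>0 \<delta> C\<^sub>\<psi> \<gamma> \<longrightarrow>
      (\<forall>n\<ge>5. \<forall>(P :: 'w measure) X Y.
        prob_space P \<longrightarrow>
        iid_sample P \<mu> n X \<longrightarrow> iid_sample P \<nu> n Y \<longrightarrow> indep_samples P \<mu> \<nu> n X Y \<longrightarrow>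
        (let \<delta>' = min \<delta> (t\<^sub>0 / 2);
             r\<^sub>\<mu> = trunc_radius p c\<^sub>\<mu> \<alpha>\<^sub>\<mu> n;
             r\<^sub>\<nu> = trunc_radius p c\<^sub>\<nu> \<alpha>\<^sub>\<nu> n;
             B\<^sub>\<mu> = ball_Rd d (zero_Rd d) r\<^sub>\<mu> \<inter> spt d \<mu>;
             B\<^sub>\<nu> = ball_Rd d (zero_Rd d) r\<^sub>\<nu> \<inter> spt d \<nu>;
             \<eta> = \<delta>' * \<epsilon> / (2 * C\<^sub>p * (r\<^sub>\<mu> + r\<^sub>\<nu>) powr (p - 1));
             err = (\<lambda>\<omega>. e2ennreal
               \<bar>reg_OT c \<phi> \<epsilon> (empirical_measure \<mu> n (\<lambda>i. X i \<omega>)) (empirical_measure \<nu> n (\<lambda>i. Y i \<omega>))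
                 - reg_OT c \<phi> \<epsilon> \<mu> \<nu>\<bar>)
         in err \<in> borel_measurable P \<and>
            (\<integral>\<^sup>+ \<omega>. err \<omega> \<partial>P) \<le> ennreal
              (C / sqrt (real n) * (1 + c\<^sub>\<mu> powr (- (p / \<alpha>\<^sub>\<mu>)) + c\<^sub>\<nu> powr (- (p / \<alpha>\<^sub>\<nu>)))
               + C / sqrt (real n) * (\<epsilon> + (r\<^sub>\<mu> + r\<^sub>\<nu>) powr p)
                 * (1 + exp (C\<^sub>\<psi> * \<delta>' / (2 * (t\<^sub>0 / 2) powr \<gamma>))
                        * sqrt (real (min (covering_number d B\<^sub>\<mu> \<eta>) (covering_number d B\<^sub>\<nu> \<eta>)))))))"
proof (cases "p \<ge> 1 \<and> C\<^sub>p > 0 \<and> t\<^sub>0 > 0")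
  \<comment> \<open>The constant is chosen before the assumptions are made, so parameters that
    violate them must be served as well; the claim is then vacuous.\<close>
  case False
  then show ?thesis
    by (intro exI[of _ 1]) (auto simp: cost_assumption_def divergence_assumption_def)
next
  case True
  then have p: "p \<ge> 1" and Cp: "C\<^sub>p > 0" and t0: "t\<^sub>0 > 0" by auto
  define q where "q = C\<^sub>p * (1 + 3 powr p)"
  define k\<^sub>\<mu> where "k\<^sub>\<mu> = tail_const \<alpha>\<^sub>\<mu> p"
  define k\<^sub>\<nu> where "k\<^sub>\<nu> = tail_const \<alpha>\<^sub>\<nu> p"
  \<comment> \<open>Built from the two tail exponents, \<open>p\<close>, \<open>C\<^sub>p\<close>
    and \<open>t\<^sub>0\<close> alone, since \<open>q\<close>, \<open>k\<^sub>\<mu>\<close> and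
    \<open>k\<^sub>\<nu>\<close> are.\<close>
  define C where "C = 2 * C\<^sub>p + 8 * q + 2 * q * (k\<^sub>\<mu> + k\<^sub>\<nu>) + 22 * (t\<^sub>0 + C\<^sub>p)"
  have q: "0 \<le> q" using Cp by (simp add: q_def)
  have k: "0 \<le> k\<^sub>\<mu>" "0 \<le> k\<^sub>\<nu>" by (simp_all add: k\<^sub>\<mu>_def k\<^sub>\<nu>_def tail_const_nonneg)
  have C: "C > 0" unfolding C_def using q k Cp t0 by (intro add_nonneg_pos add_nonneg_nonneg mult_nonneg_nonneg) auto
  show ?thesis
  proof (rule exI[of _ C], intro conjI C allI impI, goal_cases)
    case (1 d \<epsilon> \<mu> \<nu> c\<^sub>\<mu> c\<^sub>\<nu> c \<phi> \<delta> C\<^sub>\<psi> \<gamma> n P X Y)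
    obtain h where h: "continuous_on {0..} h" "\<forall>t\<ge>0. h t \<ge> 0" "h 0 = 0"
      "\<forall>x\<in>space (Rd d). \<forall>y\<in>space (Rd d). c x y = h (dist_Rd d x y)"
      "\<forall>t>0. \<forall>t'>0. \<bar>h t - h t'\<bar> \<le> C\<^sub>p * max t t' powr (p - 1) * \<bar>t - t'\<bar>"
      using 1 unfolding cost_assumption_def by blast
    interpret P: prob_space P by fact
    interpret ot_samples d c p C\<^sub>p h \<phi> t\<^sub>0 \<delta> C\<^sub>\<psi> \<gamma> P \<mu> \<nu> n X Y \<epsilon>
      by unfold_locales (use 1 h p Cp in auto)
    define A where "A = C\<^sub>\<psi> * min \<delta> (t\<^sub>0 / 2) / (2 * (t\<^sub>0 / 2) powr \<gamma>)"
    have A: "0 \<le> A" using C_psi_pos delta_pos t0 by (simp add: A_def)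
    have A2: "C\<^sub>\<psi> * min \<delta> (t\<^sub>0 / 2) / (t\<^sub>0 / 2) powr \<gamma> = 2 * A" by (simp add: A_def)
    define r\<^sub>\<mu> where "r\<^sub>\<mu> = trunc_radius p c\<^sub>\<mu> \<alpha>\<^sub>\<mu> n"
    define r\<^sub>\<nu> where "r\<^sub>\<nu> = trunc_radius p c\<^sub>\<nu> \<alpha>\<^sub>\<nu> n"
    define R where "R = (r\<^sub>\<mu> + r\<^sub>\<nu>) powr p"
    define \<eta> where "\<eta> = min \<delta> (t\<^sub>0 / 2) * \<epsilon> / (2 * C\<^sub>p * (r\<^sub>\<mu> + r\<^sub>\<nu>) powr (p - 1))"
    define N where "N = min (covering_number d (ball_Rd d (zero_Rd d) r\<^sub>\<mu> \<inter> spt d \<mu>) \<eta>)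
      (covering_number d (ball_Rd d (zero_Rd d) r\<^sub>\<nu> \<inter> spt d \<nu>) \<eta>)"
    note bound = nn_integral_reg_OT_diff[OF 1(5,6,9), folded r\<^sub>\<mu>_def r\<^sub>\<nu>_def, folded \<eta>_def R_def q_def, folded N_def k\<^sub>\<mu>_def k\<^sub>\<nu>_def, unfolded A2]
    have N: "1 \<le> real N" using bound(2,3) by (simp add: N_def)
    have le: "(2 * (C\<^sub>p * R + q * (2 * R + k\<^sub>\<mu> * c\<^sub>\<mu> powr (- (p / \<alpha>\<^sub>\<mu>))) + q * (2 * R + k\<^sub>\<nu> * c\<^sub>\<nu> powr (- (p / \<alpha>\<^sub>\<nu>))))
        + 11 * (\<epsilon> * t\<^sub>0 + C\<^sub>p * R) * sqrt (1 + (1 + exp (2 * A) * real N))) / sqrt n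
      \<le> C / sqrt n * (1 + c\<^sub>\<mu> powr (- (p / \<alpha>\<^sub>\<mu>)) + c\<^sub>\<nu> powr (- (p / \<alpha>\<^sub>\<nu>)))
        + C / sqrt n * (\<epsilon> + R) * (1 + exp A * sqrt N)"
      using divide_right_mono[OF sample_bound_arith[of R q k\<^sub>\<mu> k\<^sub>\<nu> "c\<^sub>\<mu> powr (- (p / \<alpha>\<^sub>\<mu>))" "c\<^sub>\<nu> powr (- (p / \<alpha>\<^sub>\<nu>))" \<epsilon> t\<^sub>0 C\<^sub>p "real N" A],
          of "sqrt n"] q k eps t0 Cp N A
      unfolding C_def[symmetric] by (simp add: R_def add_divide_distrib)
    show ?case
      unfolding Let_def r\<^sub>\<mu>_def[symmetric] r\<^sub>\<nu>_def[symmetric]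
      unfolding \<eta>_def[symmetric] R_def[symmetric] A_def[symmetric]
      unfolding N_def[symmetric]
      using bound(4) order.trans[OF bound(1) ennreal_leI[OF le]] by blast
  qed
qed

end
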